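(* In the hybrid human/AI control model described in the context, the optimal value function $V(q,\theta)$ is convex in $q$ for every $\theta\in\Theta$; that is, with $\Delta_q V(q,\theta)=V(q+1,\theta)-V(q,\theta)$, $$\Delta_q V(q+1,\theta)\ge\Delta_q V(q,\theta)\qquad\text{for all } q\in\mathbb{N}_0,\ \theta\in\Theta.$$
   Context: Model. Tasks arrive according to a Poisson process of rate $\lambda>0$, with arrival times $\tau_1<\tau_2<\dots$. The $n$-th task has a risk score $s_n\in[0,1]$, observed on arrival; the scores are i.i.d. with a distribution function $F_S$ on $[0,1]$ having a continuous density $f_S$ that is strictly positive on $(0,1)$. An exogenous reliability process $\theta(t)$ is an irreducible, ergodic continuous-time Markov chain on $\Theta=\{1,\dots,K\}$ with generator $Q=[q_{ij}]$ (so $q_{ii}=-\sum_{j\ne i}q_{ij}$). Arrivals, scores, service times and $\theta(t)$ are independent. Actions. At the arrival of the $n$-th task the controller observes the queue length $q(\tau_n^-)\in\mathbb{N}_0$, the regime $\theta(\tau_n^-)$ and $s_n$, and chooses $a_n\in\{0,1\}$. If $a_n=0$ (automate), the cost $c_{\mathrm{auto}}(s_n,\theta(\tau_n^-))$ is incurred and the queue is unchanged. If $a_n=1$ (escalate), the fixed cost $c_h>0$ is incurred and the queue length increases by $1$. Escalated tasks are served in a queue with infinite buffer and $m\geq 1$ parallel servers with independent exponential service times of rate $\mu>0$ each, so the total service rate with $n$ tasks in system is $\min(n,m)\mu$; $q(t)$ is the number of tasks in system. Cost assumptions. $h:\mathbb{N}_0\to\mathbb{R}_+$ is non-decreasing and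 convex with $h(0)=0$. $c_{\mathrm{auto}}:[0,1]\times\Theta\to\mathbb{R}_+$ satisfies: (i) for each fixed $\theta$, $c_{\mathrm{auto}}(\cdot,\theta)$ is strictly increasing, continuous and convex; (ii) for each fixed $s$, $c_{\mathrm{auto}}(s,\theta)$ is non-decreasing in $\theta$; (iii) for $s'>s$ and $\theta'>\theta$, $c_{\mathrm{auto}}(s',\theta')-c_{\mathrm{auto}}(s,\theta')\ge c_{\mathrm{auto}}(s',\theta)-c_{\mathrm{auto}}(s,\theta)$. Objective. A stationary Markovian policy is a (measurable) function $u:\mathbb{N}_0\times\Theta\times[0,1]\to\{0,1\}$, with $a_n=u(q(\tau_n^-),\theta(\tau_n^-),s_n)$. For a discount rate $\alpha>0$, $$J_u(q_0,\theta_0)=\mathbb{E}\Big[\int_0^\infty e^{-\alpha t}h(q(t))\,dt+\sum_{n\ge1}e^{-\alpha\tau_n}\big((1-a_n)c_{\mathrm{auto}}(s_n,\theta(\tau_n^-))+a_n c_h\big)\,\Big|\,q(0)=q_0,\theta(0)=\theta_0\Big],$$ and the optimal value function is $V(q,\theta)=\inf_u J_u(q,\theta)$, the infimum being over stationary Markovian policies. *)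

theory Defs
  imports "HOL-Probability.Probability"
begin

section \<open>Model data\<close>

record hybrid_params =
  arrival_rate :: real
  service_rate :: real
  servers :: nat
  discount_rate :: real
  num_regimes :: nat
  regime_gen :: "nat \<Rightarrow> nat \<Rightarrow> real"
  score_density :: "real \<Rightarrow> real"
  holding_cost :: "nat \<Rightarrow> real"
  auto_cost :: "real \<Rightarrow> nat \<Rightarrow> real"
  esc_cost :: real

definition regimes :: "hybrid_params \<Rightarrow> nat set" where
  "regimes P = {1..num_regimes P}"

definition generator_on :: "nat set \<Rightarrow> (nat \<Rightarrow> nat \<Rightarrow> real) \<Rightarrow> bool" where
  "generator_on S Q \<longleftrightarrow>
     (\<forall>i\<in>S. \<forall>j\<in>S. i \<noteq> j \<longrightarrow> 0 \<le> Q i j) \<and>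
     (\<forall>i\<in>S. Q i i = - (\<Sum>j\<in>S - {i}. Q i j))"

definition irreducible_on :: "nat set \<Rightarrow> (nat \<Rightarrow> nat \<Rightarrow> real) \<Rightarrow> bool" where
  "irreducible_on S Q \<longleftrightarrow>
     (\<forall>i\<in>S. \<forall>j\<in>S. (i, j) \<in> {(k, l). k \<in> S \<and> l \<in> S \<and> k \<noteq> l \<and> 0 < Q k l}\<^sup>*)"

text \<open>
  The regime chain has finitely many states, so it is ergodic as soon as it is irreducible.
  The continuity requirement on the score density concerns the open interval only, so that
  densities with singularities at the end points are not excluded.
\<close>

definition hybrid_model :: "hybrid_params \<Rightarrow> bool" where
  "hybrid_model P \<longleftrightarrow>
     0 < arrival_rate P \<and> 0 < service_rate P \<and> 1 \<le> servers P \<and> 0 < discount_rate P \<and>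
     1 \<le> num_regimes P \<and>
     generator_on (regimes P) (regime_gen P) \<and> irreducible_on (regimes P) (regime_gen P) \<and>
     continuous_on {0<..<1} (score_density P) \<and> (\<forall>s\<in>{0<..<1}. 0 < score_density P s) \<and>
     (\<integral>\<^sup>+s\<in>{0..1}. ennreal (score_density P s) \<partial>lborel) = 1 \<and>
     mono (holding_cost P) \<and> holding_cost P 0 = 0 \<and>
     (\<forall>n. holding_cost P (n + 1) - holding_cost P n
          \<le> holding_cost P (n + 2) - holding_cost P (n + 1)) \<and>
     (\<forall>i\<in>regimes P. \<forall>s\<in>{0..1}. 0 \<le> auto_cost P s i) \<and>
     (\<forall>i\<in>regimes P. strict_mono_on {0..1} (\<lambda>s. auto_cost P s i) \<and>
          continuous_on {0..1} (\<lambda>s. auto_cost P s i) \<and>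
          convex_on {0..1} (\<lambda>s. auto_cost P s i)) \<and>
     (\<forall>s\<in>{0..1}. mono_on (regimes P) (auto_cost P s)) \<and>
     (\<forall>s\<in>{0..1}. \<forall>s'\<in>{0..1}. \<forall>i\<in>regimes P. \<forall>i'\<in>regimes P. s < s' \<longrightarrow> i < i' \<longrightarrow>
          auto_cost P s' i - auto_cost P s i \<le> auto_cost P s' i' - auto_cost P s i') \<and>
     0 < esc_cost P"

section \<open>Primitive randomness\<close>

definition exp_law :: "real \<Rightarrow> real measure" where
  "exp_law r = density lborel (\<lambda>x. ennreal (exponential_density r x))"

definition score_law :: "hybrid_params \<Rightarrow> real measure" where
  "score_law P = density lborel (\<lambda>s. ennreal (score_density P s) * indicator {0..1} s)"

definition jump_law :: "hybrid_params \<Rightarrow> nat \<Rightarrow> nat pmf" where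
  "jump_law P i =
     (if regime_gen P i i = 0 then return_pmf i
      else embed_pmf (\<lambda>j. if j \<in> regimes P - {i}
                           then regime_gen P i j / (- regime_gen P i i) else 0))"

text \<open>
  A sample point \<open>(a, s, \<sigma>, e, \<xi>)\<close> consists of five independent i.i.d. sequences:
  interarrival times \<open>a\<close>, scores \<open>s\<close>, service times \<open>\<sigma>\<close> (indexed by the escalated tasks in
  order of arrival, the tasks present at time 0 coming first), unit exponentials \<open>e\<close> and random
  maps \<open>\<xi>\<close> on the regimes, the last two driving the regime process: \<open>\<xi> n i\<close> is the
  successor of regime \<open>i\<close> should the chain be in \<open>i\<close> after \<open>n\<close> jumps.
\<close>

type_synonym sample =
  "(nat \<Rightarrow> real) \<times> (nat \<Rightarrow> real) \<times> (nat \<Rightarrow> real) \<times> (nat \<Rightarrow> real) \<times> (nat \<Rightarrow> nat \<Rightarrow> nat)"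

definition sample_space :: "hybrid_params \<Rightarrow> sample measure" where
  "sample_space P =
     (\<Pi>\<^sub>M n\<in>UNIV. exp_law (arrival_rate P)) \<Otimes>\<^sub>M
     (\<Pi>\<^sub>M n\<in>UNIV. score_law P) \<Otimes>\<^sub>M
     (\<Pi>\<^sub>M n\<in>UNIV. exp_law (service_rate P)) \<Otimes>\<^sub>M
     (\<Pi>\<^sub>M n\<in>UNIV. exp_law 1) \<Otimes>\<^sub>M
     (\<Pi>\<^sub>M n\<in>UNIV. measure_pmf (Pi_pmf (regimes P) 0 (jump_law P)))"

section \<open>Arrivals and regimes\<close>

text \<open>Tasks are numbered from 0: \<open>arrival_time a n\<close> is \<open>\<tau>\<^sub>n\<^sub>+\<^sub>1\<close>.\<close>

definition arrival_time :: "(nat \<Rightarrow> real) \<Rightarrow> nat \<Rightarrow> real" where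
  "arrival_time a n = (\<Sum>k\<le>n. a k)"

text \<open>
  The regime process is the continuous-time Markov chain with the given generator, described by
  its jump chain and holding times: the sojourn in regime \<open>i\<close> is exponential with rate
  \<open>- regime_gen P i i\<close> (infinite if that rate is 0, by division in \<open>ennreal\<close>).
\<close>

primrec jump_chain :: "nat \<Rightarrow> (nat \<Rightarrow> nat \<Rightarrow> nat) \<Rightarrow> nat \<Rightarrow> nat" where
  "jump_chain i \<xi> 0 = i"
| "jump_chain i \<xi> (Suc n) = \<xi> n (jump_chain i \<xi> n)"

definition jump_time ::
  "hybrid_params \<Rightarrow> nat \<Rightarrow> (nat \<Rightarrow> real) \<Rightarrow> (nat \<Rightarrow> nat \<Rightarrow> nat) \<Rightarrow> nat \<Rightarrow> ennreal" where
  "jump_time P i e \<xi> n =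
     (\<Sum>k\<le>n. ennreal (e k) / ennreal (- regime_gen P (jump_chain i \<xi> k) (jump_chain i \<xi> k)))"

text \<open>\<open>\<theta>(t\<^sup>-)\<close>, for the initial regime \<open>i\<close>.\<close>

definition regime_before ::
  "hybrid_params \<Rightarrow> nat \<Rightarrow> (nat \<Rightarrow> real) \<Rightarrow> (nat \<Rightarrow> nat \<Rightarrow> nat) \<Rightarrow> real \<Rightarrow> nat" where
  "regime_before P i e \<xi> t = jump_chain i \<xi> (card {n. jump_time P i e \<xi> n < ennreal t})"

section \<open>The queue\<close>

text \<open>
  The queue is described by the list of the departure times of the tasks that have entered it, in
  order of entry. Service is first come, first served: a task that enters at time \<open>t\<close> starts
  service at the first time from \<open>t\<close> on at which fewer than \<open>m\<close> of its predecessors are present.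
\<close>

definition service_start :: "nat \<Rightarrow> real list \<Rightarrow> real \<Rightarrow> real" where
  "service_start m ds t = Inf {x. t \<le> x \<and> length (filter (\<lambda>d. x < d) ds) < m}"

definition enter_queue :: "nat \<Rightarrow> (nat \<Rightarrow> real) \<Rightarrow> real \<Rightarrow> real list \<Rightarrow> real list" where
  "enter_queue m \<sigma> t ds = ds @ [service_start m ds t + \<sigma> (length ds)]"

type_synonym policy = "nat \<Rightarrow> nat \<Rightarrow> real \<Rightarrow> bool"

text \<open>
  \<open>u q i s\<close> holds iff the action is 1 (escalate). As the first two arguments are discrete,
  measurability of a policy is measurability of its sections in the score.
\<close>

definition stationary_policies :: "hybrid_params \<Rightarrow> policy set" where
  "stationary_policies P =
     {u. \<forall>q. \<forall>i\<in>regimes P. u q i \<in> restrict_space borel {0..1} \<rightarrow>\<^sub>M count_space UNIV}"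

text \<open>The departure times of the tasks that enter among the initial ones and the first \<open>n\<close> arrivals.\<close>

primrec departures :: "hybrid_params \<Rightarrow> policy \<Rightarrow> nat \<Rightarrow> nat \<Rightarrow> sample \<Rightarrow> nat \<Rightarrow> real list" where
  "departures P u q0 i0 \<omega> 0 =
     (case \<omega> of (a, s, \<sigma>, e, \<xi>) \<Rightarrow> (enter_queue (servers P) \<sigma> 0 ^^ q0) [])"
| "departures P u q0 i0 \<omega> (Suc n) =
     (case \<omega> of (a, s, \<sigma>, e, \<xi>) \<Rightarrow>
        let ds = departures P u q0 i0 \<omega> n; t = arrival_time a n
        in if u (length (filter (\<lambda>d. t \<le> d) ds)) (regime_before P i0 e \<xi> t) (s n)
           then enter_queue (servers P) \<sigma> t ds else ds)"

text \<open>The queue length found by task \<open>n\<close>, that is, \<open>q(t\<^sup>-)\<close> at its arrival time \<open>t\<close>.\<close>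

definition queue_at_arrival :: "hybrid_params \<Rightarrow> policy \<Rightarrow> nat \<Rightarrow> nat \<Rightarrow> sample \<Rightarrow> nat \<Rightarrow> nat" where
  "queue_at_arrival P u q0 i0 \<omega> n =
     length (filter (\<lambda>d. arrival_time (fst \<omega>) n \<le> d) (departures P u q0 i0 \<omega> n))"

definition queue_length :: "hybrid_params \<Rightarrow> policy \<Rightarrow> nat \<Rightarrow> nat \<Rightarrow> sample \<Rightarrow> real \<Rightarrow> nat" where
  "queue_length P u q0 i0 \<omega> t =
     length (filter (\<lambda>d. t < d)
       (departures P u q0 i0 \<omega> (card {n. arrival_time (fst \<omega>) n \<le> t})))"

section \<open>Costs and value function\<close>

definition decision_cost :: "hybrid_params \<Rightarrow> policy \<Rightarrow> nat \<Rightarrow> nat \<Rightarrow> sample \<Rightarrow> nat \<Rightarrow> real" where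
  "decision_cost P u q0 i0 \<omega> n =
     (case \<omega> of (a, s, \<sigma>, e, \<xi>) \<Rightarrow>
        let i = regime_before P i0 e \<xi> (arrival_time a n)
        in if u (queue_at_arrival P u q0 i0 \<omega> n) i (s n) then esc_cost P else auto_cost P (s n) i)"

definition policy_cost :: "hybrid_params \<Rightarrow> policy \<Rightarrow> nat \<Rightarrow> nat \<Rightarrow> ennreal" where
  "policy_cost P u q0 i0 =
     (\<integral>\<^sup>+\<omega>.
        (\<integral>\<^sup>+t\<in>{0..}. ennreal (exp (- discount_rate P * t)
             * holding_cost P (queue_length P u q0 i0 \<omega> t)) \<partial>lborel)
        + (\<Sum>n. ennreal (exp (- discount_rate P * arrival_time (fst \<omega>) n)
             * decision_cost P u q0 i0 \<omega> n))
      \<partial>sample_space P)"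

definition optimal_value :: "hybrid_params \<Rightarrow> nat \<Rightarrow> nat \<Rightarrow> ennreal" where
  "optimal_value P q i = (INF u\<in>stationary_policies P. policy_cost P u q i)"

definition value_increment :: "hybrid_params \<Rightarrow> nat \<Rightarrow> nat \<Rightarrow> real" where
  "value_increment P q i = enn2real (optimal_value P (q + 1) i) - enn2real (optimal_value P q i)"

section \<open>Well-formedness of the laws\<close>

lemma pmf_jump_law:
  assumes "hybrid_model P" "i \<in> regimes P" "regime_gen P i i \<noteq> 0"
  shows "pmf (jump_law P i) j =
    (if j \<in> regimes P - {i} then regime_gen P i j / (- regime_gen P i i) else 0)"
proof -
  let ?S = "regimes P - {i}" and ?Q = "regime_gen P"
  let ?f = "\<lambda>j. if j \<in> ?S then ?Q i j / (- ?Q i i) else 0"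
  have fin: "finite ?S" by (simp add: regimes_def)
  have gen: "generator_on (regimes P) ?Q" using assms(1) by (simp add: hybrid_model_def)
  have nn: "\<forall>j\<in>?S. 0 \<le> ?Q i j" and diag: "?Q i i = - (\<Sum>j\<in>?S. ?Q i j)"
    using gen assms(2) by (auto simp: generator_on_def)
  have f0: "0 \<le> ?f j" for j
    using nn diag by (auto simp del: minus_divide_right intro!: divide_nonneg_nonneg sum_nonneg)
  have "(\<integral>\<^sup>+x. ennreal (?f x) \<partial>count_space UNIV) = (\<Sum>x\<in>?S. ennreal (?f x))"
    by (rule nn_integral_count_space'[OF fin]) auto
  also have "\<dots> = ennreal (\<Sum>x\<in>?S. ?f x)" by (rule sum_ennreal) (rule f0)
  also have "(\<Sum>x\<in>?S. ?f x) = (\<Sum>x\<in>?S. ?Q i x) / (- ?Q i i)"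
    unfolding sum_divide_distrib by (rule sum.cong) auto
  also have "\<dots> = 1"
    using diag assms(3) by (metis add.inverse_inverse divide_self_if neg_equal_0_iff_equal)
  finally have one: "(\<integral>\<^sup>+x. ennreal (?f x) \<partial>count_space UNIV) = 1" by simp
  show ?thesis using assms(3) unfolding jump_law_def by (simp only: if_False pmf_embed_pmf[OF f0 one])
qed

lemma prob_space_sample_space:
  assumes "hybrid_model P"
  shows "prob_space (sample_space P)"
proof -
  have e: "prob_space (exp_law r)" if "0 < r" for r
    using prob_space_exponential_density[OF that] by (simp add: exp_law_def)
  have [measurable]: "score_density P \<in> borel_measurable (restrict_space borel {0<..<1})"
    using assms by (auto simp: hybrid_model_def intro: borel_measurable_continuous_on_restrict)
  have m: "(\<lambda>s. ennreal (score_density P s) * indicator {0<..<1} s) \<in> borel_measurable borel"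
    by (subst borel_measurable_restrict_space_iff_ennreal[symmetric]) auto
  have "(\<lambda>s. ennreal (score_density P s) * indicator {0<..<1} s
        + ennreal (score_density P 0) * indicator {0} s
        + ennreal (score_density P 1) * indicator {1} s) \<in> borel_measurable borel"
    using m by measurable
  also have "(\<lambda>s. ennreal (score_density P s) * indicator {0<..<1} s
        + ennreal (score_density P 0) * indicator {0} s
        + ennreal (score_density P 1) * indicator {1} s)
      = (\<lambda>s. ennreal (score_density P s) * indicator {0..1} s)"
    by (auto simp: indicator_def fun_eq_iff)
  finally have "(\<lambda>s. ennreal (score_density P s) * indicator {0..1} s) \<in> borel_measurable lborel"
    by simp
  then have s: "prob_space (score_law P)"
    using assms by (intro prob_spaceI) (simp add: score_law_def emeasure_density hybrid_model_def)
  have pm: "prob_space (\<Pi>\<^sub>M n\<in>(UNIV::nat set). M)" if "prob_space M" for M :: "'a measure"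
    using that by (intro prob_space_PiM)
  show ?thesis
    unfolding sample_space_def using assms
    by (intro prob_space_pair pm e s prob_space_measure_pmf) (auto simp: hybrid_model_def)
qed

end

theory Submission
  imports Defs
begin

text \<open>
  Condition on the first event (arrival, completion of one of the running services, regime jump). By memorylessness
  of the exponential clocks the aged sample has the original law, and pathwise the system restarts from its new
  state with that sample. Hence the cost of every stationary policy solves a linear evaluation equation, which
  uniformization turns into a fixed-point equation for a contraction with modulus \<open>\<Lambda> / (\<alpha> + \<Lambda>)\<close>.

  Value iteration from 0 increases to a function \<open>Winf\<close> that lies below the cost of every policy. The policy that is
  greedy for \<open>Winf\<close> attains it: its cost for a holding cost truncated to bounded queue lengths is bounded, hence at
  most \<open>Winf\<close> by contraction, and the truncation is removed by monotone convergence. So \<open>Winf\<close> is the optimal value.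

  The value iteration operator preserves the class of nondecreasing convex functions of the queue length. For the
  admission term this holds because the minimum of escalating and automating can be coupled across neighbouring
  queue lengths; for the service term it needs monotonicity at the queue length where the last server becomes busy.
\<close>

section \<open>Departure lists and first-come first-served service\<close>

text \<open>The cost is defined pathwise, from the departure times of a first-come first-served
  queue and from a jump chain with holding times, so the Markov property has to be derived. Two
  observations carry it. Queue lengths and starts of service depend on a list of departure times
  only through counts. Service times are indexed by order of entry, so forgetting a departed task is
  a reindexing of an i.i.d. sequence along an injection, and its law does not change. The holding
  cost is unbounded and the cost of a policy may be infinite, so all values live in
  \<open>ennreal\<close>, where differences are unreliable. This dictates the form of many
  statements: the evaluation equation is multiplied out by the total rate, uniformization adds the
  missing rate times the value to both sides, convexity is an inequality between sums, and
  contraction appears as the effect of adding a constant. Finiteness of the optimal value comes from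
  the policy that never escalates, under which the queue never exceeds its initial length.\<close>

definition count_gt :: "real list \<Rightarrow> real \<Rightarrow> nat" where
  "count_gt ds x = length (filter (\<lambda>d. x < d) ds)"

text \<open>\<open>count_gt\<close> reads the right-continuous queue length at \<open>x\<close> off
  the departure times, \<open>count_ge\<close> its left limit, which is what an arrival at time
  \<open>x\<close> finds.\<close>

definition count_ge :: "real list \<Rightarrow> real \<Rightarrow> nat" where
  "count_ge ds x = length (filter (\<lambda>d. x \<le> d) ds)"

lemma count_gt_simps [simp]:
  "count_gt [] x = 0" "count_gt (ds @ es) x = count_gt ds x + count_gt es x"
  "count_gt [d] x = (if x < d then 1 else 0)"
  by (auto simp: count_gt_def)

lemma count_ge_simps [simp]:
  "count_ge [] x = 0" "count_ge (ds @ es) x = count_ge ds x + count_ge es x"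
  "count_ge [d] x = (if x \<le> d then 1 else 0)"
  by (auto simp: count_ge_def)

lemma count_gt_le_length: "count_gt ds x \<le> length ds"
  by (simp add: count_gt_def)

lemma length_filter_mono:
  "(\<And>d. d \<in> set ds \<Longrightarrow> Q d \<Longrightarrow> R d) \<Longrightarrow> length (filter Q ds) \<le> length (filter R ds)"
  by (induction ds) (auto simp: le_Suc_eq)

lemma count_gt_antimono: "x \<le> y \<Longrightarrow> count_gt ds y \<le> count_gt ds x"
  unfolding count_gt_def by (rule length_filter_mono) auto

lemma count_ge_le_count_gt: "x < y \<Longrightarrow> count_ge ds y \<le> count_gt ds x"
  unfolding count_gt_def count_ge_def by (rule length_filter_mono) auto

lemma count_gt_right_continuous: "\<exists>y>x. count_gt ds y = count_gt ds x"
proof -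
  let ?S = "insert (x + 2) {d \<in> set ds. x < d}"
  have "x < Min ?S" by (subst Min_gr_iff) auto
  then obtain y where y: "x < y" "y < Min ?S" using dense by blast
  have "x < d \<longleftrightarrow> y < d" if "d \<in> set ds" for d
    using that y by (auto simp: Min_gr_iff)
  then have "filter (\<lambda>d. y < d) ds = filter (\<lambda>d. x < d) ds" by (intro filter_cong) auto
  then show ?thesis using y(1) by (auto simp: count_gt_def)
qed

text \<open>The witness is the last departure before \<open>y\<close>, or \<open>t\<close> if that
  is later: between it and \<open>y\<close> nobody leaves.\<close>

lemma count_ge_left_limit: "t < y \<Longrightarrow> \<exists>x. t \<le> x \<and> x < y \<and> count_gt ds x = count_ge ds y"
proof -
  assume t: "t < y"
  let ?S = "insert t {d \<in> set ds. d < y}"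
  have 1: "Max ?S < y" using t by (subst Max_less_iff) auto
  have 2: "t \<le> Max ?S" by (rule Max_ge) auto
  have "Max ?S < d \<longleftrightarrow> y \<le> d" if "d \<in> set ds" for d
  proof
    assume "Max ?S < d" then show "y \<le> d" using that by (auto simp: Max_less_iff not_less[symmetric])
  qed (use 1 in auto)
  then have "filter (\<lambda>d. Max ?S < d) ds = filter (\<lambda>d. y \<le> d) ds" by (intro filter_cong) auto
  then have "count_gt ds (Max ?S) = count_ge ds y" unfolding count_gt_def count_ge_def by (rule arg_cong)
  then show ?thesis using 1 2 by blast
qed

text \<open>Counts decrease in time and are right-continuous, so the set in the definition of
  \<open>service_start\<close> is upward closed and contains its infimum. From here on the infimum
  is handled only through this equivalence and its strict variant.\<close>

lemma service_start_le_iff: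
  assumes "1 \<le> m"
  shows "service_start m ds t \<le> x \<longleftrightarrow> t \<le> x \<and> count_gt ds x < m"
proof -
  define S where "S = {x. t \<le> x \<and> count_gt ds x < m}"
  have start: "service_start m ds t = Inf S" by (simp add: service_start_def S_def count_gt_def)
  have bdd: "bdd_below S" by (auto simp: S_def bdd_below_def)
  \<comment> \<open>After the last departure the queue is empty, and \<open>1 \<le> m\<close> makes
    a server available. Non-emptiness keeps the real \<open>Inf\<close> meaningful.\<close>
  have "Max (insert t (set ds)) \<in> S"
  proof -
    have "count_gt ds (Max (insert t (set ds))) = 0"
      by (auto simp: count_gt_def filter_empty_conv not_less)
    then show ?thesis using assms by (auto simp: S_def)
  qed
  then have ne: "S \<noteq> {}" by auto
  have up: "y \<in> S" if "z \<in> S" "z \<le> y" for z y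
    using that count_gt_antimono[of z y ds] by (auto simp: S_def)
  have "Inf S \<in> S"
  proof -
    obtain y where y: "Inf S < y" "count_gt ds y = count_gt ds (Inf S)"
      using count_gt_right_continuous by blast
    obtain z where z: "z \<in> S" "z < y" using cInf_lessD[OF ne y(1)] by auto
    have "count_gt ds (Inf S) < m"
      using y(2) z count_gt_antimono[of z y ds] by (auto simp: S_def)
    moreover have "t \<le> Inf S" by (rule cInf_greatest[OF ne]) (auto simp: S_def)
    ultimately show ?thesis by (simp add: S_def)
  qed
  then have "Inf S \<le> x \<longleftrightarrow> x \<in> S" using up cInf_lower[OF _ bdd] by blast
  then show ?thesis by (simp add: start S_def)
qed

text \<open>The strict version replaces counts by their left limits; it is the one that controls
  \<open>count_ge\<close> of a queue after an entry.\<close>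

lemma service_start_less_iff:
  assumes "1 \<le> m"
  shows "service_start m ds t < y \<longleftrightarrow> t < y \<and> count_ge ds y < m"
proof
  assume "service_start m ds t < y"
  then obtain x where x: "service_start m ds t \<le> x" "x < y" by auto
  then show "t < y \<and> count_ge ds y < m"
    using service_start_le_iff[OF assms] count_ge_le_count_gt[of x y ds] by fastforce
next
  assume "t < y \<and> count_ge ds y < m"
  then obtain x where "t \<le> x" "x < y" "count_gt ds x < m"
    using count_ge_left_limit[of t y ds] by auto
  then show "service_start m ds t < y" using service_start_le_iff[OF assms, of ds t x] by simp
qed

lemma eq_if_le_iff: "(\<And>x. a \<le> x \<longleftrightarrow> b \<le> x) \<Longrightarrow> a = (b::real)"
  by (meson order_antisym order_refl)

lemma length_enter_queue [simp]: "length (enter_queue m \<sigma> t ds) = Suc (length ds)"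
  by (simp add: enter_queue_def)

text \<open>
  From time \<open>T\<close> on, the queue \<open>ds\<close> behaves like the queue \<open>ds'\<close> does from time 0 on: queue lengths and
  starts of service depend on a list of departure times only through these counts.
\<close>

definition residual :: "real \<Rightarrow> real list \<Rightarrow> real list \<Rightarrow> bool" where
  "residual T ds ds' \<longleftrightarrow> (\<forall>x\<ge>0. count_gt ds (T + x) = count_gt ds' x) \<and>
     (\<forall>x>0. count_ge ds (T + x) = count_ge ds' x)"

lemma residual_append:
  assumes "residual T ds ds'" "d = T + d'"
  shows "residual T (ds @ [d]) (ds' @ [d'])"
  using assms by (auto simp: residual_def)

text \<open>The start of service for an entry at \<open>T + \<tau>\<close> is determined by counts
  from that time on, and those agree by assumption, so entering commutes with the time
  shift.\<close>

lemma residual_enter_queue: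
  assumes "1 \<le> m" "residual T ds ds'" "0 \<le> \<tau>" "\<sigma> (length ds) = \<sigma>' (length ds')"
  shows "residual T (enter_queue m \<sigma> (T + \<tau>) ds) (enter_queue m \<sigma>' \<tau> ds')"
proof -
  have "service_start m ds (T + \<tau>) = T + service_start m ds' \<tau>"
  proof (rule eq_if_le_iff)
    fix x
    have "service_start m ds (T + \<tau>) \<le> x \<longleftrightarrow> \<tau> \<le> x - T \<and> count_gt ds' (x - T) < m"
      using assms(2,3) service_start_le_iff[OF assms(1), of ds "T + \<tau>" x]
      by (auto simp: residual_def dest!: spec[of _ "x - T"])
    also have "\<dots> \<longleftrightarrow> T + service_start m ds' \<tau> \<le> x"
      using service_start_le_iff[OF assms(1), of ds' \<tau> "x - T"] by auto
    finally show "service_start m ds (T + \<tau>) \<le> x \<longleftrightarrow> T + service_start m ds' \<tau> \<le> x" .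
  qed
  then show ?thesis unfolding enter_queue_def using assms(4)
    by (intro residual_append[OF assms(2)]) simp
qed

lemma service_start_ge: "1 \<le> m \<Longrightarrow> t \<le> service_start m ds t"
  using service_start_le_iff[of m ds t "service_start m ds t"] by simp

text \<open>A task that waits from time 0 cannot start before \<open>T\<close> while all servers are
  busy until then. The restarted system may therefore treat it as entering at its own time
  0.\<close>

lemma residual_enter_queue_blocked:
  assumes "1 \<le> m" "residual T ds ds'" "0 \<le> T" "\<And>x. x < T \<Longrightarrow> m \<le> count_gt ds x"
    "\<sigma> (length ds) = \<sigma>' (length ds')"
  shows "residual T (enter_queue m \<sigma> 0 ds) (enter_queue m \<sigma>' 0 ds')"
    and "T \<le> service_start m ds 0"
proof -
  have eq: "service_start m ds 0 = T + service_start m ds' 0"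
  proof (rule eq_if_le_iff)
    fix x
    show "service_start m ds 0 \<le> x \<longleftrightarrow> T + service_start m ds' 0 \<le> x"
    proof (cases "T \<le> x")
      case True
      then have "count_gt ds x = count_gt ds' (x - T)"
        using assms(2) by (auto simp: residual_def dest!: spec[of _ "x - T"])
      then show ?thesis
        using True assms(3) service_start_le_iff[OF assms(1), of ds 0 x]
          service_start_le_iff[OF assms(1), of ds' 0 "x - T"] by auto
    next
      case False
      then show ?thesis
        using assms(4)[of x] service_start_le_iff[OF assms(1), of ds 0 x]
          service_start_ge[OF assms(1), of 0 ds'] by auto
    qed
  qed
  then show "residual T (enter_queue m \<sigma> 0 ds) (enter_queue m \<sigma>' 0 ds')"
    unfolding enter_queue_def using assms(5) by (intro residual_append[OF assms(2)]) simp
  show "T \<le> service_start m ds 0" using eq service_start_ge[OF assms(1), of 0 ds'] by simp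
qed

definition initial_queue :: "nat \<Rightarrow> (nat \<Rightarrow> real) \<Rightarrow> nat \<Rightarrow> real list" where
  "initial_queue m \<sigma> q = (enter_queue m \<sigma> 0 ^^ q) []"

lemma initial_queue_simps [simp]:
  "initial_queue m \<sigma> 0 = []"
  "initial_queue m \<sigma> (Suc q) = enter_queue m \<sigma> 0 (initial_queue m \<sigma> q)"
  "length (initial_queue m \<sigma> q) = q"
proof -
  show *: "initial_queue m \<sigma> 0 = []" "\<And>q. initial_queue m \<sigma> (Suc q) = enter_queue m \<sigma> 0 (initial_queue m \<sigma> q)"
    by (simp_all add: initial_queue_def)
  show "length (initial_queue m \<sigma> q) = q" by (induction q) (simp_all add: *)
qed

lemma initial_queue_idle_server:
  assumes "1 \<le> m" "q \<le> m"
  shows "initial_queue m \<sigma> q = map \<sigma> [0..<q]"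
  using assms(2)
proof (induction q)
  case (Suc q)
  have "service_start m (initial_queue m \<sigma> q) 0 = 0"
    using Suc.prems count_gt_le_length[of "initial_queue m \<sigma> q" 0] service_start_ge[OF assms(1), of 0]
      service_start_le_iff[OF assms(1), of "initial_queue m \<sigma> q" 0 0] by (simp add: antisym)
  then show ?case using Suc by (simp add: enter_queue_def)
qed simp

lemma count_map_upt:
  "count_gt (map \<sigma> [0..<p]) x = card {j. j < p \<and> x < \<sigma> j}"
  "count_ge (map \<sigma> [0..<p]) x = card {j. j < p \<and> x \<le> \<sigma> j}"
proof -
  have *: "length (filter (\<lambda>j. Q (\<sigma> j)) [0..<p]) = card {j. j < p \<and> Q (\<sigma> j)}" for Q
    by (subst distinct_length_filter) (auto intro!: arg_cong[where f = card])
  show "count_gt (map \<sigma> [0..<p]) x = card {j. j < p \<and> x < \<sigma> j}"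
    "count_ge (map \<sigma> [0..<p]) x = card {j. j < p \<and> x \<le> \<sigma> j}"
    using *[of "\<lambda>d. x < d"] *[of "\<lambda>d. x \<le> d"]
    by (simp_all add: count_gt_def count_ge_def filter_map comp_def)
qed

text \<open>\<open>f\<close> enumerates the tasks still in service after \<open>T\<close>. Counts
  ignore the order of a list, so any enumeration of the survivors will do.\<close>

lemma residual_map_upt:
  assumes bij: "bij_betw f {..<p'} {j. j < p \<and> T < \<sigma> j}"
    and \<sigma>': "\<And>j. j < p' \<Longrightarrow> \<sigma>' j = \<sigma> (f j) - T"
  shows "residual T (map \<sigma> [0..<p]) (map \<sigma>' [0..<p'])"
proof -
  have im: "f ` {..<p'} = {j. j < p \<and> T < \<sigma> j}" and inj: "inj_on f {..<p'}"
    using bij by (auto simp: bij_betw_def)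
  \<comment> \<open>The predicate must force a positive residual time, because tasks gone by
    \<open>T\<close> have no counterpart in the restarted list.\<close>
  have *: "card {j. j < p \<and> Q (\<sigma> j - T)} = card {j. j < p' \<and> Q (\<sigma>' j)}" if "\<And>x. Q x \<Longrightarrow> 0 < x" for Q
  proof -
    have "{j. j < p \<and> Q (\<sigma> j - T)} = f ` {j. j < p' \<and> Q (\<sigma>' j)}"
    proof (intro equalityI subsetI)
      fix j assume j: "j \<in> {j. j < p \<and> Q (\<sigma> j - T)}"
      then have "j \<in> f ` {..<p'}" using that[of "\<sigma> j - T"] by (auto simp: im)
      then show "j \<in> f ` {j. j < p' \<and> Q (\<sigma>' j)}" using j \<sigma>' by auto
    next
      fix j assume "j \<in> f ` {j. j < p' \<and> Q (\<sigma>' j)}"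
      then show "j \<in> {j. j < p \<and> Q (\<sigma> j - T)}" using im \<sigma>' by auto
    qed
    moreover have "inj_on f {j. j < p' \<and> Q (\<sigma>' j)}" using inj by (rule inj_on_subset) auto
    ultimately show ?thesis by (simp add: card_image)
  qed
  show ?thesis
    using *[of "\<lambda>d. x < d" for x] *[of "\<lambda>d. x \<le> d" for x]
    by (auto simp: residual_def count_map_upt less_diff_eq le_diff_eq add.commute)
qed

text \<open>Of the \<open>min q m\<close> tasks in service \<open>p'\<close> survive
  \<open>T\<close>; their residual service times come first in \<open>\<sigma>'\<close>, and the
  waiting tasks keep theirs with shifted indices. Waiting tasks exist only if all servers are busy,
  so they are added one by one with \<open>residual_enter_queue_blocked\<close>. The cases used
  later are \<open>p' = min q m\<close> and \<open>p' = min q m - 1\<close>.\<close>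

lemma residual_initial_queue:
  assumes m: "1 \<le> m" and T: "0 \<le> T"
    and bij: "bij_betw f {..<p'} {j. j < min q m \<and> T < \<sigma> j}" and p': "p' \<le> min q m"
    and \<sigma>': "\<And>j. j < p' \<Longrightarrow> \<sigma>' j = \<sigma> (f j) - T"
    and alive: "\<And>j. j < min q m \<Longrightarrow> T \<le> \<sigma> j"
    and later: "\<And>j. min q m \<le> j \<Longrightarrow> \<sigma> j = \<sigma>' (j - (min q m - p'))"
    and nonneg: "\<And>j. 0 \<le> \<sigma> j"
  shows "residual T (initial_queue m \<sigma> q) (initial_queue m \<sigma>' (q - (min q m - p')))"
    and "\<And>d. d \<in> set (initial_queue m \<sigma> q) \<Longrightarrow> T \<le> d"
proof -
  let ?p = "min q m"
  have "residual T (initial_queue m \<sigma> (?p + n)) (initial_queue m \<sigma>' (p' + n)) \<and>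
     (\<forall>d\<in>set (initial_queue m \<sigma> (?p + n)). T \<le> d)" if "n \<le> q - ?p" for n
    using that
  proof (induction n)
    case 0
    have "residual T (map \<sigma> [0..<?p]) (map \<sigma>' [0..<p'])"
      by (rule residual_map_upt[OF bij \<sigma>'])
    then show ?case using initial_queue_idle_server[OF m] p' alive by auto
  next
    case (Suc n)
    let ?ds = "initial_queue m \<sigma> (?p + n)" and ?ds' = "initial_queue m \<sigma>' (p' + n)"
    have p: "?p = m" using Suc.prems by auto
    have IH: "residual T ?ds ?ds'" "\<And>d. d \<in> set ?ds \<Longrightarrow> T \<le> d" using Suc by auto
    \<comment> \<open>No departure time lies before \<open>T\<close>, so at an earlier time all
      \<open>m + n\<close> tasks are still present.\<close>
    have "m \<le> count_gt ?ds x" if "x < T" for x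
    proof -
      have "filter (\<lambda>d. x < d) ?ds = ?ds" using IH(2) that by (fastforce simp: filter_id_conv)
      then show ?thesis using p by (simp add: count_gt_def)
    qed
    moreover have "\<sigma> (length ?ds) = \<sigma>' (length ?ds')" using later[of "?p + n"] p' by (simp add: add.commute)
    ultimately have R: "residual T (enter_queue m \<sigma> 0 ?ds) (enter_queue m \<sigma>' 0 ?ds')"
      and S: "T \<le> service_start m ?ds 0"
      using residual_enter_queue_blocked[OF m IH(1) T] by blast+
    have "T \<le> service_start m ?ds 0 + \<sigma> (length ?ds)" using S nonneg[of "length ?ds"] by linarith
    then show ?case using R IH(2) by (auto simp: enter_queue_def)
  qed
  from this[of "q - ?p"] show "residual T (initial_queue m \<sigma> q) (initial_queue m \<sigma>' (q - (?p - p')))"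
    "\<And>d. d \<in> set (initial_queue m \<sigma> q) \<Longrightarrow> T \<le> d" using p' by (auto simp: algebra_simps)
qed

section \<open>Restarting the system at an event\<close>

text \<open>The integrand of \<open>policy_cost\<close> with free holding and stage costs:
  \<open>h\<close> will also be a truncated holding cost, and \<open>g\<close> an extension of the
  decision cost that is measurable everywhere.\<close>

definition total_cost ::
  "hybrid_params \<Rightarrow> policy \<Rightarrow> (nat \<Rightarrow> ennreal) \<Rightarrow> (nat \<Rightarrow> nat \<Rightarrow> real \<Rightarrow> ennreal) \<Rightarrow> nat \<Rightarrow> nat \<Rightarrow> sample \<Rightarrow> ennreal"
where
  "total_cost P u h g q i \<omega> = (case \<omega> of (a, s, \<sigma>, e, \<xi>) \<Rightarrow>
     (\<integral>\<^sup>+t\<in>{0..}. ennreal (exp (- discount_rate P * t)) * h (queue_length P u q i \<omega> t) \<partial>lborel)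
     + (\<Sum>n. ennreal (exp (- discount_rate P * arrival_time a n))
         * g (queue_at_arrival P u q i \<omega> n) (regime_before P i e \<xi> (arrival_time a n)) (s n)))"

text \<open>\<open>k\<close> is the number of running clocks of one kind: 1 for the arrivals and for
  the regime, \<open>min q m\<close> for the services, and 0 for a kind whose only running clock has
  just rung and been removed.\<close>

definition age :: "nat \<Rightarrow> real \<Rightarrow> (nat \<Rightarrow> real) \<Rightarrow> nat \<Rightarrow> real" where
  "age k t x = (\<lambda>j. if j < k then x j - t else x j)"

definition alive :: "nat \<Rightarrow> real \<Rightarrow> (nat \<Rightarrow> real) \<Rightarrow> bool" where
  "alive k t x \<longleftrightarrow> (\<forall>j<k. t < x j)"

text \<open>The increasing injection that omits \<open>k\<close>; composing a sequence with it
  deletes entry \<open>k\<close>, the clock that has rung.\<close>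

definition skip :: "nat \<Rightarrow> nat \<Rightarrow> nat" where
  "skip k j = (if j < k then j else Suc j)"

section \<open>Arrivals and regimes seen from a later time\<close>

lemma arrival_time_Suc: "arrival_time a (Suc n) = a 0 + arrival_time (\<lambda>n. a (skip 0 n)) n"
  unfolding arrival_time_def skip_def by (subst sum.atMost_Suc_shift) simp

lemma arrival_time_age: "arrival_time a n = T + arrival_time (age 1 T a) n"
  unfolding arrival_time_def age_def by (cases n) (simp_all add: sum.atMost_Suc_shift del: sum.atMost_Suc)

lemma jump_chain_Suc: "jump_chain i \<xi> (Suc n) = jump_chain (\<xi> 0 i) (\<lambda>n. \<xi> (skip 0 n)) n"
  by (induction n) (simp_all add: skip_def)

text \<open>For an absorbing regime, \<open>r = 0\<close>, both sides are infinite, since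
  \<open>x\<close> is then positive.\<close>

lemma ennreal_divide_split:
  assumes "0 \<le> r" "0 \<le> T" "r * T < x"
  shows "ennreal x / ennreal r = ennreal T + ennreal (x - r * T) / ennreal r"
proof (cases "r = 0")
  case True
  then show ?thesis using assms by (simp add: ennreal_divide_zero)
next
  case False
  have "0 \<le> r * T" using assms by simp
  then have "0 \<le> x" using assms by linarith
  then have "ennreal x / ennreal r = ennreal (x / r)"
    "ennreal (x - r * T) / ennreal r = ennreal (x / r - T)"
    using False assms by (auto simp: divide_ennreal diff_divide_distrib)
  moreover have "0 \<le> x / r - T" using False assms by (simp add: field_simps)
  ultimately show ?thesis using assms by (simp flip: ennreal_plus)
qed

text \<open>The clock \<open>e 0\<close> is a unit exponential consumed at speed \<open>r\<close> in
  regime \<open>i\<close>, so a time span \<open>T\<close> uses up \<open>r * T\<close> of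
  it.\<close>

lemma jump_time_age:
  assumes "0 \<le> T" "r = - regime_gen P i i" "0 \<le> r" "r * T < e 0"
  shows "jump_time P i e \<xi> n = ennreal T + jump_time P i (age 1 (r * T) e) \<xi> n"
proof -
  have 0: "ennreal (e 0) / ennreal r = ennreal T + ennreal (e 0 - r * T) / ennreal r"
    using assms by (intro ennreal_divide_split) auto
  show ?thesis
    unfolding jump_time_def age_def
    by (cases n) (simp_all add: 0 sum.atMost_Suc_shift assms(2)[symmetric] add.assoc del: sum.atMost_Suc)
qed

lemma regime_before_age:
  assumes "0 \<le> T" "r = - regime_gen P i i" "0 \<le> r" "r * T < e 0" "0 \<le> t"
  shows "regime_before P i e \<xi> (T + t) = regime_before P i (age 1 (r * T) e) \<xi> t"
  unfolding regime_before_def jump_time_age[where P = P and i = i and e = e, OF assms(1-4)]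
  using assms(1,5) by (simp add: ennreal_plus)

lemma regime_before_first:
  assumes "0 \<le> T" "r = - regime_gen P i i" "0 \<le> r" "r * T < e 0"
  shows "regime_before P i e \<xi> T = i"
  using regime_before_age[where P = P and i = i and e = e, OF assms, of 0 \<xi>] by (simp add: regime_before_def)

lemma jump_time_Suc:
  assumes "0 < r" "r = - regime_gen P i i" "0 \<le> e 0" "T = e 0 / r"
  shows "jump_time P i e \<xi> (Suc n)
     = ennreal T + jump_time P (\<xi> 0 i) (\<lambda>n. e (skip 0 n)) (\<lambda>n. \<xi> (skip 0 n)) n"
    and "jump_time P i e \<xi> 0 = ennreal T"
proof -
  have 0: "ennreal (e 0) / ennreal r = ennreal T" using assms by (simp add: divide_ennreal)
  show "jump_time P i e \<xi> (Suc n)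
     = ennreal T + jump_time P (\<xi> 0 i) (\<lambda>n. e (skip 0 n)) (\<lambda>n. \<xi> (skip 0 n)) n"
    unfolding jump_time_def sum.atMost_Suc_shift
    by (simp add: 0 assms(2)[symmetric] jump_chain_Suc skip_def del: jump_chain.simps(2))
  show "jump_time P i e \<xi> 0 = ennreal T"
    by (simp add: jump_time_def 0 assms(2)[symmetric])
qed

lemma card_nat_split_0:
  fixes S :: "nat set"
  assumes "finite S" "0 \<in> S"
  shows "card S = Suc (card {n. Suc n \<in> S})"
proof -
  have eq: "S = insert 0 (Suc ` {n. Suc n \<in> S})"
    using assms(2) by (auto simp: image_iff) (metis not0_implies_Suc)
  have "finite (Suc ` {n. Suc n \<in> S})" using assms(1) by (rule finite_subset[rotated]) auto
  then show ?thesis by (subst eq) (simp add: card_image)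
qed

text \<open>The jump at \<open>T\<close> is counted strictly before \<open>T + t\<close> because
  \<open>t\<close> is positive, and the remaining jumps are those of the shifted chain. Finiteness
  is assumed because \<open>card\<close> of an infinite set is 0.\<close>

lemma regime_before_jump:
  assumes "0 < r" "r = - regime_gen P i i" "0 \<le> e 0" "T = e 0 / r" "0 < t"
    and fin: "finite {n. jump_time P i e \<xi> n < ennreal (T + t)}"
  shows "regime_before P i e \<xi> (T + t)
    = regime_before P (\<xi> 0 i) (\<lambda>n. e (skip 0 n)) (\<lambda>n. \<xi> (skip 0 n)) t"
proof -
  note jt = jump_time_Suc[where P = P and i = i and e = e, OF assms(1-4)]
  have T: "0 \<le> T" using assms(1,3) unfolding assms(4) by (rule divide_nonneg_pos[rotated])
  have "card {n. jump_time P i e \<xi> n < ennreal (T + t)}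
     = Suc (card {n. Suc n \<in> {n. jump_time P i e \<xi> n < ennreal (T + t)}})"
    using T assms(5) by (intro card_nat_split_0 fin) (simp add: jt(2) ennreal_less_iff)
  also have "{n. Suc n \<in> {n. jump_time P i e \<xi> n < ennreal (T + t)}}
     = {n. jump_time P (\<xi> 0 i) (\<lambda>n. e (skip 0 n)) (\<lambda>n. \<xi> (skip 0 n)) n < ennreal t}"
    using T assms(5) by (simp add: jt(1) ennreal_plus)
  finally show ?thesis by (simp add: regime_before_def jump_chain_Suc del: jump_chain.simps(2))
qed

section \<open>Paths and costs after a restart\<close>

lemma departures_0: "departures P u q i (a, s, \<sigma>, e, \<xi>) 0 = initial_queue (servers P) \<sigma> q"
  by (simp add: initial_queue_def)

lemma queue_at_arrival_count:
  "queue_at_arrival P u q i (a, s, \<sigma>, e, \<xi>) n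
     = count_ge (departures P u q i (a, s, \<sigma>, e, \<xi>) n) (arrival_time a n)"
  by (simp add: queue_at_arrival_def count_ge_def)

lemma queue_length_count:
  "queue_length P u q i (a, s, \<sigma>, e, \<xi>) t
     = count_gt (departures P u q i (a, s, \<sigma>, e, \<xi>) (card {n. arrival_time a n \<le> t})) t"
  by (simp add: queue_length_def count_gt_def)

lemma departures_Suc:
  "departures P u q i (a, s, \<sigma>, e, \<xi>) (Suc n) =
    (if u (queue_at_arrival P u q i (a, s, \<sigma>, e, \<xi>) n) (regime_before P i e \<xi> (arrival_time a n)) (s n)
     then enter_queue (servers P) \<sigma> (arrival_time a n) (departures P u q i (a, s, \<sigma>, e, \<xi>) n)
     else departures P u q i (a, s, \<sigma>, e, \<xi>) n)"
  by (simp add: queue_at_arrival_def Let_def)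

text \<open>
  At time \<open>T\<close> the system with sample \<open>\<omega>\<close>, after \<open>\<delta>\<close> arrivals, restarts as the system with sample
  \<open>\<omega>'\<close> and initial state \<open>(q', i')\<close>; \<open>\<kappa>\<close> counts the tasks that have left by then.
\<close>

locale restart =
  fixes P :: hybrid_params and u :: policy and q i q' i' \<delta> \<kappa> :: nat and T :: real
    and a a' s s' \<sigma> \<sigma>' e e' :: "nat \<Rightarrow> real" and \<xi> \<xi>' :: "nat \<Rightarrow> nat \<Rightarrow> nat" and \<omega> \<omega>' :: sample
  assumes m: "1 \<le> servers P" and T: "0 \<le> T" and \<alpha>: "0 < discount_rate P"
    and \<omega>_def: "\<omega> = (a, s, \<sigma>, e, \<xi>)" and \<omega>'_def: "\<omega>' = (a', s', \<sigma>', e', \<xi>')"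
    and start: "residual T (departures P u q i \<omega> \<delta>) (initial_queue (servers P) \<sigma>' q')"
    and len: "length (departures P u q i \<omega> \<delta>) = q' + \<kappa>"
    and arr: "\<And>n. arrival_time a (n + \<delta>) = T + arrival_time a' n"
    and arr_pos: "\<And>n. 0 < arrival_time a' n"
    and arr_first: "\<And>n. n < \<delta> \<Longrightarrow> arrival_time a n = T"
    and arr_fin: "\<And>t. finite {n. arrival_time a n \<le> t}"
    and scores: "\<And>n. s (n + \<delta>) = s' n"
    and regime: "\<And>t. 0 < t \<Longrightarrow> regime_before P i e \<xi> (T + t) = regime_before P i' e' \<xi>' t"
    and services: "\<And>j. q' \<le> j \<Longrightarrow> \<sigma>' j = \<sigma> (j + \<kappa>)"
    and before: "\<And>d. d \<in> set (initial_queue (servers P) \<sigma> q) \<Longrightarrow> T \<le> d"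
begin

text \<open>Induction over the arrivals: each of them finds the same queue length, regime and score
  in both systems, so the same action is taken. The constant offset \<open>\<kappa>\<close> between
  the list lengths and the lower bound \<open>q'\<close> let \<open>services\<close> supply an
  entering task with the same service time on both sides.\<close>

lemma residual_departures:
  "residual T (departures P u q i \<omega> (n + \<delta>)) (departures P u q' i' \<omega>' n) \<and>
   length (departures P u q i \<omega> (n + \<delta>)) = length (departures P u q' i' \<omega>' n) + \<kappa> \<and>
   q' \<le> length (departures P u q' i' \<omega>' n)"
proof (induction n)
  case 0
  then show ?case using start len by (simp add: \<omega>_def \<omega>'_def departures_0 del: departures.simps)
next
  case (Suc n)
  let ?ds = "departures P u q i \<omega> (n + \<delta>)" and ?ds' = "departures P u q' i' \<omega>' n"
  have "count_ge ?ds (arrival_time a (n + \<delta>)) = count_ge ?ds' (arrival_time a' n)"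
    using Suc arr_pos[of n] by (simp add: arr residual_def)
  moreover have "\<sigma> (length ?ds) = \<sigma>' (length ?ds')" using Suc services by simp
  then have "residual T (enter_queue (servers P) \<sigma> (T + arrival_time a' n) ?ds)
      (enter_queue (servers P) \<sigma>' (arrival_time a' n) ?ds')"
    using Suc arr_pos[of n] by (intro residual_enter_queue[OF m]) auto
  ultimately show ?case using Suc arr_pos[of n]
    by (simp add: \<omega>_def \<omega>'_def departures_Suc queue_at_arrival_count arr scores regime del: departures.simps)
qed

lemma queue_at_arrival_restart:
  "queue_at_arrival P u q i \<omega> (n + \<delta>) = queue_at_arrival P u q' i' \<omega>' n"
  using residual_departures[of n] arr_pos[of n] arr[of n]
  by (simp add: \<omega>_def \<omega>'_def queue_at_arrival_count residual_def)

lemma card_arrivals_restart: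
  assumes "0 \<le> t"
  shows "card {n. arrival_time a n \<le> T + t} = card {n. arrival_time a' n \<le> t} + \<delta>"
proof -
  let ?A = "{n. arrival_time a' n \<le> t}"
  have eq: "{n. arrival_time a n \<le> T + t} = {..<\<delta>} \<union> (\<lambda>n. n + \<delta>) ` ?A"
  proof (intro equalityI subsetI)
    fix n assume "n \<in> {n. arrival_time a n \<le> T + t}"
    then show "n \<in> {..<\<delta>} \<union> (\<lambda>n. n + \<delta>) ` ?A"
      using arr[of "n - \<delta>"] by (cases "n < \<delta>") (auto intro!: image_eqI[of _ _ "n - \<delta>"])
  qed (use assms arr arr_first in \<open>auto simp: arr\<close>)
  have fin: "finite ((\<lambda>n. n + \<delta>) ` ?A)"
    using arr_fin[of "T + t"] unfolding eq by simp
  have "card ({..<\<delta>} \<union> (\<lambda>n. n + \<delta>) ` ?A) = card {..<\<delta>} + card ((\<lambda>n. n + \<delta>) ` ?A)"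
    by (rule card_Un_disjoint) (use fin in auto)
  also have "card ((\<lambda>n. n + \<delta>) ` ?A) = card ?A" by (rule card_image) auto
  finally show ?thesis by (simp add: eq)
qed

lemma queue_length_restart:
  "0 \<le> t \<Longrightarrow> queue_length P u q i \<omega> (T + t) = queue_length P u q' i' \<omega>' t"
  using residual_departures[of "card {n. arrival_time a' n \<le> t}"]
  by (simp add: \<omega>_def \<omega>'_def queue_length_count card_arrivals_restart residual_def)

lemma queue_length_before:
  assumes "0 \<le> t" "t < T"
  shows "queue_length P u q i \<omega> t = q"
proof -
  have "T \<le> arrival_time a n" for n
    using arr_first[of n] arr[of "n - \<delta>"] arr_pos[of "n - \<delta>"] by (cases "n < \<delta>") auto
  then have none: "{n. arrival_time a n \<le> t} = {}" using assms(2) by (auto simp: not_le intro: less_le_trans)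
  have all: "filter (\<lambda>d. t < d) (initial_queue (servers P) \<sigma> q) = initial_queue (servers P) \<sigma> q"
    unfolding filter_id_conv using before assms(2) by fastforce
  have "queue_length P u q i \<omega> t = count_gt (departures P u q i (a, s, \<sigma>, e, \<xi>) 0) t"
    by (simp only: \<omega>_def queue_length_count none card.empty)
  also have "\<dots> = q" by (simp only: departures_0 count_gt_def all initial_queue_simps)
  finally show ?thesis .
qed

lemma exp_split:
  "ennreal (exp (- (discount_rate P * (T + t))))
    = ennreal (exp (- (discount_rate P * T))) * ennreal (exp (- (discount_rate P * t)))"
  by (simp add: distrib_left exp_add[symmetric] flip: ennreal_mult)

lemma holding_restart:
  assumes [measurable]: "(\<lambda>t. queue_length P u q i \<omega> t) \<in> borel \<rightarrow>\<^sub>M count_space UNIV"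
  shows "(\<integral>\<^sup>+t\<in>{0..}. ennreal (exp (- discount_rate P * t)) * h (queue_length P u q i \<omega> t) \<partial>lborel)
    = h q * ennreal ((1 - exp (- discount_rate P * T)) / discount_rate P)
     + ennreal (exp (- discount_rate P * T)) *
      (\<integral>\<^sup>+t\<in>{0..}. ennreal (exp (- discount_rate P * t)) * h (queue_length P u q' i' \<omega>' t) \<partial>lborel)"
proof -
  let ?\<alpha> = "discount_rate P"
  define f where "f t = ennreal (exp (- ?\<alpha> * t)) * h (queue_length P u q i \<omega> t)" for t
  have f[measurable]: "f \<in> borel_measurable borel" unfolding f_def by measurable
  have "(\<integral>\<^sup>+t\<in>{0..}. f t \<partial>lborel) = (\<integral>\<^sup>+t. f t * indicator {0..<T} t + f t * indicator {T..} t \<partial>lborel)"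
    using T by (intro nn_integral_cong) (auto simp: indicator_def)
  also have "\<dots> = (\<integral>\<^sup>+t\<in>{0..<T}. f t \<partial>lborel) + (\<integral>\<^sup>+t\<in>{T..}. f t \<partial>lborel)"
    by (intro nn_integral_add) auto
  \<comment> \<open>The queue length is \<open>q\<close> up to but excluding \<open>T\<close>; the
    closed interval is taken for the fundamental theorem, at the price of a null set.\<close>
  also have "(\<integral>\<^sup>+t\<in>{0..<T}. f t \<partial>lborel) = (\<integral>\<^sup>+t. h q * (ennreal (exp (- ?\<alpha> * t)) * indicator {0..T} t) \<partial>lborel)"
    using AE_lborel_singleton[of T]
    by (intro nn_integral_cong_AE, eventually_elim)
      (auto simp: f_def queue_length_before indicator_def mult.commute)
  also have "\<dots> = h q * (\<integral>\<^sup>+t. (ennreal (exp (- ?\<alpha> * t)) * indicator {0..T} t) \<partial>lborel)"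
    by (intro nn_integral_cmult) auto
  also have "(\<integral>\<^sup>+t. (ennreal (exp (- ?\<alpha> * t)) * indicator {0..T} t) \<partial>lborel)
     = ennreal (- exp (- ?\<alpha> * T) / ?\<alpha> - (- exp (- ?\<alpha> * 0) / ?\<alpha>))"
    by (rule nn_integral_FTC_Icc[where F = "\<lambda>t. - exp (- ?\<alpha> * t) / ?\<alpha>"])
      (use T \<alpha> in \<open>auto intro!: derivative_eq_intros\<close>)
  also have "- exp (- ?\<alpha> * T) / ?\<alpha> - (- exp (- ?\<alpha> * 0) / ?\<alpha>) = (1 - exp (- ?\<alpha> * T)) / ?\<alpha>"
    by (simp add: diff_divide_distrib)
  also have "(\<integral>\<^sup>+t\<in>{T..}. f t \<partial>lborel) = (\<integral>\<^sup>+t. f (T + 1 * t) * indicator {T..} (T + 1 * t) \<partial>lborel)"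
    by (subst nn_integral_real_affine[of _ 1 T]) auto
  also have "\<dots> = (\<integral>\<^sup>+t. ennreal (exp (- ?\<alpha> * T)) * (ennreal (exp (- ?\<alpha> * t)) * h (queue_length P u q' i' \<omega>' t) * indicator {0..} t) \<partial>lborel)"
    by (intro nn_integral_cong) (auto simp: f_def indicator_def queue_length_restart exp_split mult.assoc)
  also have "\<dots> = ennreal (exp (- ?\<alpha> * T)) * (\<integral>\<^sup>+t. ennreal (exp (- ?\<alpha> * t)) * h (queue_length P u q' i' \<omega>' t) * indicator {0..} t \<partial>lborel)"
  proof (rule nn_integral_cmult)
    \<comment> \<open>Measurability of the restarted path is inherited from the original one, with
      which it agrees after the shift on nonnegative times.\<close>
    have "(\<lambda>t. ennreal (exp (- ?\<alpha> * t)) * h (queue_length P u q i \<omega> (T + t)) * indicator {0..} t) \<in> borel_measurable lborel"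
      by measurable
    also have "?this \<longleftrightarrow> (\<lambda>t. ennreal (exp (- ?\<alpha> * t)) * h (queue_length P u q' i' \<omega>' t) * indicator {0..} t) \<in> borel_measurable lborel"
      by (intro measurable_cong) (auto simp: indicator_def queue_length_restart)
    finally show "(\<lambda>t. ennreal (exp (- ?\<alpha> * t)) * h (queue_length P u q' i' \<omega>' t) * indicator {0..} t) \<in> borel_measurable lborel" .
  qed
  finally show ?thesis by (simp add: f_def)
qed

lemma decisions_restart:
  "(\<Sum>n. ennreal (exp (- discount_rate P * arrival_time a n))
      * g (queue_at_arrival P u q i \<omega> n) (regime_before P i e \<xi> (arrival_time a n)) (s n))
   = ennreal (exp (- discount_rate P * T)) *
     ((\<Sum>n<\<delta>. g (queue_at_arrival P u q i \<omega> n) (regime_before P i e \<xi> T) (s n)) +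
      (\<Sum>n. ennreal (exp (- discount_rate P * arrival_time a' n))
         * g (queue_at_arrival P u q' i' \<omega>' n) (regime_before P i' e' \<xi>' (arrival_time a' n)) (s' n)))"
  (is "(\<Sum>n. ?f n) = ?c * (?A + (\<Sum>n. ?f' n))")
proof -
  have "(\<Sum>n. ?f n) = (\<Sum>n<\<delta>. ?f n) + (\<Sum>n. ?f (n + \<delta>))"
    by (subst suminf_offset[of _ \<delta>]) (auto simp: add.commute)
  also have "(\<Sum>n<\<delta>. ?f n) = ?c * ?A"
    by (simp add: arr_first sum_distrib_left)
  also have "?f (n + \<delta>) = ?c * ?f' n" for n
    using regime[OF arr_pos[of n]]
    by (simp add: arr queue_at_arrival_restart scores exp_split mult.assoc)
  then have "(\<Sum>n. ?f (n + \<delta>)) = ?c * (\<Sum>n. ?f' n)" by (simp add: ennreal_suminf_cmult)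
  finally show ?thesis by (simp add: distrib_left)
qed

lemma total_cost_restart:
  assumes "(\<lambda>t. queue_length P u q i \<omega> t) \<in> borel \<rightarrow>\<^sub>M count_space UNIV"
  shows "total_cost P u h g q i \<omega> = h q * ennreal ((1 - exp (- discount_rate P * T)) / discount_rate P)
     + ennreal (exp (- discount_rate P * T)) *
     ((\<Sum>n<\<delta>. g (queue_at_arrival P u q i \<omega> n) (regime_before P i e \<xi> T) (s n))
       + total_cost P u h g q' i' \<omega>')"
  using holding_restart[OF assms, of h] decisions_restart[of g]
  by (simp add: total_cost_def \<omega>_def \<omega>'_def distrib_left add_ac)

end

section \<open>Measurability\<close>

text \<open>Instead of a sigma-algebra on lists, measurability is asked of the observables through
  which a queue acts: its length and its counts at measurable random times.\<close>

definition measurable_queue :: "'x measure \<Rightarrow> ('x \<Rightarrow> real list) \<Rightarrow> bool" where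
  "measurable_queue M D \<longleftrightarrow> (\<lambda>x. length (D x)) \<in> M \<rightarrow>\<^sub>M count_space UNIV \<and>
     (\<forall>t\<in>borel_measurable M. (\<lambda>x. count_gt (D x) (t x)) \<in> M \<rightarrow>\<^sub>M count_space UNIV \<and>
        (\<lambda>x. count_ge (D x) (t x)) \<in> M \<rightarrow>\<^sub>M count_space UNIV)"

lemma measurable_queueD:
  assumes "measurable_queue M D"
  shows "(\<lambda>x. length (D x)) \<in> M \<rightarrow>\<^sub>M count_space UNIV"
    "t \<in> borel_measurable M \<Longrightarrow> (\<lambda>x. count_gt (D x) (t x)) \<in> M \<rightarrow>\<^sub>M count_space UNIV"
    "t \<in> borel_measurable M \<Longrightarrow> (\<lambda>x. count_ge (D x) (t x)) \<in> M \<rightarrow>\<^sub>M count_space UNIV"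
  using assms by (auto simp: measurable_queue_def)

lemma measurable_queue_Nil: "measurable_queue M (\<lambda>_. [])"
  by (simp add: measurable_queue_def)

lemma measurable_queue_If:
  assumes [measurable]: "Measurable.pred M Q" and D: "measurable_queue M D" "measurable_queue M E"
  shows "measurable_queue M (\<lambda>x. if Q x then D x else E x)"
proof -
  note [measurable] = measurable_queueD[OF D(1)] measurable_queueD[OF D(2)]
  have *: "(\<lambda>x. f (if Q x then D x else E x) (t x)) \<in> M \<rightarrow>\<^sub>M count_space UNIV"
    if "(\<lambda>x. f (D x) (t x)) \<in> M \<rightarrow>\<^sub>M count_space UNIV" "(\<lambda>x. f (E x) (t x)) \<in> M \<rightarrow>\<^sub>M count_space UNIV"
    for f :: "real list \<Rightarrow> real \<Rightarrow> nat" and t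
  proof -
    have "(\<lambda>x. if Q x then f (D x) (t x) else f (E x) (t x)) \<in> M \<rightarrow>\<^sub>M count_space UNIV"
      using that by measurable
    also have "(\<lambda>x. if Q x then f (D x) (t x) else f (E x) (t x)) = (\<lambda>x. f (if Q x then D x else E x) (t x))"
      by auto
    finally show ?thesis .
  qed
  show ?thesis unfolding measurable_queue_def
    by (intro conjI ballI *[where f = "\<lambda>ds _. length ds"] *[where f = count_gt] *[where f = count_ge]
        measurable_queueD[OF D(1)] measurable_queueD[OF D(2)])
qed

text \<open>Whether the new departure time exceeds \<open>t\<close> is, by the two equivalences for
  \<open>service_start\<close>, a condition on the counts of \<open>D\<close> at the random time
  \<open>t - w\<close>, where \<open>w\<close> is the service time. This is why
  \<open>measurable_queue\<close> allows random times.\<close>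

lemma measurable_queue_enter:
  assumes m: "1 \<le> m" and D: "measurable_queue M D" and [measurable]: "\<tau> \<in> borel_measurable M"
    and \<sigma>: "\<And>n. (\<lambda>x. \<sigma> x n) \<in> borel_measurable M"
  shows "measurable_queue M (\<lambda>x. enter_queue m (\<sigma> x) (\<tau> x) (D x))"
proof -
  note [measurable] = measurable_queueD[OF D]
  define w where "w x = \<sigma> x (length (D x))" for x
  have [measurable]: "w \<in> borel_measurable M"
    unfolding w_def by (rule measurable_compose_countable[OF \<sigma>]) measurable
  have gt: "(\<lambda>x. count_gt (enter_queue m (\<sigma> x) (\<tau> x) (D x)) (t x)) \<in> M \<rightarrow>\<^sub>M count_space UNIV"
    if [measurable]: "t \<in> borel_measurable M" for t
  proof -
    have "count_gt (enter_queue m (\<sigma> x) (\<tau> x) (D x)) (t x) =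
      count_gt (D x) (t x) + (if \<tau> x \<le> t x - w x \<and> count_gt (D x) (t x - w x) < m then 0 else 1)" for x
      using service_start_le_iff[OF m, of "D x" "\<tau> x" "t x - w x"]
      by (auto simp: enter_queue_def w_def)
    then show ?thesis by (simp only:) measurable
  qed
  have ge: "(\<lambda>x. count_ge (enter_queue m (\<sigma> x) (\<tau> x) (D x)) (t x)) \<in> M \<rightarrow>\<^sub>M count_space UNIV"
    if [measurable]: "t \<in> borel_measurable M" for t
  proof -
    have "count_ge (enter_queue m (\<sigma> x) (\<tau> x) (D x)) (t x) =
      count_ge (D x) (t x) + (if \<tau> x < t x - w x \<and> count_ge (D x) (t x - w x) < m then 0 else 1)" for x
      using service_start_less_iff[OF m, of "D x" "\<tau> x" "t x - w x"]
      by (auto simp: enter_queue_def w_def)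
    then show ?thesis by (simp only:) measurable
  qed
  show ?thesis using gt ge unfolding measurable_queue_def by simp
qed

text \<open>The sample is a function on an arbitrary space \<open>M\<close>, so that one development
  covers a random sample, a fixed sample with time as the variable, and joint measurability in
  sample and time.\<close>

locale random_sample =
  fixes M :: "'x measure" and P :: hybrid_params and u :: policy and q i :: nat
    and a s \<sigma> e :: "'x \<Rightarrow> nat \<Rightarrow> real" and \<xi> :: "'x \<Rightarrow> nat \<Rightarrow> nat \<Rightarrow> nat"
  assumes m: "1 \<le> servers P"
    and a [measurable]: "\<And>n. (\<lambda>x. a x n) \<in> borel_measurable M"
    and s [measurable]: "\<And>n. (\<lambda>x. s x n) \<in> borel_measurable M"
    and \<sigma> [measurable]: "\<And>n. (\<lambda>x. \<sigma> x n) \<in> borel_measurable M"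
    and e [measurable]: "\<And>n. (\<lambda>x. e x n) \<in> borel_measurable M"
    and \<xi> [measurable]: "\<And>n. (\<lambda>x. \<xi> x n) \<in> M \<rightarrow>\<^sub>M count_space UNIV"
    and u [measurable]: "\<And>k j. Measurable.pred borel (u k j)"
begin

lemma measurable_arrival_time [measurable]: "(\<lambda>x. arrival_time (a x) n) \<in> borel_measurable M"
  unfolding arrival_time_def by measurable

lemma measurable_jump_chain [measurable]:
  "(\<lambda>x. jump_chain i (\<xi> x) n) \<in> M \<rightarrow>\<^sub>M count_space UNIV"
proof (induction n)
  case (Suc n)
  have "(\<lambda>x. \<xi> x n j) \<in> M \<rightarrow>\<^sub>M count_space UNIV" for j
    by (rule measurable_compose[OF \<xi>]) simp
  then show ?case unfolding jump_chain.simps by (rule measurable_compose_countable[OF _ Suc])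
qed simp

lemma measurable_jump_time [measurable]: "(\<lambda>x. jump_time P i (e x) (\<xi> x) n) \<in> borel_measurable M"
  unfolding jump_time_def
proof (intro borel_measurable_sum)
  fix k
  have "(\<lambda>x. ennreal (e x k) / ennreal (- regime_gen P j j)) \<in> borel_measurable M" for j
    by measurable
  then show "(\<lambda>x. ennreal (e x k) / ennreal (- regime_gen P (jump_chain i (\<xi> x) k) (jump_chain i (\<xi> x) k)))
    \<in> borel_measurable M"
    by (rule measurable_compose_countable[where g = "\<lambda>x. jump_chain i (\<xi> x) k"]) measurable
qed

lemma measurable_regime_before [measurable]:
  assumes [measurable]: "t \<in> borel_measurable M"
  shows "(\<lambda>x. regime_before P i (e x) (\<xi> x) (t x)) \<in> M \<rightarrow>\<^sub>M count_space UNIV"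
  unfolding regime_before_def
  by (rule measurable_compose_countable[where g = "\<lambda>x. card {n. jump_time P i (e x) (\<xi> x) n < ennreal (t x)}"])
    measurable

lemma measurable_compose_state:
  fixes f :: "nat \<Rightarrow> nat \<Rightarrow> real \<Rightarrow> 'b"
  assumes k: "k \<in> M \<rightarrow>\<^sub>M count_space UNIV" and j: "j \<in> M \<rightarrow>\<^sub>M count_space UNIV"
    and t: "t \<in> borel_measurable M" and f: "\<And>k j. f k j \<in> borel \<rightarrow>\<^sub>M N"
  shows "(\<lambda>x. f (k x) (j x) (t x)) \<in> M \<rightarrow>\<^sub>M N"
proof (rule measurable_compose_countable[OF _ k])
  fix n
  show "(\<lambda>x. f n (j x) (t x)) \<in> M \<rightarrow>\<^sub>M N"
    by (rule measurable_compose_countable[OF _ j]) (rule measurable_compose[OF t f])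
qed

lemma measurable_queue_departures:
  "measurable_queue M (\<lambda>x. departures P u q i (a x, s x, \<sigma> x, e x, \<xi> x) n)"
proof (induction n)
  case 0
  have "measurable_queue M (\<lambda>x. initial_queue (servers P) (\<sigma> x) k)" for k
    by (induction k) (auto intro: measurable_queue_Nil measurable_queue_enter[OF m])
  then show ?case unfolding departures_0 .
next
  case (Suc n)
  let ?D = "\<lambda>x. departures P u q i (a x, s x, \<sigma> x, e x, \<xi> x) n"
  have "Measurable.pred M (\<lambda>x. u (count_ge (?D x) (arrival_time (a x) n))
      (regime_before P i (e x) (\<xi> x) (arrival_time (a x) n)) (s x n))"
    by (rule measurable_compose_state[where f = u])
      (rule measurable_queueD[OF Suc] measurable_regime_before measurable_arrival_time s u)+
  then show ?case unfolding departures_Suc queue_at_arrival_count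
    by (intro measurable_queue_If measurable_queue_enter[OF m] Suc measurable_arrival_time \<sigma>)
qed

lemma measurable_queue_at_arrival [measurable]:
  "(\<lambda>x. queue_at_arrival P u q i (a x, s x, \<sigma> x, e x, \<xi> x) n) \<in> M \<rightarrow>\<^sub>M count_space UNIV"
  unfolding queue_at_arrival_count
  by (rule measurable_queueD(3)[OF measurable_queue_departures measurable_arrival_time])

lemma measurable_queue_length [measurable]:
  assumes [measurable]: "t \<in> borel_measurable M"
  shows "(\<lambda>x. queue_length P u q i (a x, s x, \<sigma> x, e x, \<xi> x) (t x)) \<in> M \<rightarrow>\<^sub>M count_space UNIV"
  unfolding queue_length_count
  by (rule measurable_compose_countable[where g = "\<lambda>x. card {n. arrival_time (a x) n \<le> t x}"])
    (auto intro: measurable_queueD(2)[OF measurable_queue_departures])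

lemma measurable_decisions [measurable]:
  assumes "\<And>k j. g k j \<in> borel_measurable borel"
  shows "(\<lambda>x. \<Sum>n. ennreal (exp (- discount_rate P * arrival_time (a x) n))
      * g (queue_at_arrival P u q i (a x, s x, \<sigma> x, e x, \<xi> x) n)
          (regime_before P i (e x) (\<xi> x) (arrival_time (a x) n)) (s x n) :: ennreal) \<in> borel_measurable M"
proof -
  have [measurable]: "(\<lambda>x. g (queue_at_arrival P u q i (a x, s x, \<sigma> x, e x, \<xi> x) n)
          (regime_before P i (e x) (\<xi> x) (arrival_time (a x) n)) (s x n)) \<in> borel_measurable M" for n
    by (rule measurable_compose_state[where f = g])
      (rule measurable_queue_at_arrival measurable_regime_before measurable_arrival_time s assms)+
  show ?thesis by measurable
qed

end

definition sample_sigma :: "sample measure" where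
  "sample_sigma = (\<Pi>\<^sub>M n\<in>UNIV. borel) \<Otimes>\<^sub>M (\<Pi>\<^sub>M n\<in>UNIV. borel) \<Otimes>\<^sub>M (\<Pi>\<^sub>M n\<in>UNIV. borel) \<Otimes>\<^sub>M
     (\<Pi>\<^sub>M n\<in>UNIV. borel) \<Otimes>\<^sub>M (\<Pi>\<^sub>M n\<in>UNIV. count_space UNIV)"

lemma sets_sample_space [measurable_cong]: "sets (sample_space P) = sets sample_sigma"
  unfolding sample_space_def sample_sigma_def
  by (intro sets_pair_measure_cong sets_PiM_cong) (auto simp: exp_law_def score_law_def)

lemma measurable_sample_components:
  assumes "f \<in> M \<rightarrow>\<^sub>M sample_sigma"
  shows "(\<lambda>x. fst (f x) n) \<in> borel_measurable M"
    "(\<lambda>x. fst (snd (f x)) n) \<in> borel_measurable M"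
    "(\<lambda>x. fst (snd (snd (f x))) n) \<in> borel_measurable M"
    "(\<lambda>x. fst (snd (snd (snd (f x)))) n) \<in> borel_measurable M"
    "(\<lambda>x. snd (snd (snd (snd (f x)))) n) \<in> M \<rightarrow>\<^sub>M count_space UNIV"
proof -
  note [measurable] = assms[unfolded sample_sigma_def]
  show "(\<lambda>x. fst (f x) n) \<in> borel_measurable M"
    "(\<lambda>x. fst (snd (f x)) n) \<in> borel_measurable M"
    "(\<lambda>x. fst (snd (snd (f x))) n) \<in> borel_measurable M"
    "(\<lambda>x. fst (snd (snd (snd (f x)))) n) \<in> borel_measurable M"
    "(\<lambda>x. snd (snd (snd (snd (f x)))) n) \<in> M \<rightarrow>\<^sub>M count_space UNIV"
    by measurable
qed

lemma random_sampleI: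
  assumes "1 \<le> servers P" "\<And>k j. Measurable.pred borel (u k j)" "f \<in> M \<rightarrow>\<^sub>M sample_sigma"
  shows "random_sample M P u (\<lambda>x. fst (f x)) (\<lambda>x. fst (snd (f x))) (\<lambda>x. fst (snd (snd (f x))))
     (\<lambda>x. fst (snd (snd (snd (f x))))) (\<lambda>x. snd (snd (snd (snd (f x)))))"
  using assms measurable_sample_components[OF assms(3)] by unfold_locales auto

lemma measurable_queue_length_time:
  assumes "1 \<le> servers P" "\<And>k j. Measurable.pred borel (u k j)"
  shows "(\<lambda>t. queue_length P u q i \<omega> t) \<in> borel \<rightarrow>\<^sub>M count_space UNIV"
proof -
  have "space sample_sigma = UNIV"
    by (simp add: sample_sigma_def space_pair_measure space_PiM)
  then have "(\<lambda>t. \<omega>) \<in> borel \<rightarrow>\<^sub>M sample_sigma" by simp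
  then interpret random_sample borel P u q i "\<lambda>x. fst \<omega>" "\<lambda>x. fst (snd \<omega>)" "\<lambda>x. fst (snd (snd \<omega>))"
     "\<lambda>x. fst (snd (snd (snd \<omega>)))" "\<lambda>x. snd (snd (snd (snd \<omega>)))"
    using assms by (intro random_sampleI) auto
  show ?thesis using measurable_queue_length[of "\<lambda>t. t"] by simp
qed

lemma measurable_total_cost:
  assumes "1 \<le> servers P" "\<And>k j. Measurable.pred borel (u k j)" "\<And>k j. g k j \<in> borel_measurable borel"
  shows "total_cost P u h g q i \<in> borel_measurable sample_sigma"
proof -
  have dec: "(\<lambda>x. \<Sum>n. ennreal (exp (- discount_rate P * arrival_time (fst x) n))
      * g (queue_at_arrival P u q i x n) (regime_before P i (fst (snd (snd (snd x))))
          (snd (snd (snd (snd x)))) (arrival_time (fst x) n)) (fst (snd x) n)) \<in> borel_measurable sample_sigma"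
    using random_sample.measurable_decisions[OF random_sampleI[OF assms(1,2) measurable_ident] assms(3)] by simp
  have ql: "(\<lambda>x. queue_length P u q i (fst x) (snd x)) \<in> sample_sigma \<Otimes>\<^sub>M lborel \<rightarrow>\<^sub>M count_space UNIV"
    using random_sample.measurable_queue_length[OF random_sampleI[OF assms(1,2) measurable_fst],
        where t = snd] by simp
  have "(\<lambda>x. h (queue_length P u q i (fst x) (snd x))) \<in> borel_measurable (sample_sigma \<Otimes>\<^sub>M lborel)"
    by (rule measurable_compose[OF ql]) simp
  then have "(\<lambda>x. ennreal (exp (- discount_rate P * snd x)) * h (queue_length P u q i (fst x) (snd x))
      * indicator {0..} (snd x)) \<in> borel_measurable (sample_sigma \<Otimes>\<^sub>M lborel)"
    by measurable
  then have hold: "(\<lambda>x. \<integral>\<^sup>+t\<in>{0..}. ennreal (exp (- discount_rate P * t)) * h (queue_length P u q i x t) \<partial>lborel)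
    \<in> borel_measurable sample_sigma"
    by (intro lborel.borel_measurable_nn_integral) (simp add: case_prod_beta)
  show ?thesis
    unfolding total_cost_def case_prod_beta prod.collapse by (rule borel_measurable_add[OF hold dec])
qed

section \<open>Independent coordinates and memorylessness\<close>

text \<open>\<open>f\<close> and \<open>g\<close> are independent under \<open>X\<close>, with laws \<open>Z\<close> and \<open>X\<close>.\<close>

definition splits_off :: "'x measure \<Rightarrow> ('x \<Rightarrow> 'z) \<Rightarrow> ('x \<Rightarrow> 'x) \<Rightarrow> 'z measure \<Rightarrow> bool" where
  "splits_off X f g Z \<longleftrightarrow> f \<in> X \<rightarrow>\<^sub>M Z \<and> g \<in> X \<rightarrow>\<^sub>M X \<and>
     (\<forall>F\<in>borel_measurable (Z \<Otimes>\<^sub>M X). (\<integral>\<^sup>+x. F (f x, g x) \<partial>X) = (\<integral>\<^sup>+z. \<integral>\<^sup>+x. F (z, x) \<partial>X \<partial>Z))"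

lemma splits_offD:
  assumes "splits_off X f g Z" "F \<in> borel_measurable (Z \<Otimes>\<^sub>M X)"
  shows "(\<integral>\<^sup>+x. F (f x, g x) \<partial>X) = (\<integral>\<^sup>+z. \<integral>\<^sup>+x. F (z, x) \<partial>X \<partial>Z)"
  using assms unfolding splits_off_def by blast

lemma inj_skip: "inj (skip k)"
  by (auto simp: inj_on_def skip_def split: if_splits)

lemma skip_neq: "skip k j \<noteq> k"
  by (auto simp: skip_def)

lemma skip_surj: "j < n \<Longrightarrow> j \<noteq> k \<Longrightarrow> k < n \<Longrightarrow> \<exists>l<n - 1. j = skip k l"
  by (intro exI[of _ "if j < k then j else j - 1"]) (auto simp: skip_def)

lemma measurable_resample:
  fixes M :: "'a measure"
  shows "(\<lambda>(x, X). X(k := x)) \<in> M \<Otimes>\<^sub>M (\<Pi>\<^sub>M n\<in>(UNIV::nat set). M) \<rightarrow>\<^sub>M (\<Pi>\<^sub>M n\<in>UNIV. M)"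
proof (rule measurable_PiM_single')
  fix j :: nat
  have "(\<lambda>p. if j = k then fst p else snd p j) \<in> M \<Otimes>\<^sub>M (\<Pi>\<^sub>M n\<in>(UNIV::nat set). M) \<rightarrow>\<^sub>M M" by measurable
  then show "(\<lambda>p. (case p of (x, X) \<Rightarrow> X(k := x)) j) \<in> M \<Otimes>\<^sub>M (\<Pi>\<^sub>M n\<in>(UNIV::nat set). M) \<rightarrow>\<^sub>M M"
    by (simp add: case_prod_beta fun_upd_apply)
qed (auto simp: space_pair_measure space_PiM)

text \<open>Overwriting one coordinate of an i.i.d. sequence by an independent copy preserves the
  law.\<close>

lemma nn_integral_resample:
  fixes M :: "'a measure" and k :: nat
  assumes "prob_space M" and F: "F \<in> borel_measurable (\<Pi>\<^sub>M n\<in>UNIV. M)"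
  shows "(\<integral>\<^sup>+\<sigma>. F \<sigma> \<partial>(\<Pi>\<^sub>M n\<in>UNIV. M)) = (\<integral>\<^sup>+x. \<integral>\<^sup>+\<sigma>. F (\<sigma>(k := x)) \<partial>(\<Pi>\<^sub>M n\<in>UNIV. M) \<partial>M)"
proof -
  let ?S = "\<Pi>\<^sub>M n\<in>(UNIV :: nat set). M"
  interpret prob_space M by fact
  interpret S: prob_space ?S by (intro prob_space_PiM assms)
  have eq: "distr (M \<Otimes>\<^sub>M ?S) ?S (\<lambda>(x, X). X(k := x)) = ?S"
    using distr_pair_PiM_eq_PiM[of "UNIV :: nat set" "\<lambda>_. M" k] assms(1) by simp
  note upd[measurable] = measurable_resample[of k M]
  have "(\<integral>\<^sup>+\<sigma>. F \<sigma> \<partial>?S) = (\<integral>\<^sup>+p. F ((\<lambda>(x, X). X(k := x)) p) \<partial>(M \<Otimes>\<^sub>M ?S))"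
    by (subst eq[symmetric], subst nn_integral_distr) (use F in auto)
  also have "\<dots> = (\<integral>\<^sup>+x. \<integral>\<^sup>+\<sigma>. F (\<sigma>(k := x)) \<partial>?S \<partial>M)"
    by (subst S.nn_integral_fst[symmetric]) (use F upd in \<open>auto intro: measurable_compose[OF upd]\<close>)
  finally show ?thesis .
qed

text \<open>Resampling coordinate \<open>k\<close> does not touch the other entries, which gives
  independence; these entries, reindexed along the injection \<open>skip k\<close>, form an i.i.d.
  sequence of the same law.\<close>

lemma splits_off_PiM:
  fixes M :: "'a measure"
  assumes "prob_space M"
  shows "splits_off (\<Pi>\<^sub>M n\<in>(UNIV::nat set). M) (\<lambda>\<sigma>. \<sigma> k) (\<lambda>\<sigma> j. \<sigma> (skip k j)) M"
proof -
  let ?S = "\<Pi>\<^sub>M n\<in>(UNIV :: nat set). M"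
  interpret prob_space M by fact
  interpret S: prob_space ?S by (intro prob_space_PiM assms)
  have sk: "(\<lambda>\<sigma> j. \<sigma> (skip k j)) \<in> ?S \<rightarrow>\<^sub>M ?S"
    by (rule measurable_PiM_single') (auto simp: space_PiM intro: measurable_component_singleton)
  have eq: "distr ?S ?S (\<lambda>\<sigma> j. \<sigma> (skip k j)) = ?S"
    using distr_PiM_reindex[of "UNIV :: nat set" "\<lambda>_. M" "skip k" UNIV, OF assms inj_skip]
    by (simp only: restrict_UNIV UNIV_I Pi_UNIV)
  have main: "(\<integral>\<^sup>+\<sigma>. F (\<sigma> k, \<lambda>j. \<sigma> (skip k j)) \<partial>?S) = (\<integral>\<^sup>+x. \<integral>\<^sup>+\<sigma>. F (x, \<sigma>) \<partial>?S \<partial>M)"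
    if F[measurable]: "F \<in> borel_measurable (M \<Otimes>\<^sub>M ?S)" for F
  proof -
    have "(\<integral>\<^sup>+\<sigma>. F (\<sigma> k, \<lambda>j. \<sigma> (skip k j)) \<partial>?S) = (\<integral>\<^sup>+x. \<integral>\<^sup>+\<sigma>. F (x, \<lambda>j. \<sigma> (skip k j)) \<partial>?S \<partial>M)"
    proof -
      have "(\<lambda>\<sigma>. F (\<sigma> k, \<lambda>j. \<sigma> (skip k j))) \<in> borel_measurable ?S"
        by (rule measurable_compose[OF measurable_Pair F]) (auto intro: sk)
      from nn_integral_resample[OF assms this, of k] show ?thesis by (simp add: skip_neq)
    qed
    also have "\<dots> = (\<integral>\<^sup>+x. \<integral>\<^sup>+\<sigma>. F (x, \<sigma>) \<partial>?S \<partial>M)"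
    proof (rule nn_integral_cong)
      fix x assume "x \<in> space M"
      then have [measurable]: "(\<lambda>\<sigma>. F (x, \<sigma>)) \<in> borel_measurable ?S" by measurable
      show "(\<integral>\<^sup>+\<sigma>. F (x, \<lambda>j. \<sigma> (skip k j)) \<partial>?S) = (\<integral>\<^sup>+\<sigma>. F (x, \<sigma>) \<partial>?S)"
        using nn_integral_distr[OF sk, of "\<lambda>\<sigma>. F (x, \<sigma>)"] by (simp add: eq)
    qed
    finally show ?thesis .
  qed
  show ?thesis unfolding splits_off_def
    by (intro conjI ballI main sk measurable_component_singleton) auto
qed

lemma splits_off_fst:
  assumes X: "prob_space X" and Y: "prob_space Y" and Z: "prob_space Z" and s: "splits_off X f g Z"
  shows "splits_off (X \<Otimes>\<^sub>M Y) (\<lambda>(x, y). f x) (\<lambda>(x, y). (g x, y)) Z"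
proof -
  interpret X: prob_space X by fact
  interpret Y: prob_space Y by fact
  interpret Z: prob_space Z by fact
  interpret XY: pair_sigma_finite X Y ..
  have [measurable]: "f \<in> X \<rightarrow>\<^sub>M Z" "g \<in> X \<rightarrow>\<^sub>M X" using s by (auto simp: splits_off_def)
  have main: "(\<integral>\<^sup>+p. F ((\<lambda>(x, y). f x) p, (\<lambda>(x, y). (g x, y)) p) \<partial>(X \<Otimes>\<^sub>M Y)) = (\<integral>\<^sup>+z. \<integral>\<^sup>+p. F (z, p) \<partial>(X \<Otimes>\<^sub>M Y) \<partial>Z)"
    if F[measurable]: "F \<in> borel_measurable (Z \<Otimes>\<^sub>M (X \<Otimes>\<^sub>M Y))" for F
  proof -
    have "(\<integral>\<^sup>+p. F ((\<lambda>(x, y). f x) p, (\<lambda>(x, y). (g x, y)) p) \<partial>(X \<Otimes>\<^sub>M Y)) = (\<integral>\<^sup>+x. \<integral>\<^sup>+y. F (f x, g x, y) \<partial>Y \<partial>X)"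
      by (subst Y.nn_integral_fst[symmetric]) auto
    also have "\<dots> = (\<integral>\<^sup>+z. \<integral>\<^sup>+x. \<integral>\<^sup>+y. F (z, x, y) \<partial>Y \<partial>X \<partial>Z)"
    proof -
      have "(\<lambda>(z, x). \<integral>\<^sup>+y. F (z, x, y) \<partial>Y) \<in> borel_measurable (Z \<Otimes>\<^sub>M X)" by measurable
      from splits_offD[OF s this] show ?thesis by simp
    qed
    also have "\<dots> = (\<integral>\<^sup>+z. \<integral>\<^sup>+p. F (z, p) \<partial>(X \<Otimes>\<^sub>M Y) \<partial>Z)"
      by (rule nn_integral_cong, subst Y.nn_integral_fst[symmetric]) auto
    finally show ?thesis .
  qed
  show ?thesis unfolding splits_off_def by (intro conjI ballI main) measurable
qed

lemma splits_off_snd: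
  assumes X: "prob_space X" and Y: "prob_space Y" and Z: "prob_space Z" and s: "splits_off Y f g Z"
  shows "splits_off (X \<Otimes>\<^sub>M Y) (\<lambda>(x, y). f y) (\<lambda>(x, y). (x, g y)) Z"
proof -
  interpret X: prob_space X by fact
  interpret Y: prob_space Y by fact
  interpret Z: prob_space Z by fact
  interpret ZX: pair_sigma_finite Z X ..
  have [measurable]: "f \<in> Y \<rightarrow>\<^sub>M Z" "g \<in> Y \<rightarrow>\<^sub>M Y" using s by (auto simp: splits_off_def)
  have main: "(\<integral>\<^sup>+p. F ((\<lambda>(x, y). f y) p, (\<lambda>(x, y). (x, g y)) p) \<partial>(X \<Otimes>\<^sub>M Y)) = (\<integral>\<^sup>+z. \<integral>\<^sup>+p. F (z, p) \<partial>(X \<Otimes>\<^sub>M Y) \<partial>Z)"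
    if F[measurable]: "F \<in> borel_measurable (Z \<Otimes>\<^sub>M (X \<Otimes>\<^sub>M Y))" for F
  proof -
    have "(\<integral>\<^sup>+p. F ((\<lambda>(x, y). f y) p, (\<lambda>(x, y). (x, g y)) p) \<partial>(X \<Otimes>\<^sub>M Y)) = (\<integral>\<^sup>+x. \<integral>\<^sup>+y. F (f y, x, g y) \<partial>Y \<partial>X)"
      by (subst Y.nn_integral_fst[symmetric]) auto
    also have "\<dots> = (\<integral>\<^sup>+x. \<integral>\<^sup>+z. \<integral>\<^sup>+y. F (z, x, y) \<partial>Y \<partial>Z \<partial>X)"
    proof (rule nn_integral_cong)
      fix x assume [measurable]: "x \<in> space X"
      have "(\<lambda>(z, y). F (z, x, y)) \<in> borel_measurable (Z \<Otimes>\<^sub>M Y)" by measurable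
      from splits_offD[OF s this] show "(\<integral>\<^sup>+y. F (f y, x, g y) \<partial>Y) = (\<integral>\<^sup>+z. \<integral>\<^sup>+y. F (z, x, y) \<partial>Y \<partial>Z)"
        by simp
    qed
    also have "\<dots> = (\<integral>\<^sup>+z. \<integral>\<^sup>+x. \<integral>\<^sup>+y. F (z, x, y) \<partial>Y \<partial>X \<partial>Z)"
      by (rule ZX.Fubini') measurable
    also have "\<dots> = (\<integral>\<^sup>+z. \<integral>\<^sup>+p. F (z, p) \<partial>(X \<Otimes>\<^sub>M Y) \<partial>Z)"
      by (rule nn_integral_cong, subst Y.nn_integral_fst[symmetric]) auto
    finally show ?thesis .
  qed
  show ?thesis unfolding splits_off_def by (intro conjI ballI main) measurable
qed

lemma splits_off_AE:
  assumes s: "splits_off X f g Z" and X: "prob_space X" and Q: "AE z in Z. Q z"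
  shows "AE x in X. Q (f x)"
proof -
  interpret prob_space X by fact
  have [measurable]: "f \<in> X \<rightarrow>\<^sub>M Z" using s by (simp add: splits_off_def)
  have eq: "distr X Z f = Z"
  proof (rule measure_eqI)
    fix A assume A: "A \<in> sets (distr X Z f)"
    then have [measurable]: "A \<in> sets Z" by simp
    have "emeasure (distr X Z f) A = (\<integral>\<^sup>+z. indicator A z \<partial>distr X Z f)"
      by (rule nn_integral_indicator[symmetric]) (rule A)
    also have "\<dots> = (\<integral>\<^sup>+x. indicator A (f x) \<partial>X)" by (rule nn_integral_distr) measurable
    also have "\<dots> = (\<integral>\<^sup>+z. \<integral>\<^sup>+x. indicator A z \<partial>X \<partial>Z)"
    proof -
      have "(\<lambda>(z, x). indicator A z :: ennreal) \<in> borel_measurable (Z \<Otimes>\<^sub>M X)" by measurable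
      from splits_offD[OF s this] show ?thesis by simp
    qed
    finally show "emeasure (distr X Z f) A = emeasure Z A" by (simp add: emeasure_space_1)
  qed simp
  have "AE z in distr X Z f. Q z" unfolding eq by (rule Q)
  then show ?thesis by (rule AE_distrD[rotated]) measurable
qed

text \<open>
  For an indicator \<open>w\<close>, an event of probability \<open>c\<close>: conditionally on it, \<open>op\<close> again has law \<open>X\<close>. This is the form
  in which memorylessness is used.
\<close>

definition rescales :: "'x measure \<Rightarrow> ('x \<Rightarrow> 'x) \<Rightarrow> ('x \<Rightarrow> ennreal) \<Rightarrow> ennreal \<Rightarrow> bool" where
  "rescales X op w c \<longleftrightarrow> op \<in> X \<rightarrow>\<^sub>M X \<and> w \<in> borel_measurable X \<and>
     (\<forall>F\<in>borel_measurable X. (\<integral>\<^sup>+x. F (op x) * w x \<partial>X) = c * (\<integral>\<^sup>+x. F x \<partial>X))"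

lemma rescalesD:
  assumes "rescales X op w c" "F \<in> borel_measurable X"
  shows "(\<integral>\<^sup>+x. F (op x) * w x \<partial>X) = c * (\<integral>\<^sup>+x. F x \<partial>X)"
  using assms unfolding rescales_def by blast

lemma rescales_id: "rescales X (\<lambda>x. x) (\<lambda>_. 1) 1"
  by (simp add: rescales_def)

lemma rescales_comp:
  assumes 1: "rescales X op w c" and 2: "rescales X op' w' c'"
  shows "rescales X (\<lambda>x. op' (op x)) (\<lambda>x. w' (op x) * w x) (c * c')"
proof -
  have [measurable]: "op \<in> X \<rightarrow>\<^sub>M X" "op' \<in> X \<rightarrow>\<^sub>M X" "w \<in> borel_measurable X" "w' \<in> borel_measurable X"
    using assms by (auto simp: rescales_def)
  have main: "(\<integral>\<^sup>+x. F (op' (op x)) * (w' (op x) * w x) \<partial>X) = c * c' * (\<integral>\<^sup>+x. F x \<partial>X)"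
    if [measurable]: "F \<in> borel_measurable X" for F
  proof -
    have "(\<lambda>x. F (op' x) * w' x) \<in> borel_measurable X" by measurable
    from rescalesD[OF 1 this]
    have "(\<integral>\<^sup>+x. (F (op' (op x)) * w' (op x)) * w x \<partial>X) = c * (\<integral>\<^sup>+x. F (op' x) * w' x \<partial>X)" .
    also have "(\<integral>\<^sup>+x. F (op' x) * w' x \<partial>X) = c' * (\<integral>\<^sup>+x. F x \<partial>X)" by (rule rescalesD[OF 2]) fact
    finally show ?thesis by (simp add: mult.assoc)
  qed
  show ?thesis unfolding rescales_def by (intro conjI ballI main) measurable
qed

lemma rescales_pair:
  assumes "prob_space X" "prob_space Y" and 1: "rescales X op w c" and 2: "rescales Y op' w' c'"
  shows "rescales (X \<Otimes>\<^sub>M Y) (\<lambda>(x, y). (op x, op' y)) (\<lambda>(x, y). w x * w' y) (c * c')"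
proof -
  interpret X: prob_space X by fact
  interpret Y: prob_space Y by fact
  have [measurable]: "op \<in> X \<rightarrow>\<^sub>M X" "op' \<in> Y \<rightarrow>\<^sub>M Y" "w \<in> borel_measurable X" "w' \<in> borel_measurable Y"
    using assms by (auto simp: rescales_def)
  have main: "(\<integral>\<^sup>+p. F ((\<lambda>(x, y). (op x, op' y)) p) * (\<lambda>(x, y). w x * w' y) p \<partial>(X \<Otimes>\<^sub>M Y))
      = c * c' * (\<integral>\<^sup>+p. F p \<partial>(X \<Otimes>\<^sub>M Y))" if [measurable]: "F \<in> borel_measurable (X \<Otimes>\<^sub>M Y)" for F
  proof -
    have "(\<integral>\<^sup>+p. F ((\<lambda>(x, y). (op x, op' y)) p) * (\<lambda>(x, y). w x * w' y) p \<partial>(X \<Otimes>\<^sub>M Y))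
       = (\<integral>\<^sup>+x. \<integral>\<^sup>+y. F (op x, op' y) * (w x * w' y) \<partial>Y \<partial>X)"
      by (subst Y.nn_integral_fst[symmetric]) auto
    also have "\<dots> = (\<integral>\<^sup>+x. (c' * (\<integral>\<^sup>+y. F (op x, y) \<partial>Y)) * w x \<partial>X)"
    proof (rule nn_integral_cong)
      fix x assume [measurable]: "x \<in> space X"
      have "(\<integral>\<^sup>+y. F (op x, op' y) * (w x * w' y) \<partial>Y) = (\<integral>\<^sup>+y. w x * (F (op x, op' y) * w' y) \<partial>Y)"
        by (simp add: mult_ac)
      also have "\<dots> = w x * (\<integral>\<^sup>+y. F (op x, op' y) * w' y \<partial>Y)"
        by (rule nn_integral_cmult) measurable
      also have "(\<integral>\<^sup>+y. F (op x, op' y) * w' y \<partial>Y) = c' * (\<integral>\<^sup>+y. F (op x, y) \<partial>Y)"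
        by (rule rescalesD[OF 2]) measurable
      finally show "(\<integral>\<^sup>+y. F (op x, op' y) * (w x * w' y) \<partial>Y) = (c' * (\<integral>\<^sup>+y. F (op x, y) \<partial>Y)) * w x"
        by (simp add: mult_ac)
    qed
    also have "\<dots> = c * (\<integral>\<^sup>+x. c' * (\<integral>\<^sup>+y. F (x, y) \<partial>Y) \<partial>X)"
    proof -
      have "(\<lambda>x. c' * (\<integral>\<^sup>+y. F (x, y) \<partial>Y)) \<in> borel_measurable X" by measurable
      from rescalesD[OF 1 this] show ?thesis .
    qed
    also have "\<dots> = c * (c' * (\<integral>\<^sup>+x. \<integral>\<^sup>+y. F (x, y) \<partial>Y \<partial>X))"
      by (subst nn_integral_cmult) auto
    finally show ?thesis by (simp add: Y.nn_integral_fst mult.assoc)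
  qed
  show ?thesis unfolding rescales_def by (intro conjI ballI main) measurable
qed

section \<open>Exponential clocks\<close>

lemma sets_exp_law [simp, measurable_cong]: "sets (exp_law r) = sets borel"
  by (simp add: exp_law_def)

lemma space_exp_law [simp]: "space (exp_law r) = UNIV"
  by (simp add: exp_law_def)

lemma prob_space_exp_law: "0 < r \<Longrightarrow> prob_space (exp_law r)"
  using prob_space_exponential_density[of r] by (simp add: exp_law_def)

lemma nn_integral_exp_law:
  assumes "G \<in> borel_measurable borel"
  shows "(\<integral>\<^sup>+x. G x \<partial>exp_law r) = (\<integral>\<^sup>+x. ennreal (exponential_density r x) * G x \<partial>lborel)"
  using assms by (simp add: exp_law_def nn_integral_density)

text \<open>The substitution \<open>x = t + y\<close> splits the factor
  \<open>exp (- (r * t))\<close> off the density. The point \<open>y = 0\<close>, where the density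
  is positive but the strict indicator vanishes, is a null set.\<close>

lemma exp_law_memoryless:
  assumes r: "0 < r" and t: "0 \<le> t" and [measurable]: "G \<in> borel_measurable borel"
  shows "(\<integral>\<^sup>+x. G (x - t) * indicator {t<..} x \<partial>exp_law r) = ennreal (exp (- (r * t))) * (\<integral>\<^sup>+x. G x \<partial>exp_law r)"
proof -
  have "(\<integral>\<^sup>+x. G (x - t) * indicator {t<..} x \<partial>exp_law r)
     = (\<integral>\<^sup>+x. ennreal (exponential_density r x) * (G (x - t) * indicator {t<..} x) \<partial>lborel)"
    by (rule nn_integral_exp_law) measurable
  also have "\<dots> = (\<integral>\<^sup>+y. ennreal (exponential_density r (t + 1 * y)) * (G (t + 1 * y - t) * indicator {t<..} (t + 1 * y)) \<partial>lborel)"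
    by (subst nn_integral_real_affine[of _ 1 t]) auto
  also have "\<dots> = (\<integral>\<^sup>+y. ennreal (exp (- (r * t))) * (ennreal (exponential_density r y) * G y) \<partial>lborel)"
    using AE_lborel_singleton[of 0]
  proof (intro nn_integral_cong_AE, eventually_elim)
    fix y :: real assume "y \<noteq> 0"
    have "ennreal (exponential_density r (t + y)) = ennreal (exp (- (r * t))) * ennreal (exponential_density r y)" if "0 < y"
      using that t r by (simp add: exponential_density_def exp_add[symmetric] algebra_simps flip: ennreal_mult)
    then show "ennreal (exponential_density r (t + 1 * y)) * (G (t + 1 * y - t) * indicator {t<..} (t + 1 * y))
      = ennreal (exp (- (r * t))) * (ennreal (exponential_density r y) * G y)"
      using \<open>y \<noteq> 0\<close> by (cases "0 < y") (auto simp: mult.assoc exponential_density_def)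
  qed
  also have "\<dots> = ennreal (exp (- (r * t))) * (\<integral>\<^sup>+x. G x \<partial>exp_law r)"
    by (subst nn_integral_cmult) (auto simp: nn_integral_exp_law)
  finally show ?thesis .
qed

text \<open>Tilting the density of rate \<open>\<rho>\<close> by
  \<open>exp (- (\<kappa> * t))\<close> gives the density of rate \<open>\<rho> + \<kappa>\<close>
  up to a constant. With \<open>\<kappa>\<close> the total rate of the competing clocks, that
  constant is the probability that this clock rings first; with a discount rate, it is the expected
  discount factor.\<close>

lemma exp_law_laplace:
  assumes "0 < \<rho>" "0 \<le> \<kappa>"
  shows "(\<integral>\<^sup>+t. ennreal (exp (- (\<kappa> * t))) \<partial>exp_law \<rho>) = ennreal (\<rho> / (\<rho> + \<kappa>))"
proof -
  have "(\<integral>\<^sup>+t. ennreal (exp (- (\<kappa> * t))) \<partial>exp_law \<rho>)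
    = (\<integral>\<^sup>+t. ennreal (exponential_density \<rho> t) * ennreal (exp (- (\<kappa> * t))) \<partial>lborel)"
    by (rule nn_integral_exp_law) measurable
  also have "\<dots> = (\<integral>\<^sup>+t. ennreal (exponential_density (\<rho> + \<kappa>) t) * ennreal (\<rho> / (\<rho> + \<kappa>)) \<partial>lborel)"
  proof (rule nn_integral_cong)
    fix t :: real
    have "exponential_density \<rho> t * exp (- (\<kappa> * t)) = exponential_density (\<rho> + \<kappa>) t * (\<rho> / (\<rho> + \<kappa>))"
      using assms by (simp add: exponential_density_def mult_exp_exp distrib_left mult.commute)
    moreover have "0 \<le> exponential_density \<rho> t" "0 \<le> exponential_density (\<rho> + \<kappa>) t"
      using assms by (auto simp: exponential_density_def)
    ultimately show "ennreal (exponential_density \<rho> t) * ennreal (exp (- (\<kappa> * t)))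
       = ennreal (exponential_density (\<rho> + \<kappa>) t) * ennreal (\<rho> / (\<rho> + \<kappa>))"
      using assms by (simp flip: ennreal_mult)
  qed
  also have "\<dots> = (\<integral>\<^sup>+t. ennreal (\<rho> / (\<rho> + \<kappa>)) \<partial>exp_law (\<rho> + \<kappa>))"
    by (subst nn_integral_exp_law) auto
  also have "\<dots> = ennreal (\<rho> / (\<rho> + \<kappa>))"
    using prob_space.emeasure_space_1[OF prob_space_exp_law[of "\<rho> + \<kappa>"]] assms by simp
  finally show ?thesis .
qed

lemma AE_exp_law_pos: "AE t in exp_law r. 0 < t"
proof -
  have "AE t in lborel. 0 < exponential_density r t \<longrightarrow> 0 < t"
    using AE_lborel_singleton[of 0] by eventually_elim (auto simp: exponential_density_def not_less)
  then show ?thesis unfolding exp_law_def by (subst AE_density) auto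
qed

lemma exp_law_scale:
  assumes "0 < r" and [measurable]: "G \<in> borel_measurable borel"
  shows "(\<integral>\<^sup>+x. G (x / r) \<partial>exp_law 1) = (\<integral>\<^sup>+x. G x \<partial>exp_law r)"
proof -
  have "(\<integral>\<^sup>+x. G (x / r) \<partial>exp_law 1) = (\<integral>\<^sup>+x. ennreal (exponential_density 1 x) * G (x / r) \<partial>lborel)"
    by (rule nn_integral_exp_law) measurable
  also have "\<dots> = ennreal r * (\<integral>\<^sup>+y. ennreal (exponential_density 1 (0 + r * y)) * G ((0 + r * y) / r) \<partial>lborel)"
    using assms(1) by (subst nn_integral_real_affine[of _ r 0]) auto
  also have "\<dots> = (\<integral>\<^sup>+y. ennreal r * (ennreal (exponential_density 1 (0 + r * y)) * G ((0 + r * y) / r)) \<partial>lborel)"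
    by (subst nn_integral_cmult) auto
  also have "\<dots> = (\<integral>\<^sup>+y. ennreal (exponential_density r y) * G y \<partial>lborel)"
  proof (rule nn_integral_cong)
    fix y
    have "r * exponential_density 1 (r * y) = exponential_density r y"
      using assms(1) by (auto simp: exponential_density_def mult_less_0_iff mult.commute)
    then have "ennreal r * ennreal (exponential_density 1 (r * y)) = ennreal (exponential_density r y)"
      using assms(1) by (metis ennreal_mult'' exponential_density_nonneg less_eq_real_def zero_less_one)
    then show "ennreal r * (ennreal (exponential_density 1 (0 + r * y)) * G ((0 + r * y) / r))
      = ennreal (exponential_density r y) * G y"
      using assms(1) by (simp add: mult.assoc[symmetric])
  qed
  also have "\<dots> = (\<integral>\<^sup>+x. G x \<partial>exp_law r)" by (rule nn_integral_exp_law[symmetric]) measurable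
  finally show ?thesis .
qed

lemma measurable_seq_upd:
  "(\<lambda>\<sigma>. \<sigma>(k := \<sigma> k - t)) \<in> (\<Pi>\<^sub>M n\<in>(UNIV::nat set). exp_law r) \<rightarrow>\<^sub>M (\<Pi>\<^sub>M n\<in>UNIV. exp_law r)"
proof (rule measurable_PiM_single')
  fix j :: nat
  have "(\<lambda>\<sigma>. if j = k then \<sigma> k - t else \<sigma> j) \<in> (\<Pi>\<^sub>M n\<in>UNIV. exp_law r) \<rightarrow>\<^sub>M exp_law r" by measurable
  then show "(\<lambda>\<sigma>. (\<sigma>(k := \<sigma> k - t)) j) \<in> (\<Pi>\<^sub>M n\<in>UNIV. exp_law r) \<rightarrow>\<^sub>M exp_law r" by (simp add: fun_upd_apply)
qed (auto simp: space_PiM)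

text \<open>Resampling coordinate \<open>k\<close> turns the claim into a double integral; after
  exchanging the order, the inner integral is memorylessness of a single exponential.\<close>

lemma rescales_one:
  assumes r: "0 < r" and t: "0 \<le> t"
  shows "rescales (\<Pi>\<^sub>M n\<in>(UNIV::nat set). exp_law r) (\<lambda>\<sigma>. \<sigma>(k := \<sigma> k - t)) (\<lambda>\<sigma>. indicator {t<..} (\<sigma> k)) (ennreal (exp (- (r * t))))"
proof -
  let ?M = "exp_law r"
  let ?S = "\<Pi>\<^sub>M n\<in>(UNIV :: nat set). ?M"
  have p: "prob_space ?M" using r by (rule prob_space_exp_law)
  interpret prob_space ?M by fact
  interpret S: prob_space ?S by (intro prob_space_PiM p)
  interpret pair_sigma_finite ?M ?S ..
  note upd[measurable] = measurable_seq_upd[of k t r]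
  note upd2 = measurable_resample[of k ?M]
  have main: "(\<integral>\<^sup>+\<sigma>. F (\<sigma>(k := \<sigma> k - t)) * indicator {t<..} (\<sigma> k) \<partial>?S) = ennreal (exp (- (r * t))) * (\<integral>\<^sup>+\<sigma>. F \<sigma> \<partial>?S)"
    if F[measurable]: "F \<in> borel_measurable ?S" for F
  proof -
    have FM: "(\<lambda>(x, X). F (X(k := x))) \<in> borel_measurable (?M \<Otimes>\<^sub>M ?S)"
      using measurable_compose[OF upd2 F] by (simp add: case_prod_beta)
    have Fx: "(\<lambda>x. F (X(k := x))) \<in> borel_measurable borel" if "X \<in> space ?S" for X
      using measurable_compose[OF measurable_Pair2'[OF that] FM] that
      by (auto cong: measurable_cong_sets)
    have FMt: "(\<lambda>(x, X). F (X(k := x - t)) * indicator {t<..} x) \<in> borel_measurable (?M \<Otimes>\<^sub>M ?S)"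
    proof -
      have "(\<lambda>p. (fst p - t, snd p)) \<in> ?M \<Otimes>\<^sub>M ?S \<rightarrow>\<^sub>M ?M \<Otimes>\<^sub>M ?S" by measurable
      from measurable_compose[OF this FM] have "(\<lambda>p. F ((snd p)(k := fst p - t))) \<in> borel_measurable (?M \<Otimes>\<^sub>M ?S)"
        by simp
      then show ?thesis unfolding case_prod_beta by measurable
    qed
    have "(\<integral>\<^sup>+\<sigma>. F (\<sigma>(k := \<sigma> k - t)) * indicator {t<..} (\<sigma> k) \<partial>?S)
      = (\<integral>\<^sup>+x. \<integral>\<^sup>+\<sigma>. F (\<sigma>(k := x - t)) * indicator {t<..} x \<partial>?S \<partial>?M)"
    proof -
      have "(\<lambda>\<sigma>. F (\<sigma>(k := \<sigma> k - t)) * indicator {t<..} (\<sigma> k)) \<in> borel_measurable ?S"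
        using measurable_compose[OF upd F] by measurable
      from nn_integral_resample[OF p this, of k] show ?thesis by simp
    qed
    also have "\<dots> = (\<integral>\<^sup>+\<sigma>. \<integral>\<^sup>+x. F (\<sigma>(k := x - t)) * indicator {t<..} x \<partial>?M \<partial>?S)"
      by (rule Fubini'[symmetric]) (rule FMt)
    also have "\<dots> = (\<integral>\<^sup>+\<sigma>. ennreal (exp (- (r * t))) * (\<integral>\<^sup>+x. F (\<sigma>(k := x)) \<partial>?M) \<partial>?S)"
      by (rule nn_integral_cong) (rule exp_law_memoryless[OF r t Fx])
    also have "\<dots> = ennreal (exp (- (r * t))) * (\<integral>\<^sup>+\<sigma>. \<integral>\<^sup>+x. F (\<sigma>(k := x)) \<partial>?M \<partial>?S)"
      by (intro nn_integral_cmult borel_measurable_nn_integral)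
        (use measurable_compose[OF measurable_pair_swap' FM] in \<open>simp add: case_prod_beta\<close>)
    also have "(\<integral>\<^sup>+\<sigma>. \<integral>\<^sup>+x. F (\<sigma>(k := x)) \<partial>?M \<partial>?S) = (\<integral>\<^sup>+x. \<integral>\<^sup>+\<sigma>. F (\<sigma>(k := x)) \<partial>?S \<partial>?M)"
      by (rule Fubini') (rule FM)
    also have "\<dots> = (\<integral>\<^sup>+\<sigma>. F \<sigma> \<partial>?S)" by (rule nn_integral_resample[OF p F, symmetric])
    finally show ?thesis .
  qed
  show ?thesis unfolding rescales_def by (intro conjI ballI main upd; (assumption | measurable))
qed

lemma rescales_age:
  assumes r: "0 < r" and t: "0 \<le> t"
  shows "rescales (\<Pi>\<^sub>M n\<in>UNIV. exp_law r) (age k t) (\<lambda>\<sigma>. indicator {\<sigma>. alive k t \<sigma>} \<sigma>) (ennreal (exp (- (real k * r * t))))"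
proof (induction k)
  case 0
  have "age 0 t = (\<lambda>\<sigma>. \<sigma>)" by (auto simp: age_def)
  then show ?case using rescales_id by (simp add: alive_def)
next
  case (Suc k)
  have "(age k t \<sigma>)(k := age k t \<sigma> k - t) = age (Suc k) t \<sigma>" for \<sigma>
    by (auto simp: age_def fun_eq_iff)
  moreover have "(indicator {t<..} (age k t \<sigma> k) :: ennreal) * indicator {\<sigma>. alive k t \<sigma>} \<sigma>
     = indicator {\<sigma>. alive (Suc k) t \<sigma>} \<sigma>" for \<sigma>
    by (auto simp: age_def alive_def indicator_def less_Suc_eq)
  moreover have "ennreal (exp (- (real k * r * t))) * ennreal (exp (- (r * t))) = ennreal (exp (- (real (Suc k) * r * t)))"
    by (simp add: exp_add[symmetric] algebra_simps flip: ennreal_mult)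
  ultimately show ?case using rescales_comp[OF Suc rescales_one[OF r t, of k]] by simp
qed

lemma ennreal_sum_products:
  "0 \<le> a \<Longrightarrow> 0 \<le> b \<Longrightarrow> 0 \<le> c \<Longrightarrow> 0 \<le> d \<Longrightarrow>
    ennreal a * ennreal b + ennreal c * ennreal d = ennreal (a * b + c * d)"
  by (simp add: ennreal_mult)

text \<open>Pairwise exclusive events. Pointwise only an inequality is possible, because at a tie
  between clocks none of the strict events occurs.\<close>

lemma sum_exclusive_le_1:
  fixes A B :: bool and S :: "nat \<Rightarrow> bool"
  assumes "\<And>l l'. l < n \<Longrightarrow> l' < n \<Longrightarrow> S l \<Longrightarrow> S l' \<Longrightarrow> l = l'" "\<And>l. l < n \<Longrightarrow> S l \<Longrightarrow> \<not> A \<and> \<not> B" "\<not> (A \<and> B)"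
  shows "of_bool A + (\<Sum>l<n. of_bool (S l)) + of_bool B \<le> (1 :: ennreal)"
proof (cases "\<exists>l<n. S l")
  case True
  then obtain l where l: "l < n" "S l" by auto
  have "(\<Sum>l'<n. of_bool (S l') :: ennreal) = (\<Sum>l'<n. if l' = l then 1 else 0)"
    using assms(1) l by (intro sum.cong) auto
  then show ?thesis using l assms(2) by simp
next
  case False
  then have "(\<Sum>l'<n. of_bool (S l') :: ennreal) = 0" by simp
  then show ?thesis using assms(3) by auto
qed

text \<open>With total rate \<open>R = \<rho> + \<kappa>\<close>, the clock of rate
  \<open>\<rho>\<close> rings first with probability \<open>\<rho> / R\<close>, the expected
  discounted time up to the event is \<open>1 / (R + \<alpha>)\<close>, and the expected discount
  factor at it is \<open>R / (R + \<alpha>)\<close>; the time of the event is independent of which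
  clock causes it.\<close>

lemma exp_law_discounted_cost:
  fixes h \<Gamma> :: ennreal
  assumes \<rho>: "0 < \<rho>" and \<kappa>: "0 \<le> \<kappa>" and \<alpha>: "0 < \<alpha>"
  shows "(\<integral>\<^sup>+t. (h * ennreal ((1 - exp (- \<alpha> * t)) / \<alpha>) + ennreal (exp (- \<alpha> * t)) * \<Gamma>) * ennreal (exp (- (\<kappa> * t))) \<partial>exp_law \<rho>)
     = h * ennreal (\<rho> / ((\<rho> + \<kappa>) * (\<rho> + \<kappa> + \<alpha>))) + ennreal (\<rho> / (\<rho> + \<kappa> + \<alpha>)) * \<Gamma>"
proof -
  have e: "ennreal (exp (- \<alpha> * t)) * ennreal (exp (- (\<kappa> * t))) = ennreal (exp (- ((\<kappa> + \<alpha>) * t)))" for t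
    by (simp add: mult_exp_exp algebra_simps flip: ennreal_mult)
  define K where "K = (\<integral>\<^sup>+t. ennreal ((1 - exp (- \<alpha> * t)) / \<alpha>) * ennreal (exp (- (\<kappa> * t))) \<partial>exp_law \<rho>)"
  \<comment> \<open>The integrand of \<open>K\<close> is a difference of two exponentials with known
    transforms. Since subtraction truncates in \<open>ennreal\<close>, one transform is added to
    both sides and the finite term is cancelled at the end.\<close>
  have "K + ennreal (1 / \<alpha>) * ennreal (\<rho> / (\<rho> + (\<kappa> + \<alpha>)))
    = K + (\<integral>\<^sup>+t. ennreal (1 / \<alpha>) * ennreal (exp (- ((\<kappa> + \<alpha>) * t))) \<partial>exp_law \<rho>)"
    using assms by (subst nn_integral_cmult) (auto simp: exp_law_laplace)
  also have "\<dots> = (\<integral>\<^sup>+t. ennreal ((1 - exp (- \<alpha> * t)) / \<alpha>) * ennreal (exp (- (\<kappa> * t)))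
       + ennreal (1 / \<alpha>) * ennreal (exp (- ((\<kappa> + \<alpha>) * t))) \<partial>exp_law \<rho>)"
    unfolding K_def by (rule nn_integral_add[symmetric]) measurable
  also have "\<dots> = (\<integral>\<^sup>+t. ennreal (1 / \<alpha>) * ennreal (exp (- (\<kappa> * t))) \<partial>exp_law \<rho>)"
    using AE_exp_law_pos[of \<rho>]
  proof (intro nn_integral_cong_AE, eventually_elim)
    fix t :: real assume t: "0 < t"
    have le: "0 \<le> (1 - exp (- \<alpha> * t)) / \<alpha>" using t \<alpha> by simp
    have "ennreal ((1 - exp (- \<alpha> * t)) / \<alpha>) * ennreal (exp (- (\<kappa> * t)))
       + ennreal (1 / \<alpha>) * ennreal (exp (- ((\<kappa> + \<alpha>) * t)))
      = ennreal ((1 - exp (- \<alpha> * t)) / \<alpha> * exp (- (\<kappa> * t)) + 1 / \<alpha> * exp (- ((\<kappa> + \<alpha>) * t)))"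
      using le \<alpha> by (intro ennreal_sum_products) simp_all
    also have "(1 - exp (- \<alpha> * t)) / \<alpha> * exp (- (\<kappa> * t)) + 1 / \<alpha> * exp (- ((\<kappa> + \<alpha>) * t)) = 1 / \<alpha> * exp (- (\<kappa> * t))"
    proof -
      have "exp (- ((\<kappa> + \<alpha>) * t)) = exp (- \<alpha> * t) * exp (- (\<kappa> * t))" by (simp add: mult_exp_exp algebra_simps)
      then show ?thesis using \<alpha> by (simp add: field_simps)
    qed
    finally show "ennreal ((1 - exp (- \<alpha> * t)) / \<alpha>) * ennreal (exp (- (\<kappa> * t)))
       + ennreal (1 / \<alpha>) * ennreal (exp (- ((\<kappa> + \<alpha>) * t))) = ennreal (1 / \<alpha>) * ennreal (exp (- (\<kappa> * t)))"
      using \<alpha> by (simp flip: ennreal_mult)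
  qed
  also have "\<dots> = ennreal (1 / \<alpha>) * ennreal (\<rho> / (\<rho> + \<kappa>))"
    using assms by (subst nn_integral_cmult) (auto simp: exp_law_laplace)
  also have "\<dots> = ennreal (\<rho> / ((\<rho> + \<kappa>) * (\<rho> + \<kappa> + \<alpha>))) + ennreal (1 / \<alpha>) * ennreal (\<rho> / (\<rho> + (\<kappa> + \<alpha>)))"
  proof -
    have "1 / \<alpha> * (\<rho> / (\<rho> + \<kappa>)) = \<rho> / ((\<rho> + \<kappa>) * (\<rho> + \<kappa> + \<alpha>)) + 1 / \<alpha> * (\<rho> / (\<rho> + (\<kappa> + \<alpha>)))"
    proof -
      have "\<rho> + \<kappa> \<noteq> 0" "\<rho> + \<kappa> + \<alpha> \<noteq> 0" using assms by linarith+
      then show ?thesis using \<alpha> by (simp add: divide_simps add.assoc) (simp add: algebra_simps)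
    qed
    then show ?thesis using assms by (simp flip: ennreal_mult ennreal_plus)
  qed
  finally have K: "K = ennreal (\<rho> / ((\<rho> + \<kappa>) * (\<rho> + \<kappa> + \<alpha>)))"
    using assms by (simp add: ennreal_mult_eq_top_iff flip: ennreal_mult)
  have "(\<integral>\<^sup>+t. (h * ennreal ((1 - exp (- \<alpha> * t)) / \<alpha>) + ennreal (exp (- \<alpha> * t)) * \<Gamma>) * ennreal (exp (- (\<kappa> * t))) \<partial>exp_law \<rho>)
    = (\<integral>\<^sup>+t. h * (ennreal ((1 - exp (- \<alpha> * t)) / \<alpha>) * ennreal (exp (- (\<kappa> * t)))) + \<Gamma> * ennreal (exp (- ((\<kappa> + \<alpha>) * t))) \<partial>exp_law \<rho>)"
  proof -
    have "(h * A + E * \<Gamma>) * B = h * (A * B) + \<Gamma> * (E * B)" for A B E :: ennreal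
      by (simp add: distrib_left distrib_right mult_ac)
    then show ?thesis by (simp only: e[symmetric])
  qed
  also have "\<dots> = h * K + \<Gamma> * ennreal (\<rho> / (\<rho> + (\<kappa> + \<alpha>)))"
    unfolding K_def using assms exp_law_laplace[of \<rho> "\<kappa> + \<alpha>"]
    by (subst nn_integral_add) (auto simp: nn_integral_cmult)
  finally show ?thesis by (simp add: K add.assoc mult.commute)
qed

text \<open>\<open>g\<close> removes the first gap, which is independent of the shifted sequence, so
  every gap contributes one factor. The exponent is \<open>Suc n\<close> because arrival
  \<open>n\<close> is the sum of \<open>n + 1\<close> gaps.\<close>

lemma nn_integral_discounted_arrival:
  fixes x :: "'x \<Rightarrow> nat \<Rightarrow> real"
  assumes "prob_space X" and \<rho>: "0 < \<rho>" and \<alpha>: "0 \<le> \<alpha>"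
    and split: "splits_off X (\<lambda>\<omega>. x \<omega> 0) g (exp_law \<rho>)"
    and x[measurable]: "\<And>n. (\<lambda>\<omega>. x \<omega> n) \<in> borel_measurable X"
    and shift: "\<And>\<omega> n. x (g \<omega>) n = x \<omega> (Suc n)"
  shows "(\<integral>\<^sup>+\<omega>. ennreal (exp (- (\<alpha> * arrival_time (x \<omega>) n))) \<partial>X) = ennreal ((\<rho> / (\<rho> + \<alpha>)) ^ Suc n)"
proof (induction n)
  case 0
  interpret prob_space X by fact
  have "(\<lambda>(t, \<omega>). ennreal (exp (- (\<alpha> * t)))) \<in> borel_measurable (exp_law \<rho> \<Otimes>\<^sub>M X)" by measurable
  from splits_offD[OF split this]
  have "(\<integral>\<^sup>+\<omega>. ennreal (exp (- (\<alpha> * x \<omega> 0))) \<partial>X) = (\<integral>\<^sup>+t. ennreal (exp (- (\<alpha> * t))) \<partial>exp_law \<rho>)"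
    by (simp add: emeasure_space_1)
  then show ?case using exp_law_laplace[OF \<rho> \<alpha>] by (simp add: arrival_time_def)
next
  case (Suc n)
  have [measurable]: "(\<lambda>\<omega>. arrival_time (x \<omega>) n) \<in> borel_measurable X" unfolding arrival_time_def by measurable
  have "(\<lambda>(t, \<omega>). ennreal (exp (- (\<alpha> * t))) * ennreal (exp (- (\<alpha> * arrival_time (x \<omega>) n)))) \<in> borel_measurable (exp_law \<rho> \<Otimes>\<^sub>M X)"
    by measurable
  note * = splits_offD[OF split this]
  have "arrival_time (x \<omega>) (Suc n) = x \<omega> 0 + arrival_time (x (g \<omega>)) n" for \<omega>
    unfolding arrival_time_def by (subst sum.atMost_Suc_shift) (simp add: shift)
  then have "(\<integral>\<^sup>+\<omega>. ennreal (exp (- (\<alpha> * arrival_time (x \<omega>) (Suc n)))) \<partial>X)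
    = (\<integral>\<^sup>+\<omega>. ennreal (exp (- (\<alpha> * x \<omega> 0))) * ennreal (exp (- (\<alpha> * arrival_time (x (g \<omega>)) n))) \<partial>X)"
    by (simp add: mult_exp_exp distrib_left flip: ennreal_mult)
  also have "\<dots> = (\<integral>\<^sup>+t. \<integral>\<^sup>+\<omega>. ennreal (exp (- (\<alpha> * t))) * ennreal (exp (- (\<alpha> * arrival_time (x \<omega>) n))) \<partial>X \<partial>exp_law \<rho>)"
    using * by simp
  also have "\<dots> = (\<integral>\<^sup>+t. ennreal (exp (- (\<alpha> * t))) * ennreal ((\<rho> / (\<rho> + \<alpha>)) ^ Suc n) \<partial>exp_law \<rho>)"
    by (intro nn_integral_cong, subst nn_integral_cmult) (auto simp only: Suc, measurable)
  also have "\<dots> = ennreal (\<rho> / (\<rho> + \<alpha>)) * ennreal ((\<rho> / (\<rho> + \<alpha>)) ^ Suc n)"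
    using exp_law_laplace[OF \<rho> \<alpha>] by (subst nn_integral_multc) auto
  also have "\<dots> = ennreal ((\<rho> / (\<rho> + \<alpha>)) ^ Suc (Suc n))"
    using \<rho> \<alpha> by (simp flip: ennreal_mult)
  finally show ?case .
qed

text \<open>The infimum of \<open>exp (- arrival_time (x \<omega>) n)\<close> over \<open>n\<close>
  has expectation at most every power of \<open>\<rho> / (\<rho> + 1)\<close>, hence vanishes almost
  surely. This excludes explosion, both of the arrivals and of the clocks that drive the
  regime.\<close>

lemma AE_arrival_time_unbounded:
  fixes x :: "'x \<Rightarrow> nat \<Rightarrow> real"
  assumes "prob_space X" and \<rho>: "0 < \<rho>"
    and split: "splits_off X (\<lambda>\<omega>. x \<omega> 0) g (exp_law \<rho>)"
    and x[measurable]: "\<And>n. (\<lambda>\<omega>. x \<omega> n) \<in> borel_measurable X"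
    and shift: "\<And>\<omega> n. x (g \<omega>) n = x \<omega> (Suc n)"
  shows "AE \<omega> in X. \<forall>y. \<exists>n. y < arrival_time (x \<omega>) n"
proof -
  have [measurable]: "(\<lambda>\<omega>. arrival_time (x \<omega>) n) \<in> borel_measurable X" for n unfolding arrival_time_def by measurable
  define I where "I \<omega> = (INF n. ennreal (exp (- arrival_time (x \<omega>) n)))" for \<omega>
  have [measurable]: "I \<in> borel_measurable X" unfolding I_def by measurable
  have le: "(\<integral>\<^sup>+\<omega>. I \<omega> \<partial>X) \<le> ennreal ((\<rho> / (\<rho> + 1)) ^ Suc n)" for n
  proof -
    have "(\<integral>\<^sup>+\<omega>. I \<omega> \<partial>X) \<le> (\<integral>\<^sup>+\<omega>. ennreal (exp (- (1 * arrival_time (x \<omega>) n))) \<partial>X)"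
      unfolding I_def by (intro nn_integral_mono INF_lower2[of n]) auto
    also have "\<dots> = ennreal ((\<rho> / (\<rho> + 1)) ^ Suc n)"
      by (rule nn_integral_discounted_arrival[OF assms(1) \<rho> _ split x shift]) simp
    finally show ?thesis .
  qed
  have "(\<lambda>n. (\<rho> / (\<rho> + 1)) ^ n) \<longlonglongrightarrow> 0" using \<rho> by (intro LIMSEQ_realpow_zero) auto
  then have "(\<lambda>n. ennreal ((\<rho> / (\<rho> + 1)) ^ Suc n)) \<longlonglongrightarrow> ennreal 0"
    by (intro tendsto_ennrealI LIMSEQ_Suc)
  then have "(\<integral>\<^sup>+\<omega>. I \<omega> \<partial>X) \<le> 0" using le by (intro LIMSEQ_le_const) auto
  then have "AE \<omega> in X. I \<omega> = 0" by (subst nn_integral_0_iff_AE[symmetric]) auto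
  then show ?thesis
  proof eventually_elim
    case (elim \<omega>)
    show ?case
    proof
      fix y
      have "I \<omega> < ennreal (exp (- y))" using elim by simp
      then obtain n where "ennreal (exp (- arrival_time (x \<omega>) n)) < ennreal (exp (- y))"
        unfolding I_def INF_less_iff by auto
      then show "\<exists>n. y < arrival_time (x \<omega>) n" by (auto simp: ennreal_less_iff)
    qed
  qed
qed

section \<open>Ageing a whole sample\<close>

definition age_sample :: "nat \<Rightarrow> nat \<Rightarrow> nat \<Rightarrow> real \<Rightarrow> real \<Rightarrow> sample \<Rightarrow> sample" where
  "age_sample ka ks ke r t = (\<lambda>(a, s, \<sigma>, e, \<xi>). (age ka t a, s, age ks t \<sigma>, age ke (r * t) e, \<xi>))"

definition alive_sample :: "nat \<Rightarrow> nat \<Rightarrow> nat \<Rightarrow> real \<Rightarrow> real \<Rightarrow> sample \<Rightarrow> bool" where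
  "alive_sample ka ks ke r t = (\<lambda>(a, s, \<sigma>, e, \<xi>). alive ka t a \<and> alive ks t \<sigma> \<and> alive ke (r * t) e)"

lemma measurable_age:
  assumes [measurable]: "t \<in> borel_measurable M" "x \<in> M \<rightarrow>\<^sub>M (\<Pi>\<^sub>M n\<in>UNIV. borel)"
  shows "(\<lambda>y. age k (t y) (x y)) \<in> M \<rightarrow>\<^sub>M (\<Pi>\<^sub>M n\<in>UNIV. borel)"
proof (rule measurable_PiM_single')
  fix j
  show "(\<lambda>y. age k (t y) (x y) j) \<in> borel_measurable M" unfolding age_def by measurable
qed (auto simp: space_PiM)

lemma pred_alive:
  assumes [measurable]: "t \<in> borel_measurable M" "x \<in> M \<rightarrow>\<^sub>M (\<Pi>\<^sub>M n\<in>UNIV. borel)"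
  shows "Measurable.pred M (\<lambda>y. alive k (t y) (x y))"
  unfolding alive_def by measurable

lemma measurable_age_sample:
  "(\<lambda>(t, \<omega>). age_sample ka ks ke r t \<omega>) \<in> borel \<Otimes>\<^sub>M sample_sigma \<rightarrow>\<^sub>M sample_sigma"
  unfolding age_sample_def sample_sigma_def case_prod_beta
  by (intro measurable_Pair measurable_age) measurable

lemma pred_alive_sample:
  "Measurable.pred (borel \<Otimes>\<^sub>M sample_sigma) (\<lambda>(t, \<omega>). alive_sample ka ks ke r t \<omega>)"
  unfolding alive_sample_def sample_sigma_def case_prod_beta
  by (intro pred_intros_logic pred_alive) measurable

lemma sets_score_law [simp, measurable_cong]: "sets (score_law P) = sets borel"
  by (simp add: score_law_def)

text \<open>Continuity is available on the open interval only; the two end points are added as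
  separate indicators.\<close>

lemma measurable_score_density:
  assumes "hybrid_model P"
  shows "(\<lambda>s. ennreal (score_density P s) * indicator {0..1} s) \<in> borel_measurable lborel"
proof -
  have c: "continuous_on {0<..<1} (score_density P)" using assms by (simp add: hybrid_model_def)
  have "(\<lambda>s. ennreal (score_density P s * indicator {0<..<1} s)) \<in> borel_measurable borel"
    using borel_measurable_continuous_on_indicator[OF _ c] by (simp add: mult.commute)
  then have "(\<lambda>s. ennreal (score_density P s * indicator {0<..<1} s)
      + ennreal (score_density P 0) * indicator {0} s
      + ennreal (score_density P 1) * indicator {1} s) \<in> borel_measurable borel"
    by measurable
  also have "(\<lambda>s. ennreal (score_density P s * indicator {0<..<1} s)
      + ennreal (score_density P 0) * indicator {0} s
      + ennreal (score_density P 1) * indicator {1} s)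
    = (\<lambda>s. ennreal (score_density P s) * indicator {0..1} s)"
    by (auto simp: indicator_def fun_eq_iff)
  finally show ?thesis by simp
qed

lemma prob_space_score_law: "hybrid_model P \<Longrightarrow> prob_space (score_law P)"
  using measurable_score_density[of P]
  by (intro prob_spaceI) (simp add: score_law_def emeasure_density hybrid_model_def)

lemma AE_score_law: "hybrid_model P \<Longrightarrow> AE s in score_law P. s \<in> {0..1}"
  using measurable_score_density[of P] unfolding score_law_def
  by (subst AE_density) (auto split: split_indicator)

section \<open>The sample space\<close>

abbreviation arrival_of :: "nat \<Rightarrow> sample \<Rightarrow> real" where
  "arrival_of k \<equiv> \<lambda>(a, s, \<sigma>, e, \<xi>). a k"
abbreviation drop_arrival :: "nat \<Rightarrow> sample \<Rightarrow> sample" where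
  "drop_arrival k \<equiv> \<lambda>(a, s, \<sigma>, e, \<xi>). (\<lambda>j. a (skip k j), s, \<sigma>, e, \<xi>)"
abbreviation score_of :: "nat \<Rightarrow> sample \<Rightarrow> real" where
  "score_of k \<equiv> \<lambda>(a, s, \<sigma>, e, \<xi>). s k"
abbreviation drop_score :: "nat \<Rightarrow> sample \<Rightarrow> sample" where
  "drop_score k \<equiv> \<lambda>(a, s, \<sigma>, e, \<xi>). (a, \<lambda>j. s (skip k j), \<sigma>, e, \<xi>)"
abbreviation service_of :: "nat \<Rightarrow> sample \<Rightarrow> real" where
  "service_of k \<equiv> \<lambda>(a, s, \<sigma>, e, \<xi>). \<sigma> k"
abbreviation drop_service :: "nat \<Rightarrow> sample \<Rightarrow> sample" where
  "drop_service k \<equiv> \<lambda>(a, s, \<sigma>, e, \<xi>). (a, s, \<lambda>j. \<sigma> (skip k j), e, \<xi>)"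
abbreviation clock_of :: "nat \<Rightarrow> sample \<Rightarrow> real" where
  "clock_of k \<equiv> \<lambda>(a, s, \<sigma>, e, \<xi>). e k"
abbreviation drop_clock :: "nat \<Rightarrow> sample \<Rightarrow> sample" where
  "drop_clock k \<equiv> \<lambda>(a, s, \<sigma>, e, \<xi>). (a, s, \<sigma>, \<lambda>j. e (skip k j), \<xi>)"
abbreviation jump_of :: "nat \<Rightarrow> sample \<Rightarrow> nat \<Rightarrow> nat" where
  "jump_of k \<equiv> \<lambda>(a, s, \<sigma>, e, \<xi>). \<xi> k"
abbreviation drop_jump :: "nat \<Rightarrow> sample \<Rightarrow> sample" where
  "drop_jump k \<equiv> \<lambda>(a, s, \<sigma>, e, \<xi>). (a, s, \<sigma>, e, \<lambda>j. \<xi> (skip k j))"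
abbreviation arrivals :: "sample \<Rightarrow> nat \<Rightarrow> real" where
  "arrivals \<equiv> \<lambda>(a, s, \<sigma>, e, \<xi>). a"
abbreviation clocks :: "sample \<Rightarrow> nat \<Rightarrow> real" where
  "clocks \<equiv> \<lambda>(a, s, \<sigma>, e, \<xi>). e"
abbreviation first_jump :: "real \<Rightarrow> sample \<Rightarrow> real" where
  "first_jump r \<equiv> \<lambda>(a, s, \<sigma>, e, \<xi>). e 0 / r"

locale hybrid =
  fixes P :: hybrid_params
  assumes model: "hybrid_model P"
begin

abbreviation "\<Omega> \<equiv> sample_space P"
abbreviation "\<nu> \<equiv> arrival_rate P"
abbreviation "\<mu> \<equiv> service_rate P"
abbreviation "\<alpha> \<equiv> discount_rate P"
abbreviation "m \<equiv> servers P"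

definition exit_rate :: "nat \<Rightarrow> real" where
  "exit_rate i = - regime_gen P i i"

lemma params: "0 < \<nu>" "0 < \<mu>" "0 < \<alpha>" "1 \<le> m"
  using model by (auto simp: hybrid_model_def)

lemma finite_regimes [simp]: "finite (regimes P)"
  by (simp add: regimes_def)

lemma exit_rate_eq: "i \<in> regimes P \<Longrightarrow> exit_rate i = (\<Sum>j\<in>regimes P - {i}. regime_gen P i j)"
  using model by (auto simp: hybrid_model_def generator_on_def exit_rate_def)

lemma regime_gen_nonneg: "i \<in> regimes P \<Longrightarrow> j \<in> regimes P \<Longrightarrow> i \<noteq> j \<Longrightarrow> 0 \<le> regime_gen P i j"
  using model by (auto simp: hybrid_model_def generator_on_def)

lemma exit_rate_nonneg: "i \<in> regimes P \<Longrightarrow> 0 \<le> exit_rate i"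
  by (auto simp: exit_rate_eq intro!: sum_nonneg regime_gen_nonneg)

abbreviation "regime_map_law \<equiv> measure_pmf (Pi_pmf (regimes P) 0 (jump_law P))"

lemma prob_spaces:
  "prob_space (exp_law \<nu>)" "prob_space (exp_law \<mu>)" "prob_space (exp_law 1)"
  "prob_space (score_law P)" "prob_space regime_map_law"
  using params model by (auto intro: prob_space_exp_law prob_space_score_law prob_space_measure_pmf)

sublocale prob_space \<Omega>
  using model by (rule prob_space_sample_space)

lemma prob_space_tails:
  "prob_space (\<Pi>\<^sub>M n\<in>(UNIV::nat set). exp_law \<nu>)" "prob_space (\<Pi>\<^sub>M n\<in>(UNIV::nat set). score_law P)"
  "prob_space (\<Pi>\<^sub>M n\<in>(UNIV::nat set). exp_law \<mu>)" "prob_space (\<Pi>\<^sub>M n\<in>(UNIV::nat set). exp_law 1)"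
  "prob_space (\<Pi>\<^sub>M n\<in>(UNIV::nat set). regime_map_law)"
  by (intro prob_space_PiM prob_spaces)+

lemmas prob_rules = prob_space_pair prob_space_tails prob_spaces

section \<open>Isolating one clock of the sample\<close>

lemma split_arrival:
  "splits_off \<Omega> (arrival_of k) (drop_arrival k) (exp_law \<nu>)"
proof -
  have "splits_off \<Omega> (\<lambda>(x, y). x k) (\<lambda>(x, y). (\<lambda>j. x (skip k j), y)) (exp_law \<nu>)"
    unfolding sample_space_def by (intro splits_off_fst splits_off_PiM prob_rules)
  then show ?thesis by (simp add: case_prod_beta')
qed

lemma split_score:
  "splits_off \<Omega> (score_of k) (drop_score k) (score_law P)"
proof -
  have "splits_off \<Omega> (\<lambda>(a, y). (\<lambda>(x, y). x k) y)
     (\<lambda>(a, y). (a, (\<lambda>(x, y). (\<lambda>j. x (skip k j), y)) y)) (score_law P)"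
    unfolding sample_space_def by (intro splits_off_snd splits_off_fst splits_off_PiM prob_rules)
  then show ?thesis by (simp add: case_prod_beta')
qed

lemma split_service:
  "splits_off \<Omega> (service_of k) (drop_service k) (exp_law \<mu>)"
proof -
  have "splits_off \<Omega> (\<lambda>(a, y). (\<lambda>(s, y). (\<lambda>(x, y). x k) y) y)
     (\<lambda>(a, y). (a, (\<lambda>(s, y). (s, (\<lambda>(x, y). (\<lambda>j. x (skip k j), y)) y)) y)) (exp_law \<mu>)"
    unfolding sample_space_def by (intro splits_off_snd splits_off_fst splits_off_PiM prob_rules)
  then show ?thesis by (simp add: case_prod_beta')
qed

lemma split_clock:
  "splits_off \<Omega> (clock_of k) (drop_clock k) (exp_law 1)"
proof -
  have "splits_off \<Omega> (\<lambda>(a, y). (\<lambda>(s, y). (\<lambda>(\<sigma>, y). (\<lambda>(x, y). x k) y) y) y)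
     (\<lambda>(a, y). (a, (\<lambda>(s, y). (s, (\<lambda>(\<sigma>, y). (\<sigma>, (\<lambda>(x, y). (\<lambda>j. x (skip k j), y)) y)) y)) y)) (exp_law 1)"
    unfolding sample_space_def by (intro splits_off_snd splits_off_fst splits_off_PiM prob_rules)
  then show ?thesis by (simp add: case_prod_beta')
qed

lemma split_jump:
  "splits_off \<Omega> (jump_of k) (drop_jump k) regime_map_law"
proof -
  have "splits_off \<Omega> (\<lambda>(a, y). (\<lambda>(s, y). (\<lambda>(\<sigma>, y). (\<lambda>(e, y). y k) y) y) y)
     (\<lambda>(a, y). (a, (\<lambda>(s, y). (s, (\<lambda>(\<sigma>, y). (\<sigma>, (\<lambda>(e, x). (e, \<lambda>j. x (skip k j))) y)) y)) y)) regime_map_law"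
    unfolding sample_space_def by (intro splits_off_snd splits_off_PiM prob_rules)
  then show ?thesis by (simp add: case_prod_beta')
qed

lemma split_regime_clock:
  assumes r: "0 < r"
  shows "splits_off \<Omega> (first_jump r) (drop_clock 0) (exp_law r)"
proof -
  note s = split_clock[of 0]
  have m1: "clock_of 0 \<in> borel_measurable \<Omega>"
    and m2: "drop_clock 0 \<in> \<Omega> \<rightarrow>\<^sub>M \<Omega>"
    using s by (auto simp: splits_off_def cong: measurable_cong_sets)
  have m3: "(first_jump r) \<in> \<Omega> \<rightarrow>\<^sub>M exp_law r"
    using borel_measurable_divide[OF m1 borel_measurable_const[of r]]
    by (simp add: case_prod_beta' cong: measurable_cong_sets)
  have main: "(\<integral>\<^sup>+\<omega>. F (first_jump r \<omega>, drop_clock 0 \<omega>) \<partial>\<Omega>)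
      = (\<integral>\<^sup>+t. \<integral>\<^sup>+\<omega>. F (t, \<omega>) \<partial>\<Omega> \<partial>exp_law r)" if F[measurable]: "F \<in> borel_measurable (exp_law r \<Otimes>\<^sub>M \<Omega>)" for F
  proof -
    have "(\<lambda>(t, \<omega>). F (t / r, \<omega>)) \<in> borel_measurable (exp_law 1 \<Otimes>\<^sub>M \<Omega>)"
      by measurable
    from splits_offD[OF s this]
    have "(\<integral>\<^sup>+\<omega>. F (first_jump r \<omega>, drop_clock 0 \<omega>) \<partial>\<Omega>)
      = (\<integral>\<^sup>+t. \<integral>\<^sup>+\<omega>. F (t / r, \<omega>) \<partial>\<Omega> \<partial>exp_law 1)"
      by (simp add: case_prod_beta')
    also have "\<dots> = (\<integral>\<^sup>+t. \<integral>\<^sup>+\<omega>. F (t, \<omega>) \<partial>\<Omega> \<partial>exp_law r)"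
    proof (rule exp_law_scale[OF r])
      have "(\<lambda>t. \<integral>\<^sup>+\<omega>. F (t, \<omega>) \<partial>\<Omega>) \<in> borel_measurable (exp_law r)" by measurable
      then show "(\<lambda>t. \<integral>\<^sup>+\<omega>. F (t, \<omega>) \<partial>\<Omega>) \<in> borel_measurable borel" by (simp cong: measurable_cong_sets)
    qed
    finally show ?thesis .
  qed
  show ?thesis unfolding splits_off_def by (intro conjI ballI main m2 m3)
qed

text \<open>The components are independent, so the survival probabilities multiply and the rates
  add. The regime clock has unit rate but is aged by \<open>r * t\<close>, which contributes the
  rate \<open>r\<close>.\<close>

lemma rescales_sample:
  assumes t: "0 \<le> t" and r: "0 \<le> r"
  shows "rescales \<Omega> (age_sample ka ks ke r t) (indicator (Collect (alive_sample ka ks ke r t)))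
     (ennreal (exp (- ((real ka * \<nu> + real ks * \<mu> + real ke * r) * t))))"
proof -
  let ?w = "\<lambda>k t x. indicator {x. alive k t x} x :: ennreal"
  have "rescales \<Omega>
    (\<lambda>(a, y). (age ka t a, (\<lambda>(s, y). ((\<lambda>s. s) s, (\<lambda>(\<sigma>, y). (age ks t \<sigma>, (\<lambda>(e, \<xi>). (age ke (r * t) e, (\<lambda>\<xi>. \<xi>) \<xi>)) y)) y)) y))
    (\<lambda>(a, y). ?w ka t a * (\<lambda>(s, y). (\<lambda>_. 1) s * (\<lambda>(\<sigma>, y). ?w ks t \<sigma> * (\<lambda>(e, \<xi>). ?w ke (r * t) e * (\<lambda>_. 1) \<xi>) y) y) y)
    (ennreal (exp (- (real ka * \<nu> * t))) * (1 * (ennreal (exp (- (real ks * \<mu> * t))) * (ennreal (exp (- (real ke * 1 * (r * t)))) * 1))))"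
    unfolding sample_space_def
    by (intro rescales_pair rescales_age rescales_id prob_rules params) (use t r in auto)
  moreover have "(\<lambda>(a, y). (age ka t a, (\<lambda>(s, y). ((\<lambda>s. s) s, (\<lambda>(\<sigma>, y). (age ks t \<sigma>, (\<lambda>(e, \<xi>). (age ke (r * t) e, (\<lambda>\<xi>. \<xi>) \<xi>)) y)) y)) y))
    = age_sample ka ks ke r t"
    by (auto simp: age_sample_def)
  moreover have "(\<lambda>(a, y). ?w ka t a * (\<lambda>(s, y). (\<lambda>_. 1) s * (\<lambda>(\<sigma>, y). ?w ks t \<sigma> * (\<lambda>(e, \<xi>). ?w ke (r * t) e * (\<lambda>_. 1) \<xi>) y) y) y)
    = indicator (Collect (alive_sample ka ks ke r t))"
    by (auto simp: alive_sample_def indicator_def fun_eq_iff)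
  moreover have "ennreal (exp (- (real ka * \<nu> * t))) * (1 * (ennreal (exp (- (real ks * \<mu> * t))) * (ennreal (exp (- (real ke * 1 * (r * t)))) * 1)))
    = ennreal (exp (- ((real ka * \<nu> + real ks * \<mu> + real ke * r) * t)))"
    by (simp add: mult_exp_exp algebra_simps flip: ennreal_mult)
  ultimately show ?thesis by simp
qed

text \<open>\<open>f\<close> is the clock that rings and \<open>g\<close> the sample without it.
  Conditionally on \<open>f = t\<close> the other running clocks survive \<open>t\<close> with the
  exponential weight on the right, and given survival the aged sample is as good as new.\<close>

lemma clock_integral:
  assumes split: "splits_off \<Omega> f g (exp_law \<rho>)" and r: "0 \<le> r"
    and [measurable]: "\<phi> \<in> borel_measurable borel" "\<psi> \<in> borel_measurable borel" "G \<in> borel_measurable \<Omega>"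
  shows "(\<integral>\<^sup>+\<omega>. (\<phi> (f \<omega>) + \<psi> (f \<omega>) * G (age_sample ka ks ke r (f \<omega>) (g \<omega>))) *
       indicator (Collect (alive_sample ka ks ke r (f \<omega>))) (g \<omega>) \<partial>\<Omega>)
    = (\<integral>\<^sup>+t. (\<phi> t + \<psi> t * (\<integral>\<^sup>+\<omega>. G \<omega> \<partial>\<Omega>)) * ennreal (exp (- ((real ka * \<nu> + real ks * \<mu> + real ke * r) * t))) \<partial>exp_law \<rho>)"
proof -
  have [measurable]: "(\<lambda>(t, \<omega>). age_sample ka ks ke r t \<omega>) \<in> exp_law \<rho> \<Otimes>\<^sub>M \<Omega> \<rightarrow>\<^sub>M \<Omega>"
    using measurable_age_sample by (simp cong: measurable_cong_sets sets_pair_measure_cong add: sets_sample_space)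
  have [measurable]: "Measurable.pred (exp_law \<rho> \<Otimes>\<^sub>M \<Omega>) (\<lambda>(t, \<omega>). alive_sample ka ks ke r t \<omega>)"
    using pred_alive_sample by (simp cong: measurable_cong_sets sets_pair_measure_cong add: sets_sample_space)
  have "(\<lambda>(t, \<omega>). (\<phi> t + \<psi> t * G (age_sample ka ks ke r t \<omega>)) * indicator (Collect (alive_sample ka ks ke r t)) \<omega>)
     \<in> borel_measurable (exp_law \<rho> \<Otimes>\<^sub>M \<Omega>)"
  proof -
    have "(\<lambda>p. (\<phi> (fst p) + \<psi> (fst p) * G ((\<lambda>(t, \<omega>). age_sample ka ks ke r t \<omega>) p))
        * indicator {p \<in> space (exp_law \<rho> \<Otimes>\<^sub>M \<Omega>). (\<lambda>(t, \<omega>). alive_sample ka ks ke r t \<omega>) p} p) \<in> borel_measurable (exp_law \<rho> \<Otimes>\<^sub>M \<Omega>)"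
      by measurable
    then show ?thesis by (rule measurable_cong[THEN iffD1, rotated]) (auto simp: indicator_def)
  qed
  from splits_offD[OF split this]
  have "(\<integral>\<^sup>+\<omega>. (\<phi> (f \<omega>) + \<psi> (f \<omega>) * G (age_sample ka ks ke r (f \<omega>) (g \<omega>))) *
       indicator (Collect (alive_sample ka ks ke r (f \<omega>))) (g \<omega>) \<partial>\<Omega>)
    = (\<integral>\<^sup>+t. \<integral>\<^sup>+\<omega>. (\<phi> t + \<psi> t * G (age_sample ka ks ke r t \<omega>)) * indicator (Collect (alive_sample ka ks ke r t)) \<omega> \<partial>\<Omega> \<partial>exp_law \<rho>)"
    by simp
  also have "\<dots> = (\<integral>\<^sup>+t. (\<phi> t + \<psi> t * (\<integral>\<^sup>+\<omega>. G \<omega> \<partial>\<Omega>)) * ennreal (exp (- ((real ka * \<nu> + real ks * \<mu> + real ke * r) * t))) \<partial>exp_law \<rho>)"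
    using AE_exp_law_pos[of \<rho>]
  proof (intro nn_integral_cong_AE, eventually_elim)
    fix t :: real assume t: "0 < t"
    have "(\<lambda>\<omega>. \<phi> t + \<psi> t * G \<omega>) \<in> borel_measurable \<Omega>" by measurable
    from rescalesD[OF rescales_sample[OF less_imp_le[OF t] r, of ka ks ke] this]
    show "(\<integral>\<^sup>+\<omega>. (\<phi> t + \<psi> t * G (age_sample ka ks ke r t \<omega>)) * indicator (Collect (alive_sample ka ks ke r t)) \<omega> \<partial>\<Omega>)
      = (\<phi> t + \<psi> t * (\<integral>\<^sup>+\<omega>. G \<omega> \<partial>\<Omega>)) * ennreal (exp (- ((real ka * \<nu> + real ks * \<mu> + real ke * r) * t)))"
      by (subst mult.commute) (simp add: nn_integral_add nn_integral_cmult emeasure_space_1)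
  qed
  finally show ?thesis .
qed

lemma event_cost:
  assumes split: "splits_off \<Omega> f g (exp_law \<rho>)" and \<rho>: "0 < \<rho>" and r: "0 \<le> r"
    and \<kappa>: "\<kappa> = real ka * \<nu> + real ks * \<mu> + real ke * r" and G: "G \<in> borel_measurable \<Omega>"
  shows "(\<integral>\<^sup>+\<omega>. (h * ennreal ((1 - exp (- \<alpha> * f \<omega>)) / \<alpha>) + ennreal (exp (- \<alpha> * f \<omega>)) * G (age_sample ka ks ke r (f \<omega>) (g \<omega>))) *
       indicator (Collect (alive_sample ka ks ke r (f \<omega>))) (g \<omega>) \<partial>\<Omega>)
    = h * ennreal (\<rho> / ((\<rho> + \<kappa>) * (\<rho> + \<kappa> + \<alpha>))) + ennreal (\<rho> / (\<rho> + \<kappa> + \<alpha>)) * (\<integral>\<^sup>+\<omega>. G \<omega> \<partial>\<Omega>)"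
    and "(\<integral>\<^sup>+\<omega>. indicator (Collect (alive_sample ka ks ke r (f \<omega>))) (g \<omega>) \<partial>\<Omega>) = ennreal (\<rho> / (\<rho> + \<kappa>))"
proof -
  have \<kappa>0: "0 \<le> \<kappa>" using params r by (simp add: \<kappa>)
  show "(\<integral>\<^sup>+\<omega>. (h * ennreal ((1 - exp (- \<alpha> * f \<omega>)) / \<alpha>) + ennreal (exp (- \<alpha> * f \<omega>)) * G (age_sample ka ks ke r (f \<omega>) (g \<omega>))) *
       indicator (Collect (alive_sample ka ks ke r (f \<omega>))) (g \<omega>) \<partial>\<Omega>)
    = h * ennreal (\<rho> / ((\<rho> + \<kappa>) * (\<rho> + \<kappa> + \<alpha>))) + ennreal (\<rho> / (\<rho> + \<kappa> + \<alpha>)) * (\<integral>\<^sup>+\<omega>. G \<omega> \<partial>\<Omega>)"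
    using clock_integral[OF split r _ _ G, of "\<lambda>t. h * ennreal ((1 - exp (- \<alpha> * t)) / \<alpha>)" "\<lambda>t. ennreal (exp (- \<alpha> * t))" ka ks ke]
      exp_law_discounted_cost[OF \<rho> \<kappa>0 params(3), of h "\<integral>\<^sup>+\<omega>. G \<omega> \<partial>\<Omega>"] unfolding \<kappa> by simp
  show "(\<integral>\<^sup>+\<omega>. indicator (Collect (alive_sample ka ks ke r (f \<omega>))) (g \<omega>) \<partial>\<Omega>) = ennreal (\<rho> / (\<rho> + \<kappa>))"
    using clock_integral[OF split r _ _ G, of "\<lambda>t. 1" "\<lambda>t. 0" ka ks ke] exp_law_laplace[OF \<rho> \<kappa>0] unfolding \<kappa> by simp
qed

text \<open>The divergence of both partial sums keeps arrivals and jumps from accumulating;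
  otherwise the \<open>card\<close> in \<open>queue_length\<close> or \<open>regime_before\<close>
  could be taken of an infinite set and drop to 0.\<close>

definition good :: "sample \<Rightarrow> bool" where
  "good = (\<lambda>(a, s, \<sigma>, e, \<xi>). (\<forall>n. 0 < a n) \<and> (\<forall>n. s n \<in> {0..1}) \<and> (\<forall>n. 0 < \<sigma> n) \<and> (\<forall>n. 0 < e n) \<and>
     (\<forall>n. \<forall>j\<in>regimes P. \<xi> n j \<in> regimes P) \<and>
     (\<forall>y. \<exists>n. y < arrival_time a n) \<and> (\<forall>y. \<exists>n. y < arrival_time e n))"

lemma measurable_components:
  "arrival_of n \<in> borel_measurable \<Omega>" "clock_of n \<in> borel_measurable \<Omega>"
  using measurable_sample_components(1,4)[OF measurable_ident, of n]
  by (simp_all add: case_prod_beta' sets_sample_space cong: measurable_cong_sets)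

lemma set_jump_law: "i \<in> regimes P \<Longrightarrow> set_pmf (jump_law P i) \<subseteq> regimes P"
proof
  fix j assume i: "i \<in> regimes P" and j: "j \<in> set_pmf (jump_law P i)"
  show "j \<in> regimes P"
  proof (cases "regime_gen P i i = 0")
    case True
    then show ?thesis using i j by (simp add: jump_law_def)
  next
    case False
    then show ?thesis using j pmf_jump_law[OF model i False, of j] by (auto simp: set_pmf_iff split: if_splits)
  qed
qed

lemma AE_good: "AE \<omega> in \<Omega>. good \<omega>"
proof -
  have 1: "AE \<omega> in \<Omega>. \<forall>n. 0 < arrival_of n \<omega>"
    unfolding AE_all_countable by (intro allI splits_off_AE[OF split_arrival prob_space_axioms AE_exp_law_pos])
  have 2: "AE \<omega> in \<Omega>. \<forall>n. score_of n \<omega> \<in> {0..1}"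
    unfolding AE_all_countable by (intro allI splits_off_AE[OF split_score prob_space_axioms AE_score_law[OF model]])
  have 3: "AE \<omega> in \<Omega>. \<forall>n. 0 < service_of n \<omega>"
    unfolding AE_all_countable by (intro allI splits_off_AE[OF split_service prob_space_axioms AE_exp_law_pos])
  have 4: "AE \<omega> in \<Omega>. \<forall>n. 0 < clock_of n \<omega>"
    unfolding AE_all_countable by (intro allI splits_off_AE[OF split_clock prob_space_axioms AE_exp_law_pos])
  have "AE f in regime_map_law. \<forall>j\<in>regimes P. f j \<in> regimes P"
    unfolding AE_measure_pmf_iff using set_jump_law by (fastforce simp: set_Pi_pmf PiE_dflt_def)
  then have 5: "AE \<omega> in \<Omega>. \<forall>n. \<forall>j\<in>regimes P. jump_of n \<omega> j \<in> regimes P"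
    unfolding AE_all_countable by (intro allI splits_off_AE[OF split_jump prob_space_axioms])
  have 6: "AE \<omega> in \<Omega>. \<forall>y. \<exists>n. y < arrival_time (arrivals \<omega>) n"
    using split_arrival[of 0] measurable_components(1)
    by (intro AE_arrival_time_unbounded[OF prob_space_axioms params(1), where g = "drop_arrival 0"])
      (auto simp: case_prod_beta' skip_def)
  have 7: "AE \<omega> in \<Omega>. \<forall>y. \<exists>n. y < arrival_time (clocks \<omega>) n"
    using split_clock[of 0] measurable_components(2)
    by (intro AE_arrival_time_unbounded[OF prob_space_axioms zero_less_one, where g = "drop_clock 0"])
      (auto simp: case_prod_beta' skip_def)
  from 1 2 3 4 5 6 7 show ?thesis
    by eventually_elim (auto simp: good_def)
qed

lemma finite_arrivals:
  assumes "\<And>n. 0 < x n" "\<And>y. \<exists>n. y < arrival_time x n"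
  shows "finite {n. arrival_time x n \<le> t}"
proof -
  obtain N where N: "t < arrival_time x N" using assms(2) by blast
  have "arrival_time x N \<le> arrival_time x n" if "N \<le> n" for n
    unfolding arrival_time_def using that assms(1) by (intro sum_mono2) (auto intro: less_imp_le)
  then have "{n. arrival_time x n \<le> t} \<subseteq> {..<N}" using N by (force simp: not_le[symmetric])
  then show ?thesis by (rule finite_subset) simp
qed

lemma jump_chain_regimes:
  assumes "i \<in> regimes P" "\<And>n j. j \<in> regimes P \<Longrightarrow> \<xi> n j \<in> regimes P"
  shows "jump_chain i \<xi> n \<in> regimes P"
  by (induction n) (auto intro: assms)

text \<open>With all exit rates below \<open>B\<close>, jump times are at least the partial sums of
  the clocks divided by \<open>B\<close>, and these diverge. Absorbing regimes only make the jump
  times infinite.\<close>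

lemma finite_jumps:
  assumes i: "i \<in> regimes P" and \<xi>: "\<And>n j. j \<in> regimes P \<Longrightarrow> \<xi> n j \<in> regimes P"
    and e: "\<And>n. 0 < e n" "\<And>y. \<exists>n. y < arrival_time e n"
  shows "finite {n. jump_time P i e \<xi> n < ennreal t}"
proof -
  \<comment> \<open>The summand 1 keeps \<open>B\<close> positive when all exit rates
    vanish.\<close>
  define B where "B = 1 + (\<Sum>j\<in>regimes P. exit_rate j)"
  have B: "0 < B" unfolding B_def by (intro add_pos_nonneg sum_nonneg exit_rate_nonneg) auto
  have le: "ennreal (e k / B) \<le> ennreal (e k) / ennreal (exit_rate j)" if j: "j \<in> regimes P" for k j
  proof (cases "exit_rate j = 0")
    case True
    then show ?thesis using e(1)[of k] by (simp add: ennreal_divide_zero)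
  next
    case False
    then have pos: "0 < exit_rate j" using exit_rate_nonneg[OF j] by simp
    have "exit_rate j \<le> (\<Sum>j\<in>regimes P. exit_rate j)"
      by (rule member_le_sum[OF j]) (auto intro: exit_rate_nonneg)
    then have "e k / B \<le> e k / exit_rate j" using pos e(1)[of k] by (intro divide_left_mono) (auto simp: B_def)
    then show ?thesis using pos e(1)[of k] by (simp add: divide_ennreal less_imp_le ennreal_leI)
  qed
  have "ennreal (arrival_time e n / B) \<le> jump_time P i e \<xi> n" for n
  proof -
    have "ennreal (arrival_time e n / B) = (\<Sum>k\<le>n. ennreal (e k / B))"
      unfolding arrival_time_def sum_divide_distrib using e(1) B
      by (intro sum_ennreal[symmetric]) (auto intro: less_imp_le)
    also have "\<dots> \<le> jump_time P i e \<xi> n"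
      unfolding jump_time_def
      by (intro sum_mono) (use le[OF jump_chain_regimes[OF i \<xi>]] in \<open>auto simp: exit_rate_def\<close>)
    finally show ?thesis .
  qed
  then have "jump_time P i e \<xi> n < ennreal t \<Longrightarrow> arrival_time e n \<le> t * B" for n
  proof -
    assume "jump_time P i e \<xi> n < ennreal t"
    then have "ennreal (arrival_time e n / B) < ennreal t" using \<open>\<And>n. ennreal (arrival_time e n / B) \<le> jump_time P i e \<xi> n\<close>[of n] by (rule le_less_trans[rotated])
    moreover have "0 \<le> arrival_time e n" unfolding arrival_time_def using e(1) by (intro sum_nonneg less_imp_le)
    ultimately have "arrival_time e n / B < t" using B by (simp add: ennreal_less_iff)
    then show "arrival_time e n \<le> t * B" using B by (simp add: field_simps)
  qed
  then show ?thesis by (intro finite_subset[OF _ finite_arrivals[OF e, of "t * B"]]) auto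
qed

lemma regime_before_regimes:
  "i \<in> regimes P \<Longrightarrow> good (a, s, \<sigma>, e, \<xi>) \<Longrightarrow> regime_before P i e \<xi> t \<in> regimes P"
  unfolding regime_before_def by (rule jump_chain_regimes) (auto simp: good_def)

lemma arrival_time_pos:
  assumes "\<And>n. 0 < x n"
  shows "0 < arrival_time x n"
  unfolding arrival_time_def using assms by (intro sum_pos) auto

lemma arrival_time_age_pos:
  assumes "\<And>n. 0 < a n" "T < a 0"
  shows "0 < arrival_time (age 1 T a) n"
  by (rule arrival_time_pos) (use assms in \<open>auto simp: age_def\<close>)

lemma residual_no_departure:
  assumes "0 \<le> T" "alive (min q m) T \<sigma>" "\<And>j. 0 < \<sigma> j"
  shows "residual T (initial_queue m \<sigma> q) (initial_queue m (age (min q m) T \<sigma>) q)"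
    and "d \<in> set (initial_queue m \<sigma> q) \<Longrightarrow> T \<le> d"
proof -
  let ?k = "min q m"
  have *: "bij_betw id {..<?k} {j. j < ?k \<and> T < \<sigma> j}"
    using assms(2) by (auto simp: bij_betw_def alive_def)
  have "residual T (initial_queue m \<sigma> q) (initial_queue m (age ?k T \<sigma>) (q - (?k - ?k)))"
    by (rule residual_initial_queue[OF params(4) assms(1) *]) (use assms in \<open>auto simp: age_def alive_def less_imp_le\<close>)
  then show "residual T (initial_queue m \<sigma> q) (initial_queue m (age (min q m) T \<sigma>) q)" by simp
  show "d \<in> set (initial_queue m \<sigma> q) \<Longrightarrow> T \<le> d"
    by (rule residual_initial_queue(2)[OF params(4) assms(1) *, where \<sigma>' = "age ?k T \<sigma>"])
      (use assms in \<open>auto simp: age_def alive_def less_imp_le\<close>)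
qed

text \<open>\<open>skip k\<close> enumerates the running services that outlast \<open>T\<close> and
  moves the waiting tasks down by one index. The leaving task has departure time exactly
  \<open>T\<close>: \<open>count_gt\<close> at \<open>T\<close> no longer sees it, while
  \<open>count_ge\<close> at \<open>T\<close> still does, which is why \<open>residual\<close>
  compares \<open>count_ge\<close> at positive times only.\<close>

lemma residual_departure:
  assumes k: "k < min q m" and T: "T = \<sigma> k" and al: "alive (min q m - 1) T (\<lambda>j. \<sigma> (skip k j))"
    and pos: "\<And>j. 0 < \<sigma> j"
  shows "residual T (initial_queue m \<sigma> q) (initial_queue m (age (min q m - 1) T (\<lambda>j. \<sigma> (skip k j))) (q - 1))"
    and "d \<in> set (initial_queue m \<sigma> q) \<Longrightarrow> T \<le> d"
proof -
  let ?k = "min q m" and ?\<sigma>' = "age (min q m - 1) T (\<lambda>j. \<sigma> (skip k j))"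
  have im: "\<exists>l<?k - 1. j = skip k l" if "j < ?k" "j \<noteq> k" for j
    using skip_surj[OF that k] .
  have T0: "0 \<le> T" using pos[of k] T by simp
  have al': "T < \<sigma> (skip k j)" if "j < ?k - 1" for j using al that by (simp add: alive_def)
  have "skip k ` {..<?k - 1} = {j. j < ?k \<and> T < \<sigma> j}"
  proof (intro equalityI subsetI)
    fix j assume "j \<in> skip k ` {..<?k - 1}"
    then obtain l where l: "l < ?k - 1" "j = skip k l" by auto
    then have "j < ?k" by (auto simp: skip_def split: if_splits)
    then show "j \<in> {j. j < ?k \<and> T < \<sigma> j}" using al'[OF l(1)] l(2) by simp
  next
    fix j assume "j \<in> {j. j < ?k \<and> T < \<sigma> j}"
    then show "j \<in> skip k ` {..<?k - 1}" using im[of j] T by auto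
  qed
  then have *: "bij_betw (skip k) {..<?k - 1} {j. j < ?k \<and> T < \<sigma> j}"
    using inj_on_subset[OF inj_skip] by (auto simp: bij_betw_def)
  have 1: "T \<le> \<sigma> j" if "j < ?k" for j
    using im[OF that] al' T by (cases "j = k") (auto intro: less_imp_le)
  have 2: "\<sigma> j = ?\<sigma>' (j - (?k - (?k - 1)))" if "?k \<le> j" for j
    using that k by (auto simp: age_def skip_def)
  have 3: "?\<sigma>' j = \<sigma> (skip k j) - T" if "j < ?k - 1" for j using that by (simp add: age_def)
  have "residual T (initial_queue m \<sigma> q) (initial_queue m ?\<sigma>' (q - (?k - (?k - 1))))"
    by (rule residual_initial_queue(1)[OF params(4) T0 *]) (use 1 2 3 pos in \<open>auto simp: less_imp_le\<close>)
  then show "residual T (initial_queue m \<sigma> q) (initial_queue m ?\<sigma>' (q - 1))" using k by simp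
  show "d \<in> set (initial_queue m \<sigma> q) \<Longrightarrow> T \<le> d"
    by (rule residual_initial_queue(2)[OF params(4) T0 *, where \<sigma>' = ?\<sigma>']) (use 1 2 3 pos in \<open>auto simp: less_imp_le\<close>)
qed

end

section \<open>First-event decomposition\<close>

locale hybrid_policy = hybrid +
  fixes u :: policy and h :: "nat \<Rightarrow> ennreal" and g :: "nat \<Rightarrow> nat \<Rightarrow> real \<Rightarrow> ennreal"
  assumes u [measurable]: "\<And>q i. Measurable.pred borel (u q i)"
    and g [measurable]: "\<And>q i. g q i \<in> borel_measurable borel"
begin

abbreviation "C \<equiv> total_cost P u h g"

definition J :: "nat \<Rightarrow> nat \<Rightarrow> ennreal" where
  "J q i = (\<integral>\<^sup>+\<omega>. C q i \<omega> \<partial>\<Omega>)"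

lemma measurable_C [measurable]: "C q i \<in> borel_measurable \<Omega>"
  using measurable_total_cost[OF params(4) u g] by (simp cong: measurable_cong_sets add: sets_sample_space)

lemma measurable_time: "(\<lambda>t. queue_length P u q i \<omega> t) \<in> borel \<rightarrow>\<^sub>M count_space UNIV"
  by (rule measurable_queue_length_time[OF params(4) u])

definition after_arrival :: "nat \<Rightarrow> nat \<Rightarrow> sample \<Rightarrow> ennreal" where
  "after_arrival q i = (\<lambda>(a, s, \<sigma>, e, \<xi>).
     g q i (s 0) + C (if u q i (s 0) then q + 1 else q) i (a, \<lambda>j. s (skip 0 j), \<sigma>, e, \<xi>))"

definition after_jump :: "nat \<Rightarrow> nat \<Rightarrow> sample \<Rightarrow> ennreal" where
  "after_jump q i = (\<lambda>(a, s, \<sigma>, e, \<xi>). C q (\<xi> 0 i) (a, s, \<sigma>, e, \<lambda>j. \<xi> (skip 0 j)))"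

text \<open>This and the next two lemmas instantiate \<open>restart\<close> at the three kinds of
  first event. Until \<open>T\<close> the holding cost is \<open>h q\<close> over a discounted
  duration of \<open>(1 - exp (- \<alpha> * T)) / \<alpha>\<close>; afterwards the discounted cost
  of the restarted system accrues. Here one arrival is consumed (\<open>\<delta> = 1\<close>) and no
  task leaves (\<open>\<kappa> = 0\<close>).\<close>

lemma cost_arrival:
  assumes i: "i \<in> regimes P" and good: "good (a, s, \<sigma>, e, \<xi>)" and r: "r = exit_rate i"
    and T: "T = a 0" and al: "alive (min q m) T \<sigma>" "r * T < e 0"
  shows "C q i (a, s, \<sigma>, e, \<xi>) = h q * ennreal ((1 - exp (- \<alpha> * T)) / \<alpha>) + ennreal (exp (- \<alpha> * T)) *
     after_arrival q i (\<lambda>j. a (skip 0 j), s, age (min q m) T \<sigma>, age 1 (r * T) e, \<xi>)"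
proof -
  let ?\<omega> = "(a, s, \<sigma>, e, \<xi>)" and ?\<sigma>' = "age (min q m) T \<sigma>"
  let ?q' = "if u q i (s 0) then q + 1 else q"
  have pos: "\<And>n. 0 < a n" "\<And>n. 0 < \<sigma> n" using good by (auto simp: good_def)
  have T0: "0 \<le> T" using pos(1)[of 0] T by simp
  have r0: "0 \<le> r" "r = - regime_gen P i i" using exit_rate_nonneg[OF i] r by (auto simp: exit_rate_def)
  note res = residual_no_departure(1)[OF T0 al(1) pos(2)]
  note old = residual_no_departure(2)[OF T0 al(1) pos(2)]
  have first: "queue_at_arrival P u q i ?\<omega> 0 = q" "regime_before P i e \<xi> T = i"
  proof -
    have "filter (\<lambda>d. T \<le> d) (initial_queue m \<sigma> q) = initial_queue m \<sigma> q"
      unfolding filter_id_conv using old by auto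
    then show "queue_at_arrival P u q i ?\<omega> 0 = q"
      by (simp add: queue_at_arrival_count departures_0 count_ge_def arrival_time_def T del: departures.simps)
    show "regime_before P i e \<xi> T = i" by (rule regime_before_first[where e = e, OF T0 r0(2,1) al(2)])
  qed
  have dep: "departures P u q i ?\<omega> (Suc 0) = (if u q i (s 0) then enter_queue m \<sigma> T (initial_queue m \<sigma> q) else initial_queue m \<sigma> q)"
    using first T by (simp add: departures_Suc departures_0 arrival_time_def del: departures.simps)
  \<comment> \<open>An escalated task enters at time 0 of the restarted system, hence becomes the
    last of its \<open>q + 1\<close> initial tasks. Its service time \<open>\<sigma> q\<close> has
    not been aged, since \<open>q\<close> is at least \<open>min q m\<close>.\<close>
  have "residual T (enter_queue m \<sigma> (T + 0) (initial_queue m \<sigma> q)) (enter_queue m ?\<sigma>' 0 (initial_queue m ?\<sigma>' q))"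
    by (rule residual_enter_queue[OF params(4) res]) (auto simp: age_def)
  then have start: "residual T (departures P u q i ?\<omega> 1) (initial_queue m ?\<sigma>' ?q')"
    using res by (simp add: dep del: departures.simps)
  interpret restart P u q i ?q' i 1 0 T a "\<lambda>j. a (skip 0 j)" s "\<lambda>j. s (skip 0 j)" \<sigma> ?\<sigma>' e "age 1 (r * T) e" \<xi> \<xi>
    ?\<omega> "(\<lambda>j. a (skip 0 j), \<lambda>j. s (skip 0 j), ?\<sigma>', age 1 (r * T) e, \<xi>)"
  proof
    show "residual T (departures P u q i ?\<omega> 1) (initial_queue m ?\<sigma>' ?q')" by (rule start)
    show "length (departures P u q i ?\<omega> 1) = ?q' + 0" by (simp add: dep del: departures.simps)
    show "arrival_time a (n + 1) = T + arrival_time (\<lambda>j. a (skip 0 j)) n" for n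
      using arrival_time_Suc[of a n] T by simp
    show "0 < arrival_time (\<lambda>j. a (skip 0 j)) n" for n by (rule arrival_time_pos) (rule pos)
    show "arrival_time a n = T" if "n < 1" for n using that T by (simp add: arrival_time_def)
    show "finite {n. arrival_time a n \<le> t}" for t
      using good by (intro finite_arrivals) (auto simp: good_def)
    show "regime_before P i e \<xi> (T + t) = regime_before P i (age 1 (r * T) e) \<xi> t" if "0 < t" for t
      using that by (intro regime_before_age[where e = e, OF T0 r0(2,1) al(2)]) simp
    show "T \<le> d" if "d \<in> set (initial_queue m \<sigma> q)" for d using old that by blast
    show "?\<sigma>' j = \<sigma> (j + 0)" if "?q' \<le> j" for j using that by (auto simp: age_def split: if_splits)
  qed (use params T0 in \<open>auto simp: skip_def\<close>)
  show ?thesis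
    using total_cost_restart[OF measurable_time, of h g] first by (simp add: after_arrival_def T)
qed

lemma cost_departure:
  assumes i: "i \<in> regimes P" and good: "good (a, s, \<sigma>, e, \<xi>)" and r: "r = exit_rate i"
    and k: "k < min q m" and T: "T = \<sigma> k" and al: "T < a 0" "alive (min q m - 1) T (\<lambda>j. \<sigma> (skip k j))" "r * T < e 0"
  shows "C q i (a, s, \<sigma>, e, \<xi>) = h q * ennreal ((1 - exp (- \<alpha> * T)) / \<alpha>) + ennreal (exp (- \<alpha> * T)) *
     C (q - 1) i (age 1 T a, s, age (min q m - 1) T (\<lambda>j. \<sigma> (skip k j)), age 1 (r * T) e, \<xi>)"
proof -
  let ?\<omega> = "(a, s, \<sigma>, e, \<xi>)" and ?\<sigma>' = "age (min q m - 1) T (\<lambda>j. \<sigma> (skip k j))"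
  have pos: "\<And>n. 0 < a n" "\<And>n. 0 < \<sigma> n" using good by (auto simp: good_def)
  have T0: "0 \<le> T" using pos(2)[of k] T by simp
  have r0: "0 \<le> r" "r = - regime_gen P i i" using exit_rate_nonneg[OF i] r by (auto simp: exit_rate_def)
  interpret restart P u q i "q - 1" i 0 1 T a "age 1 T a" s s \<sigma> ?\<sigma>' e "age 1 (r * T) e" \<xi> \<xi>
    ?\<omega> "(age 1 T a, s, ?\<sigma>', age 1 (r * T) e, \<xi>)"
  proof
    show "residual T (departures P u q i ?\<omega> 0) (initial_queue m ?\<sigma>' (q - 1))"
      unfolding departures_0 by (rule residual_departure(1)[OF k T al(2) pos(2)])
    show "length (departures P u q i ?\<omega> 0) = q - 1 + 1" using k by (simp add: departures_0 del: departures.simps)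
    show "arrival_time a (n + 0) = T + arrival_time (age 1 T a) n" for n using arrival_time_age by simp
    show "0 < arrival_time (age 1 T a) n" for n by (rule arrival_time_age_pos[where a = a, OF pos(1) al(1)])
    show "finite {n. arrival_time a n \<le> t}" for t
      using good by (intro finite_arrivals) (auto simp: good_def)
    show "regime_before P i e \<xi> (T + t) = regime_before P i (age 1 (r * T) e) \<xi> t" if "0 < t" for t
      using that by (intro regime_before_age[where e = e, OF T0 r0(2,1) al(3)]) simp
    show "T \<le> d" if "d \<in> set (initial_queue m \<sigma> q)" for d
      using residual_departure(2)[OF k T al(2) pos(2)] that by blast
    show "?\<sigma>' j = \<sigma> (j + 1)" if "q - 1 \<le> j" for j using that k by (auto simp: age_def skip_def)
  qed (use params T0 in auto)
  show ?thesis using total_cost_restart[OF measurable_time, of h g] by simp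
qed

lemma cost_jump:
  assumes i: "i \<in> regimes P" and good: "good (a, s, \<sigma>, e, \<xi>)" and r: "r = exit_rate i" "0 < r"
    and T: "T = e 0 / r" and al: "T < a 0" "alive (min q m) T \<sigma>"
  shows "C q i (a, s, \<sigma>, e, \<xi>) = h q * ennreal ((1 - exp (- \<alpha> * T)) / \<alpha>) + ennreal (exp (- \<alpha> * T)) *
     after_jump q i (age 1 T a, s, age (min q m) T \<sigma>, \<lambda>j. e (skip 0 j), \<xi>)"
proof -
  let ?\<omega> = "(a, s, \<sigma>, e, \<xi>)" and ?\<sigma>' = "age (min q m) T \<sigma>"
  have pos: "\<And>n. 0 < a n" "\<And>n. 0 < \<sigma> n" "\<And>n. 0 < e n" using good by (auto simp: good_def)
  have T0: "0 \<le> T" using pos(3)[of 0] T r(2) by simp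
  have r0: "r = - regime_gen P i i" using r by (auto simp: exit_rate_def)
  interpret restart P u q i q "\<xi> 0 i" 0 0 T a "age 1 T a" s s \<sigma> ?\<sigma>' e "\<lambda>j. e (skip 0 j)" \<xi> "\<lambda>j. \<xi> (skip 0 j)"
    ?\<omega> "(age 1 T a, s, ?\<sigma>', \<lambda>j. e (skip 0 j), \<lambda>j. \<xi> (skip 0 j))"
  proof
    show "residual T (departures P u q i ?\<omega> 0) (initial_queue m ?\<sigma>' q)"
      unfolding departures_0 by (rule residual_no_departure(1)[OF T0 al(2) pos(2)])
    show "length (departures P u q i ?\<omega> 0) = q + 0" by (simp add: departures_0 del: departures.simps)
    show "arrival_time a (n + 0) = T + arrival_time (age 1 T a) n" for n using arrival_time_age by simp
    show "0 < arrival_time (age 1 T a) n" for n by (rule arrival_time_age_pos[where a = a, OF pos(1) al(1)])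
    show "finite {n. arrival_time a n \<le> t}" for t
      using good by (intro finite_arrivals) (auto simp: good_def)
    show "regime_before P i e \<xi> (T + t) = regime_before P (\<xi> 0 i) (\<lambda>j. e (skip 0 j)) (\<lambda>j. \<xi> (skip 0 j)) t" if "0 < t" for t
    proof (rule regime_before_jump[where e = e, OF r(2) r0 _ T that])
      show "finite {n. jump_time P i e \<xi> n < ennreal (T + t)}"
        using good by (intro finite_jumps[OF i]) (auto simp: good_def)
    qed (use pos(3)[of 0] in simp)
    show "T \<le> d" if "d \<in> set (initial_queue m \<sigma> q)" for d
      using residual_no_departure(2)[OF T0 al(2) pos(2)] that by blast
  qed (use params T0 in \<open>auto simp: age_def\<close>)
  show ?thesis using total_cost_restart[OF measurable_time, of h g] by (simp add: after_jump_def)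
qed

lemma after_arrival_integral:
  "after_arrival q i \<in> borel_measurable \<Omega>"
  "(\<integral>\<^sup>+\<omega>. after_arrival q i \<omega> \<partial>\<Omega>) = (\<integral>\<^sup>+x. g q i x + (if u q i x then J (q + 1) i else J q i) \<partial>score_law P)"
proof -
  define F where "F = (\<lambda>(x, \<omega>). g q i x + (if u q i x then C (q + 1) i \<omega> else C q i \<omega>))"
  have F: "F \<in> borel_measurable (score_law P \<Otimes>\<^sub>M \<Omega>)" unfolding F_def by measurable
  note split = split_score[of 0]
  have eq: "after_arrival q i = (\<lambda>\<omega>. F (score_of 0 \<omega>, drop_score 0 \<omega>))"
    by (auto simp: after_arrival_def F_def fun_eq_iff)
  show "after_arrival q i \<in> borel_measurable \<Omega>"
    unfolding eq using split by (intro measurable_compose[OF measurable_Pair F]) (auto simp: splits_off_def)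
  have "(\<integral>\<^sup>+\<omega>. after_arrival q i \<omega> \<partial>\<Omega>) = (\<integral>\<^sup>+x. \<integral>\<^sup>+\<omega>. F (x, \<omega>) \<partial>\<Omega> \<partial>score_law P)"
    unfolding eq by (rule splits_offD[OF split F])
  also have "\<dots> = (\<integral>\<^sup>+x. g q i x + (if u q i x then J (q + 1) i else J q i) \<partial>score_law P)"
    by (rule nn_integral_cong) (simp add: F_def J_def nn_integral_add emeasure_space_1)
  finally show "(\<integral>\<^sup>+\<omega>. after_arrival q i \<omega> \<partial>\<Omega>) = (\<integral>\<^sup>+x. g q i x + (if u q i x then J (q + 1) i else J q i) \<partial>score_law P)" .
qed

lemma after_jump_integral:
  assumes i: "i \<in> regimes P" and r: "0 < exit_rate i"
  shows "after_jump q i \<in> borel_measurable \<Omega>"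
    and "ennreal (exit_rate i) * (\<integral>\<^sup>+\<omega>. after_jump q i \<omega> \<partial>\<Omega>) = (\<Sum>j\<in>regimes P - {i}. ennreal (regime_gen P i j) * J q j)"
proof -
  define F where "F = (\<lambda>(f :: nat \<Rightarrow> nat, \<omega>). C q (f i) \<omega>)"
  have F: "F \<in> borel_measurable (regime_map_law \<Otimes>\<^sub>M \<Omega>)"
    unfolding F_def case_prod_beta
  proof (rule measurable_compose_countable[where g = "\<lambda>p. fst p i"])
    show "(\<lambda>p. fst p i) \<in> regime_map_law \<Otimes>\<^sub>M \<Omega> \<rightarrow>\<^sub>M count_space UNIV"
      by (rule measurable_compose[OF measurable_fst]) simp
  qed measurable
  note split = split_jump[of 0]
  have eq: "after_jump q i = (\<lambda>\<omega>. F (jump_of 0 \<omega>, drop_jump 0 \<omega>))"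
    by (auto simp: after_jump_def F_def fun_eq_iff)
  show "after_jump q i \<in> borel_measurable \<Omega>"
    unfolding eq using split by (intro measurable_compose[OF measurable_Pair F]) (auto simp: splits_off_def)
  have "(\<integral>\<^sup>+\<omega>. after_jump q i \<omega> \<partial>\<Omega>) = (\<integral>\<^sup>+f. \<integral>\<^sup>+\<omega>. F (f, \<omega>) \<partial>\<Omega> \<partial>regime_map_law)"
    unfolding eq by (rule splits_offD[OF split F])
  also have "\<dots> = (\<integral>\<^sup>+f. J q (f i) \<partial>regime_map_law)"
    by (simp add: F_def J_def)
  also have "\<dots> = (\<integral>\<^sup>+j. J q j \<partial>measure_pmf (map_pmf (\<lambda>f. f i) (Pi_pmf (regimes P) 0 (jump_law P))))"
    by (simp add: nn_integral_map_pmf)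
  \<comment> \<open>Only the component of the random map at the current regime is used, and it has
    law \<open>jump_law P i\<close>. Multiplying by the exit rate afterwards turns jump
    probabilities back into rates.\<close>
  also have "map_pmf (\<lambda>f. f i) (Pi_pmf (regimes P) 0 (jump_law P)) = jump_law P i"
    using i by (subst Pi_pmf_component) auto
  also have "(\<integral>\<^sup>+j. J q j \<partial>measure_pmf (jump_law P i)) = (\<Sum>j\<in>regimes P. J q j * pmf (jump_law P i) j)"
    by (rule nn_integral_measure_pmf_support) (use set_jump_law[OF i] in auto)
  also have "\<dots> = (\<Sum>j\<in>regimes P - {i}. J q j * pmf (jump_law P i) j)"
    using r i by (intro sum.mono_neutral_right) (auto simp: pmf_jump_law[OF model i] exit_rate_def)
  also have "ennreal (exit_rate i) * \<dots> = (\<Sum>j\<in>regimes P - {i}. ennreal (regime_gen P i j) * J q j)"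
    unfolding sum_distrib_left
  proof (rule sum.cong)
    fix j assume j: "j \<in> regimes P - {i}"
    have "exit_rate i * pmf (jump_law P i) j = regime_gen P i j"
      using r j by (simp add: pmf_jump_law[OF model i] exit_rate_def)
    then have "ennreal (exit_rate i) * ennreal (pmf (jump_law P i) j) = ennreal (regime_gen P i j)"
      using r by (simp flip: ennreal_mult)
    then show "ennreal (exit_rate i) * (J q j * pmf (jump_law P i) j) = ennreal (regime_gen P i j) * J q j"
      by (metis mult.assoc mult.commute)
  qed simp
  finally show "ennreal (exit_rate i) * (\<integral>\<^sup>+\<omega>. after_jump q i \<omega> \<partial>\<Omega>) = (\<Sum>j\<in>regimes P - {i}. ennreal (regime_gen P i j) * J q j)" .
qed

text \<open>\<open>X\<close> indicates that the clock \<open>f\<close> of rate \<open>\<rho>\<close>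
  rings strictly before all others, and \<open>G\<close> is the cost after that event. The factor
  \<open>\<rho>\<close> is pulled out so that the contributions of all events, which share the total
  rate \<open>R\<close>, can be added up.\<close>

lemma event_law:
  fixes f g' ka ks ke r
  defines "X \<equiv> (\<lambda>\<omega>. indicator (Collect (alive_sample ka ks ke r (f \<omega>))) (g' \<omega>) :: ennreal)"
  assumes split: "splits_off \<Omega> f g' (exp_law \<rho>)" and \<rho>: "0 < \<rho>" and r: "0 \<le> r"
    and R: "R = \<rho> + (real ka * \<nu> + real ks * \<mu> + real ke * r)" and G: "G \<in> borel_measurable \<Omega>"
    and C: "\<And>\<omega>. good \<omega> \<Longrightarrow> alive_sample ka ks ke r (f \<omega>) (g' \<omega>) \<Longrightarrow>
       C q i \<omega> = h q * ennreal ((1 - exp (- \<alpha> * f \<omega>)) / \<alpha>) + ennreal (exp (- \<alpha> * f \<omega>)) * G (age_sample ka ks ke r (f \<omega>) (g' \<omega>))"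
  shows "X \<in> borel_measurable \<Omega>"
    and "(\<integral>\<^sup>+\<omega>. C q i \<omega> * X \<omega> \<partial>\<Omega>) = ennreal \<rho> * (h q * ennreal (1 / (R * (R + \<alpha>))) + ennreal (1 / (R + \<alpha>)) * (\<integral>\<^sup>+\<omega>. G \<omega> \<partial>\<Omega>))"
    and "(\<integral>\<^sup>+\<omega>. X \<omega> \<partial>\<Omega>) = ennreal \<rho> * ennreal (1 / R)"
proof -
  have \<kappa>: "0 \<le> real ka * \<nu> + real ks * \<mu> + real ke * r" using params r by simp
  then have R0: "0 < R" using \<rho> R by simp
  have fg: "f \<in> \<Omega> \<rightarrow>\<^sub>M borel" "g' \<in> \<Omega> \<rightarrow>\<^sub>M sample_sigma"
    using split by (auto simp: splits_off_def sets_sample_space cong: measurable_cong_sets)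
  have "Measurable.pred \<Omega> (\<lambda>\<omega>. alive_sample ka ks ke r (f \<omega>) (g' \<omega>))"
    using measurable_compose[OF measurable_Pair[OF fg] pred_alive_sample] by simp
  then have "(\<lambda>\<omega>. if alive_sample ka ks ke r (f \<omega>) (g' \<omega>) then 1 else 0 :: ennreal) \<in> borel_measurable \<Omega>" by measurable
  also have "(\<lambda>\<omega>. if alive_sample ka ks ke r (f \<omega>) (g' \<omega>) then 1 else 0 :: ennreal) = X"
    by (auto simp: X_def indicator_def)
  finally show "X \<in> borel_measurable \<Omega>" .
  note ev = event_cost[OF split \<rho> r refl G]
  have split_const: "ennreal (\<rho> / x) = ennreal \<rho> * ennreal (1 / x)" if "0 \<le> x" for x
    using that \<rho> by (simp flip: ennreal_mult)
  have "(\<integral>\<^sup>+\<omega>. C q i \<omega> * X \<omega> \<partial>\<Omega>) = (\<integral>\<^sup>+\<omega>. (h q * ennreal ((1 - exp (- \<alpha> * f \<omega>)) / \<alpha>) + ennreal (exp (- \<alpha> * f \<omega>)) * G (age_sample ka ks ke r (f \<omega>) (g' \<omega>))) * X \<omega> \<partial>\<Omega>)"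
    using AE_good by (intro nn_integral_cong_AE, eventually_elim) (auto simp: X_def indicator_def C)
  also have "\<dots> = h q * ennreal (\<rho> / (R * (R + \<alpha>))) + ennreal (\<rho> / (R + \<alpha>)) * (\<integral>\<^sup>+\<omega>. G \<omega> \<partial>\<Omega>)"
    unfolding X_def R by (rule ev(1))
  also have "\<dots> = ennreal \<rho> * (h q * ennreal (1 / (R * (R + \<alpha>))) + ennreal (1 / (R + \<alpha>)) * (\<integral>\<^sup>+\<omega>. G \<omega> \<partial>\<Omega>))"
    using R0 params by (simp add: split_const distrib_left mult_ac)
  finally show "(\<integral>\<^sup>+\<omega>. C q i \<omega> * X \<omega> \<partial>\<Omega>) = ennreal \<rho> * (h q * ennreal (1 / (R * (R + \<alpha>))) + ennreal (1 / (R + \<alpha>)) * (\<integral>\<^sup>+\<omega>. G \<omega> \<partial>\<Omega>))" .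
  show "(\<integral>\<^sup>+\<omega>. X \<omega> \<partial>\<Omega>) = ennreal \<rho> * ennreal (1 / R)"
    using ev(2) R0 split_const[of R] unfolding X_def R by simp
qed

text \<open>
  The first event is an arrival, one of the running services or a regime jump. These strict events are mutually
  exclusive and their probabilities add up to 1, so that ties need no separate treatment.
\<close>

lemma bellman:
  assumes i: "i \<in> regimes P"
  shows "ennreal (\<alpha> + (\<nu> + real (min q m) * \<mu> + exit_rate i)) * J q i
    = h q + ennreal \<nu> * (\<integral>\<^sup>+x. g q i x + (if u q i x then J (q + 1) i else J q i) \<partial>score_law P)
      + ennreal (real (min q m) * \<mu>) * J (q - 1) i + (\<Sum>j\<in>regimes P - {i}. ennreal (regime_gen P i j) * J q j)"
proof -
  define k where "k = min q m"
  define r where "r = exit_rate i"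
  define R where "R = \<nu> + real k * \<mu> + r"
  \<comment> \<open>For the first event time, exponential with rate \<open>R\<close>, these
    constants are the expected discounted duration and the expected discount factor, each divided by
    \<open>R\<close>, that is, per unit of event rate.\<close>
  define c where "c = ennreal (1 / (R * (R + \<alpha>)))"
  define d where "d = ennreal (1 / (R + \<alpha>))"
  have r0: "0 \<le> r" using exit_rate_nonneg[OF i] by (simp add: r_def)
  have R0: "0 < R" using params r0 by (simp add: R_def add_pos_nonneg)
  define XA where "XA \<omega> = (indicator (Collect (alive_sample 0 k 1 r (arrival_of 0 \<omega>)))
      (drop_arrival 0 \<omega>) :: ennreal)" for \<omega>
  define XS where "XS l \<omega> = (indicator (Collect (alive_sample 1 (k - 1) 1 r (service_of l \<omega>)))
      (drop_service l \<omega>) :: ennreal)" for l \<omega>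
  \<comment> \<open>For \<open>r = 0\<close> the real quotient \<open>e 0 / r\<close> is 0 instead
    of infinite; the case distinction removes this spurious jump.\<close>
  define XR where "XR \<omega> = (if 0 < r then indicator (Collect (alive_sample 1 k 0 r (first_jump r \<omega>)))
      (drop_clock 0 \<omega>) else 0 :: ennreal)" for \<omega>
  define \<Gamma>A where "\<Gamma>A = (\<integral>\<^sup>+x. g q i x + (if u q i x then J (q + 1) i else J q i) \<partial>score_law P)"
  define \<Gamma>R where "\<Gamma>R = (if 0 < r then \<integral>\<^sup>+\<omega>. after_jump q i \<omega> \<partial>\<Omega> else 0)"

  have A: "XA \<in> borel_measurable \<Omega>"
      "(\<integral>\<^sup>+\<omega>. C q i \<omega> * XA \<omega> \<partial>\<Omega>) = ennreal \<nu> * (h q * c + d * \<Gamma>A)"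
      "(\<integral>\<^sup>+\<omega>. XA \<omega> \<partial>\<Omega>) = ennreal \<nu> * ennreal (1 / R)"
  proof -
    have "C q i \<omega> = h q * ennreal ((1 - exp (- \<alpha> * arrival_of 0 \<omega>)) / \<alpha>) + ennreal (exp (- \<alpha> * arrival_of 0 \<omega>))
        * after_arrival q i (age_sample 0 k 1 r (arrival_of 0 \<omega>) (drop_arrival 0 \<omega>))"
      if "good \<omega>" "alive_sample 0 k 1 r (arrival_of 0 \<omega>) (drop_arrival 0 \<omega>)" for \<omega>
    proof (cases \<omega>)
      case (fields a s \<sigma> e \<xi>)
      have "age 0 (a 0) x = x" for x by (simp add: age_def)
      then show ?thesis
        using cost_arrival[of i a s \<sigma> e \<xi> r "a 0" q] i that unfolding fields k_def r_def
        by (simp add: alive_sample_def age_sample_def alive_def)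
    qed
    note ev = event_law[OF split_arrival[of 0] params(1) r0 _ after_arrival_integral(1) this, of R]
    show "XA \<in> borel_measurable \<Omega>"
      "(\<integral>\<^sup>+\<omega>. C q i \<omega> * XA \<omega> \<partial>\<Omega>) = ennreal \<nu> * (h q * c + d * \<Gamma>A)"
      "(\<integral>\<^sup>+\<omega>. XA \<omega> \<partial>\<Omega>) = ennreal \<nu> * ennreal (1 / R)"
      using ev unfolding XA_def c_def d_def \<Gamma>A_def after_arrival_integral(2)[symmetric] by (simp_all add: R_def)
  qed
  have S: "XS l \<in> borel_measurable \<Omega>"
      "(\<integral>\<^sup>+\<omega>. C q i \<omega> * XS l \<omega> \<partial>\<Omega>) = ennreal \<mu> * (h q * c + d * J (q - 1) i)"
      "(\<integral>\<^sup>+\<omega>. XS l \<omega> \<partial>\<Omega>) = ennreal \<mu> * ennreal (1 / R)" if l: "l < k" for l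
  proof -
    have "C q i \<omega> = h q * ennreal ((1 - exp (- \<alpha> * service_of l \<omega>)) / \<alpha>) + ennreal (exp (- \<alpha> * service_of l \<omega>))
        * C (q - 1) i (age_sample 1 (k - 1) 1 r (service_of l \<omega>) (drop_service l \<omega>))"
      if "good \<omega>" "alive_sample 1 (k - 1) 1 r (service_of l \<omega>) (drop_service l \<omega>)" for \<omega>
    proof (cases \<omega>)
      case (fields a s \<sigma> e \<xi>)
      show ?thesis
        using cost_departure[of i a s \<sigma> e \<xi> r l q "\<sigma> l"] i l that unfolding fields k_def r_def
        by (simp add: alive_sample_def age_sample_def alive_def[of "Suc 0"])
    qed
    note ev = event_law[OF split_service[of l] params(2) r0 _ measurable_C this, of R]
    have "R = \<mu> + (real 1 * \<nu> + real (k - 1) * \<mu> + real 1 * r)"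
      using l by (simp add: R_def of_nat_diff algebra_simps)
    from ev[OF this] show "XS l \<in> borel_measurable \<Omega>"
      "(\<integral>\<^sup>+\<omega>. C q i \<omega> * XS l \<omega> \<partial>\<Omega>) = ennreal \<mu> * (h q * c + d * J (q - 1) i)"
      "(\<integral>\<^sup>+\<omega>. XS l \<omega> \<partial>\<Omega>) = ennreal \<mu> * ennreal (1 / R)"
      unfolding XS_def c_def d_def J_def[symmetric] by simp_all
  qed
  have R: "XR \<in> borel_measurable \<Omega>"
      "(\<integral>\<^sup>+\<omega>. C q i \<omega> * XR \<omega> \<partial>\<Omega>) = ennreal r * (h q * c + d * \<Gamma>R)"
      "(\<integral>\<^sup>+\<omega>. XR \<omega> \<partial>\<Omega>) = ennreal r * ennreal (1 / R)"
  proof -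
    have "XR \<in> borel_measurable \<Omega> \<and> (\<integral>\<^sup>+\<omega>. C q i \<omega> * XR \<omega> \<partial>\<Omega>) = ennreal r * (h q * c + d * \<Gamma>R) \<and>
      (\<integral>\<^sup>+\<omega>. XR \<omega> \<partial>\<Omega>) = ennreal r * ennreal (1 / R)"
    proof (cases "0 < r")
      case True
      have "C q i \<omega> = h q * ennreal ((1 - exp (- \<alpha> * first_jump r \<omega>)) / \<alpha>) + ennreal (exp (- \<alpha> * first_jump r \<omega>))
        * after_jump q i (age_sample 1 k 0 r (first_jump r \<omega>) (drop_clock 0 \<omega>))"
        if "good \<omega>" "alive_sample 1 k 0 r (first_jump r \<omega>) (drop_clock 0 \<omega>)" for \<omega>
      proof (cases \<omega>)
        case (fields a s \<sigma> e \<xi>)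
        have "age 0 t x = x" for t x by (simp add: age_def)
        then show ?thesis
          using cost_jump[of i a s \<sigma> e \<xi> r "e 0 / r" q] i that True unfolding fields k_def r_def
          by (simp add: alive_sample_def age_sample_def alive_def)
      qed
      note ev = event_law[OF split_regime_clock[OF True] True r0 _ after_jump_integral(1)[OF i True[unfolded r_def]] this, of R]
      show ?thesis using ev True unfolding XR_def c_def d_def \<Gamma>R_def by (simp add: R_def)
    next
      case False
      then have "XR = (\<lambda>_. 0)" by (simp add: XR_def fun_eq_iff)
      then show ?thesis using False r0 by simp
    qed
    then show "XR \<in> borel_measurable \<Omega>"
      "(\<integral>\<^sup>+\<omega>. C q i \<omega> * XR \<omega> \<partial>\<Omega>) = ennreal r * (h q * c + d * \<Gamma>R)"
      "(\<integral>\<^sup>+\<omega>. XR \<omega> \<partial>\<Omega>) = ennreal r * ennreal (1 / R)" by auto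
  qed
  note [measurable] = A(1) R(1)
  define X where "X \<omega> = XA \<omega> + (\<Sum>l<k. XS l \<omega>) + XR \<omega>" for \<omega>
  have [measurable]: "(\<lambda>\<omega>. \<Sum>l<k. XS l \<omega>) \<in> borel_measurable \<Omega>" using S(1) by (intro borel_measurable_sum) auto
  have [measurable]: "X \<in> borel_measurable \<Omega>" unfolding X_def by measurable
  have le: "X \<omega> \<le> 1" for \<omega>
  proof (cases \<omega>)
    case (fields a s \<sigma> e \<xi>)
    define EA where "EA \<longleftrightarrow> (\<forall>j<k. a 0 < \<sigma> j) \<and> r * a 0 < e 0"
    define ES where "ES l \<longleftrightarrow> \<sigma> l < a 0 \<and> (\<forall>j<k - 1. \<sigma> l < \<sigma> (skip l j)) \<and> r * \<sigma> l < e 0" for l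
    define ER where "ER \<longleftrightarrow> 0 < r \<and> e 0 / r < a 0 \<and> (\<forall>j<k. e 0 / r < \<sigma> j)"
    have "XA \<omega> = of_bool EA"
      by (auto simp: XA_def EA_def fields alive_sample_def alive_def indicator_def)
    moreover have "XS l \<omega> = of_bool (ES l)" for l
      by (auto simp: XS_def ES_def fields alive_sample_def alive_def indicator_def)
    moreover have "XR \<omega> = of_bool ER"
      by (auto simp: XR_def ER_def fields alive_sample_def alive_def indicator_def)
    ultimately have "X \<omega> = of_bool EA + (\<Sum>l<k. of_bool (ES l)) + of_bool ER"
      by (simp add: X_def)
    also have "\<dots> \<le> 1"
    proof (rule sum_exclusive_le_1)
      fix l l' assume *: "l < k" "l' < k" "ES l" "ES l'"
      show "l = l'"
      proof (rule ccontr)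
        assume "l \<noteq> l'"
        then have "\<sigma> l < \<sigma> l'" "\<sigma> l' < \<sigma> l"
          using * skip_surj[of l' k l] skip_surj[of l k l'] by (auto simp: ES_def)
        then show False by simp
      qed
    next
      fix l assume *: "l < k" "ES l"
      have "\<not> ER"
      proof
        assume ER
        then have "e 0 / r < \<sigma> l" "0 < r" using * by (auto simp: ER_def)
        then show False using * by (simp add: ES_def field_simps)
      qed
      then show "\<not> EA \<and> \<not> ER" using * by (auto simp: EA_def ES_def)
    next
      show "\<not> (EA \<and> ER)" by (auto simp: EA_def ER_def field_simps)
    qed
    finally show ?thesis .
  qed
  have R_sum: "ennreal \<nu> + of_nat k * ennreal \<mu> + ennreal r = ennreal R"
    using params r0 by (simp add: R_def ennreal_of_nat_eq_real_of_nat flip: ennreal_mult ennreal_plus)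
  have "(\<integral>\<^sup>+\<omega>. X \<omega> \<partial>\<Omega>) = (\<integral>\<^sup>+\<omega>. XA \<omega> \<partial>\<Omega>) + (\<Sum>l<k. \<integral>\<^sup>+\<omega>. XS l \<omega> \<partial>\<Omega>) + (\<integral>\<^sup>+\<omega>. XR \<omega> \<partial>\<Omega>)"
  proof -
    have "(\<integral>\<^sup>+\<omega>. (\<Sum>l<k. XS l \<omega>) \<partial>\<Omega>) = (\<Sum>l<k. \<integral>\<^sup>+\<omega>. XS l \<omega> \<partial>\<Omega>)"
      by (rule nn_integral_sum) (use S(1) in auto)
    then show ?thesis unfolding X_def by (simp add: nn_integral_add)
  qed
  also have "\<dots> = (ennreal \<nu> + of_nat k * ennreal \<mu> + ennreal r) * ennreal (1 / R)"
    using S(3) by (simp add: A(3) R(3) distrib_right mult.assoc)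
  also have "\<dots> = 1" unfolding R_sum using R0 by (simp flip: ennreal_mult)
  finally have one: "(\<integral>\<^sup>+\<omega>. X \<omega> \<partial>\<Omega>) = 1" .
  \<comment> \<open>A function that is at most 1 everywhere and has integral 1 over a probability
    space equals 1 almost surely.\<close>
  have "AE \<omega> in \<Omega>. X \<omega> = 1"
  proof -
    have "(\<integral>\<^sup>+\<omega>. 1 - X \<omega> \<partial>\<Omega>) = (\<integral>\<^sup>+\<omega>. 1 \<partial>\<Omega>) - (\<integral>\<^sup>+\<omega>. X \<omega> \<partial>\<Omega>)"
      by (rule nn_integral_diff) (auto simp: one le)
    then have "(\<integral>\<^sup>+\<omega>. 1 - X \<omega> \<partial>\<Omega>) = 0" by (simp add: one emeasure_space_1)
    then have "AE \<omega> in \<Omega>. 1 - X \<omega> = 0" by (subst nn_integral_0_iff_AE[symmetric]) auto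
    then show ?thesis by eventually_elim (metis antisym diff_eq_0_iff_ennreal le le_less_trans ennreal_one_less_top linorder_not_le less_imp_le)
  qed
  then have "J q i = (\<integral>\<^sup>+\<omega>. C q i \<omega> * X \<omega> \<partial>\<Omega>)"
    unfolding J_def by (intro nn_integral_cong_AE, eventually_elim) simp
  also have "\<dots> = (\<integral>\<^sup>+\<omega>. C q i \<omega> * XA \<omega> + (\<Sum>l<k. C q i \<omega> * XS l \<omega>) + C q i \<omega> * XR \<omega> \<partial>\<Omega>)"
    by (simp add: X_def distrib_left sum_distrib_left)
  also have "\<dots> = (\<integral>\<^sup>+\<omega>. C q i \<omega> * XA \<omega> \<partial>\<Omega>) + (\<Sum>l<k. \<integral>\<^sup>+\<omega>. C q i \<omega> * XS l \<omega> \<partial>\<Omega>) + (\<integral>\<^sup>+\<omega>. C q i \<omega> * XR \<omega> \<partial>\<Omega>)"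
  proof -
    have ms: "(\<lambda>\<omega>. C q i \<omega> * XS l \<omega>) \<in> borel_measurable \<Omega>" if "l \<in> {..<k}" for l
      using S(1)[of l] that by (intro borel_measurable_times_ennreal measurable_C) auto
    then have [measurable]: "(\<lambda>\<omega>. \<Sum>l<k. C q i \<omega> * XS l \<omega>) \<in> borel_measurable \<Omega>" by (intro borel_measurable_sum)
    have "(\<integral>\<^sup>+\<omega>. (\<Sum>l<k. C q i \<omega> * XS l \<omega>) \<partial>\<Omega>) = (\<Sum>l<k. \<integral>\<^sup>+\<omega>. C q i \<omega> * XS l \<omega> \<partial>\<Omega>)"
      by (rule nn_integral_sum) (rule ms)
    then show ?thesis by (simp add: nn_integral_add)
  qed
  also have "\<dots> = ennreal \<nu> * (h q * c + d * \<Gamma>A) + of_nat k * (ennreal \<mu> * (h q * c + d * J (q - 1) i)) + ennreal r * (h q * c + d * \<Gamma>R)"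
    using S(2) by (simp add: A(2) R(2))
  also have "\<dots> = (ennreal \<nu> + of_nat k * ennreal \<mu> + ennreal r) * c * h q
      + d * (ennreal \<nu> * \<Gamma>A + of_nat k * ennreal \<mu> * J (q - 1) i + ennreal r * \<Gamma>R)"
    by (simp add: distrib_left distrib_right mult_ac add_ac)
  also have "(ennreal \<nu> + of_nat k * ennreal \<mu> + ennreal r) * c = d"
    unfolding R_sum c_def d_def using R0 params by (simp flip: ennreal_mult)
  finally have J: "J q i = d * (h q + (ennreal \<nu> * \<Gamma>A + of_nat k * ennreal \<mu> * J (q - 1) i + ennreal r * \<Gamma>R))"
    by (simp add: distrib_left)
  have d1: "ennreal (\<alpha> + R) * d = 1"
  proof -
    have "ennreal (\<alpha> + R) * d = ennreal ((\<alpha> + R) * (1 / (R + \<alpha>)))"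
      unfolding d_def using R0 params by (intro ennreal_mult[symmetric]) auto
    also have "(\<alpha> + R) * (1 / (R + \<alpha>)) = 1" using R0 params by simp
    finally show ?thesis by simp
  qed
  have "ennreal (\<alpha> + R) * J q i = h q + (ennreal \<nu> * \<Gamma>A + of_nat k * ennreal \<mu> * J (q - 1) i + ennreal r * \<Gamma>R)"
    unfolding J mult.assoc[symmetric] d1 by simp
  also have "of_nat k * ennreal \<mu> = ennreal (real k * \<mu>)"
    using params by (simp add: ennreal_of_nat_eq_real_of_nat flip: ennreal_mult)
  also have "ennreal r * \<Gamma>R = (\<Sum>j\<in>regimes P - {i}. ennreal (regime_gen P i j) * J q j)"
  proof (cases "0 < r")
    case True
    then show ?thesis using after_jump_integral(2)[OF i] by (simp add: \<Gamma>R_def r_def)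
  next
    case False
    then have "(\<Sum>j\<in>regimes P - {i}. regime_gen P i j) = 0" using r0 exit_rate_eq[OF i] by (simp add: r_def)
    then have "regime_gen P i j = 0" if "j \<in> regimes P - {i}" for j
      using that i regime_gen_nonneg by (subst (asm) sum_nonneg_eq_0_iff) auto
    then show ?thesis using False r0 by simp
  qed
  finally show ?thesis by (simp add: R_def \<Gamma>A_def k_def r_def add.assoc)
qed

end

section \<open>Increasing convex functions\<close>

text \<open>Convexity is stated as a sum inequality, which stays meaningful in
  \<open>ennreal\<close> and passes to integrals and limits.\<close>

definition increasing_convex :: "(nat \<Rightarrow> ennreal) \<Rightarrow> bool" where
  "increasing_convex f \<longleftrightarrow> (\<forall>q. f q \<le> f (q + 1)) \<and> (\<forall>q. f (q + 1) + f (q + 1) \<le> f q + f (q + 2))"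

lemma increasing_convexI:
  "(\<And>q. f q \<le> f (q + 1)) \<Longrightarrow> (\<And>q. f (q + 1) + f (q + 1) \<le> f q + f (q + 2)) \<Longrightarrow> increasing_convex f"
  by (simp add: increasing_convex_def)

lemma increasing_convexD:
  assumes "increasing_convex f"
  shows "f q \<le> f (q + 1)" "f (q + 1) + f (q + 1) \<le> f q + f (q + 2)"
  using assms by (simp_all add: increasing_convex_def)

lemma increasing_convex_add:
  assumes "increasing_convex f" "increasing_convex g"
  shows "increasing_convex (\<lambda>q. f q + g q)"
proof (rule increasing_convexI)
  fix q
  show "f q + g q \<le> f (q + 1) + g (q + 1)" using assms by (intro add_mono increasing_convexD)
  show "f (q + 1) + g (q + 1) + (f (q + 1) + g (q + 1)) \<le> f q + g q + (f (q + 2) + g (q + 2))"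
    using add_mono[OF increasing_convexD(2)[OF assms(1), of q] increasing_convexD(2)[OF assms(2), of q]]
    by (simp add: add_ac)
qed

lemma increasing_convex_cmult:
  assumes "increasing_convex f"
  shows "increasing_convex (\<lambda>q. c * f q)"
  using increasing_convexD[OF assms] by (intro increasing_convexI) (auto simp: mult_left_mono simp flip: distrib_left)

lemma increasing_convex_const: "increasing_convex (\<lambda>_. c)"
  by (simp add: increasing_convex_def)

lemma increasing_convex_sum:
  "(\<And>j. j \<in> A \<Longrightarrow> increasing_convex (f j)) \<Longrightarrow> increasing_convex (\<lambda>q. \<Sum>j\<in>A. f j q)"
  by (induction A rule: infinite_finite_induct) (auto intro: increasing_convex_add increasing_convex_const)

lemma increasing_convex_nn_integral:
  assumes "\<And>x. increasing_convex (f x)" and [measurable]: "\<And>q. (\<lambda>x. f x q) \<in> borel_measurable M"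
  shows "increasing_convex (\<lambda>q. \<integral>\<^sup>+x. f x q \<partial>M)"
proof (rule increasing_convexI)
  fix q
  show "(\<integral>\<^sup>+x. f x q \<partial>M) \<le> (\<integral>\<^sup>+x. f x (q + 1) \<partial>M)"
    by (intro nn_integral_mono increasing_convexD assms)
  have "(\<integral>\<^sup>+x. f x (q + 1) \<partial>M) + (\<integral>\<^sup>+x. f x (q + 1) \<partial>M) = (\<integral>\<^sup>+x. f x (q + 1) + f x (q + 1) \<partial>M)"
    by (rule nn_integral_add[symmetric]) measurable
  also have "\<dots> \<le> (\<integral>\<^sup>+x. f x q + f x (q + 2) \<partial>M)"
    by (intro nn_integral_mono increasing_convexD assms)
  also have "\<dots> = (\<integral>\<^sup>+x. f x q \<partial>M) + (\<integral>\<^sup>+x. f x (q + 2) \<partial>M)"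
    by (rule nn_integral_add) measurable
  finally show "(\<integral>\<^sup>+x. f x (q + 1) \<partial>M) + (\<integral>\<^sup>+x. f x (q + 1) \<partial>M) \<le> (\<integral>\<^sup>+x. f x q \<partial>M) + (\<integral>\<^sup>+x. f x (q + 2) \<partial>M)" .
qed

lemma increasing_convex_ennreal_iff:
  assumes "\<And>q. 0 \<le> F q"
  shows "increasing_convex (\<lambda>q. ennreal (F q)) \<longleftrightarrow>
    (\<forall>q. F q \<le> F (q + 1)) \<and> (\<forall>q. F (q + 1) + F (q + 1) \<le> F q + F (q + 2))"
  unfolding increasing_convex_def using assms by (simp flip: ennreal_plus)

lemma increasing_convex_real:
  assumes "increasing_convex f" "\<And>q. f q < \<top>"
  obtains F where "\<And>q. 0 \<le> F q" "f = (\<lambda>q. ennreal (F q))" "\<And>q. F q \<le> F (q + 1)"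
    "\<And>q. F (q + 1) + F (q + 1) \<le> F q + F (q + 2)"
proof
  show f: "f = (\<lambda>q. ennreal (enn2real (f q)))" using assms(2) by simp
  show "enn2real (f q) \<le> enn2real (f (q + 1))" "enn2real (f (q + 1)) + enn2real (f (q + 1)) \<le> enn2real (f q) + enn2real (f (q + 2))" for q
    using assms(1) increasing_convex_ennreal_iff[of "\<lambda>q. enn2real (f q)"] f by simp_all
qed simp

text \<open>Given optimal actions at \<open>q\<close> and \<open>q + 2\<close>, use these same two
  actions, one each, at the two copies of \<open>q + 1\<close>. If they agree, this is convexity of
  \<open>f\<close>. If \<open>q\<close> escalates and \<open>q + 2\<close> automates, both sides are
  equal. In the opposite case one needs \<open>f (q + 1) + f (q + 2) \<le> f q + f (q + 3)\<close>,
  which combines two consecutive convexity inequalities.\<close>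

lemma increasing_convex_min:
  assumes f: "increasing_convex f" "\<And>q. f q < \<top>" and b: "b < \<top>" and c: "c < \<top>"
  shows "increasing_convex (\<lambda>q. min (b + f (q + 1)) (c + f q))"
proof -
  obtain F where F: "\<And>q. 0 \<le> F q" "f = (\<lambda>q. ennreal (F q))" "\<And>q. F q \<le> F (q + 1)"
    "\<And>q. F (q + 1) + F (q + 1) \<le> F q + F (q + 2)"
    using increasing_convex_real[OF f] by blast
  obtain b' c' where bc: "b = ennreal b'" "0 \<le> b'" "c = ennreal c'" "0 \<le> c'" using b c by (cases b; cases c) auto
  have eq: "min (b + f (q + 1)) (c + f q) = ennreal (min (b' + F (q + 1)) (c' + F q))" for q
    using bc F(1)[of q] F(1)[of "q + 1"] by (simp add: F(2) min_def flip: ennreal_plus)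
  show ?thesis
    unfolding eq
  proof (subst increasing_convex_ennreal_iff, goal_cases)
    case (1 q)
    then show ?case using bc F(1)[of q] F(1)[of "q + 1"] by simp
  next
    case 2
    show ?case
    proof (intro conjI allI)
      fix q
      show "min (b' + F (q + 1)) (c' + F q) \<le> min (b' + F (q + 1 + 1)) (c' + F (q + 1))"
        using F(3)[of q] F(3)[of "q + 1"] by (simp add: min_def)
      show "min (b' + F (q + 1 + 1)) (c' + F (q + 1)) + min (b' + F (q + 1 + 1)) (c' + F (q + 1))
          \<le> min (b' + F (q + 1)) (c' + F q) + min (b' + F (q + 2 + 1)) (c' + F (q + 2))"
        using F(4)[of q] F(4)[of "q + 1"] by (simp add: min_def numeral_3_eq_3 numeral_2_eq_2)
    qed
  qed
qed

text \<open>
  For \<open>q + 2 \<le> m\<close> the second difference is a nonnegative combination of those of \<open>f\<close> at \<open>q - 1\<close> and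
  \<open>q\<close>; monotonicity of \<open>f\<close> is needed only at \<open>q + 1 = m\<close>, where the last idle server disappears.
\<close>

lemma increasing_convex_service:
  assumes f: "increasing_convex f" "\<And>q. f q < \<top>" and m: "1 \<le> (m::nat)"
  shows "increasing_convex (\<lambda>q. of_nat (min q m) * f (q - 1) + of_nat (m - min q m) * f q)"
proof -
  obtain F where F: "\<And>q. 0 \<le> F q" "f = (\<lambda>q. ennreal (F q))" "\<And>q. F q \<le> F (q + 1)"
    "\<And>q. F (q + 1) + F (q + 1) \<le> F q + F (q + 2)"
    using increasing_convex_real[OF f] by blast
  define S where "S q = real (min q m) * F (q - 1) + real (m - min q m) * F q" for q
  have eq: "of_nat (min q m) * f (q - 1) + of_nat (m - min q m) * f q = ennreal (S q)" for q
    unfolding S_def F(2) using F(1)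
    by (simp add: ennreal_of_nat_eq_real_of_nat ennreal_mult del: of_nat_min of_nat_diff)
  have S0: "0 \<le> S q" for q using F(1) by (simp add: S_def)
  have S_less: "S q = real q * F (q - 1) + (real m - real q) * F q" if "q \<le> m" for q
    using that by (simp add: S_def of_nat_diff min_def)
  have S_ge: "S q = real m * F (q - 1)" if "m \<le> q" for q
    using that by (simp add: S_def)
  have "S q \<le> S (q + 1)" for q
  proof (cases "q < m")
    case True
    have "S (q + 1) - S q = real q * (F q - F (q - 1)) + (real m - real q - 1) * (F (q + 1) - F q)"
      using True by (simp add: S_less algebra_simps)
    moreover have "0 \<le> real q * (F q - F (q - 1))" using F(3)[of "q - 1"] by (cases q) auto
    moreover have "0 \<le> (real m - real q - 1) * (F (q + 1) - F q)" using F(3)[of q] True by (intro mult_nonneg_nonneg) auto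
    ultimately show ?thesis by linarith
  next
    case False
    then show ?thesis using F(3)[of "q - 1"] m by (simp add: S_ge mult_left_mono)
  qed
  moreover have "S (q + 1) + S (q + 1) \<le> S q + S (q + 2)" for q
  proof -
    \<comment> \<open>At \<open>q = 0\<close> the truncated \<open>q - 1\<close> is 0 as well, but
      the factor \<open>real q\<close> removes the term.\<close>
    have D: "0 \<le> real q * (F (q - 1) - 2 * F q + F (q + 1))" using F(4)[of "q - 1"] by (cases q) (auto intro!: mult_nonneg_nonneg)
    consider "q + 2 \<le> m" | "q + 1 = m" | "m \<le> q" by linarith
    then show ?thesis
    proof cases
      case 1
      have "S q + S (q + 2) - 2 * S (q + 1) = real q * (F (q - 1) - 2 * F q + F (q + 1)) + (real m - real q - 2) * (F q - 2 * F (q + 1) + F (q + 2))"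
        using 1 by (simp add: S_less algebra_simps)
      moreover have "0 \<le> (real m - real q - 2) * (F q - 2 * F (q + 1) + F (q + 2))"
        using 1 F(4)[of q] by (intro mult_nonneg_nonneg) auto
      ultimately show ?thesis using D by linarith
    next
      case 2
      have "S q + S (q + 2) - 2 * S (q + 1) = real q * (F (q - 1) - 2 * F q + F (q + 1)) + (F (q + 1) - F q)"
        using S_less[of q] S_ge[of "q + 1"] S_ge[of "q + 2"] by (simp add: algebra_simps flip: 2)
      then show ?thesis using D F(3)[of q] by linarith
    next
      case 3
      then obtain p where p: "q = p + 1" using m by (metis add.commute le_add_diff_inverse le_trans)
      have "S q + S (q + 2) - 2 * S (q + 1) = real m * (F p + F (p + 2) - (F (p + 1) + F (p + 1)))"
        using 3 by (simp add: S_ge p algebra_simps)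
      moreover have "0 \<le> real m * (F p + F (p + 2) - (F (p + 1) + F (p + 1)))" using F(4)[of p] by simp
      ultimately show ?thesis by linarith
    qed
  qed
  ultimately show ?thesis unfolding eq using S0 by (subst increasing_convex_ennreal_iff) auto
qed

section \<open>Extending policies and costs beyond regimes and scores\<close>

context hybrid begin

text \<open>
  Membership in \<open>stationary_policies\<close> and the model assumptions say nothing about scores outside \<open>{0..1}\<close> or about
  arguments that are not regimes; there policies and costs are redefined so as to be measurable everywhere.
\<close>

definition clamp :: "policy \<Rightarrow> policy" where
  "clamp u q i s \<longleftrightarrow> i \<in> regimes P \<and> s \<in> {0..1} \<and> u q i s"

definition automation_cost :: "nat \<Rightarrow> real \<Rightarrow> ennreal" where
  "automation_cost i s = (if i \<in> regimes P \<and> s \<in> {0..1} then ennreal (auto_cost P s i) else 0)"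

definition esc :: ennreal where
  "esc = ennreal (esc_cost P)"

definition stage_cost :: "policy \<Rightarrow> nat \<Rightarrow> nat \<Rightarrow> real \<Rightarrow> ennreal" where
  "stage_cost u q i s = (if u q i s then esc else automation_cost i s)"

definition hold :: "nat \<Rightarrow> ennreal" where
  "hold q = ennreal (holding_cost P q)"

definition policy_value :: "policy \<Rightarrow> (nat \<Rightarrow> ennreal) \<Rightarrow> nat \<Rightarrow> nat \<Rightarrow> ennreal" where
  "policy_value u h q i = (\<integral>\<^sup>+\<omega>. total_cost P (clamp u) h (stage_cost (clamp u)) q i \<omega> \<partial>\<Omega>)"

lemma measurable_clamp:
  assumes "u \<in> stationary_policies P"
  shows "Measurable.pred borel (clamp u q i)"
proof (cases "i \<in> regimes P")
  case True
  then have "u q i \<in> restrict_space borel {0..1} \<rightarrow>\<^sub>M count_space UNIV"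
    using assms by (simp add: stationary_policies_def)
  then have "{s \<in> space (restrict_space borel {0..1}). u q i s} \<in> sets (restrict_space borel {0..1})"
    by (rule predE)
  then have "{s. 0 \<le> s \<and> s \<le> 1 \<and> u q i s} \<in> sets borel"
    by (subst (asm) sets_restrict_space_iff) (auto simp: space_restrict_space)
  then show ?thesis using True by (simp add: clamp_def[abs_def] pred_def)
qed (simp add: clamp_def[abs_def])

lemma measurable_automation_cost [measurable]: "automation_cost i \<in> borel_measurable borel"
proof (cases "i \<in> regimes P")
  case True
  then have "continuous_on {0..1} (\<lambda>s. auto_cost P s i)" using model by (simp add: hybrid_model_def)
  then have "(\<lambda>s. ennreal (indicator {0..1} s *\<^sub>R auto_cost P s i)) \<in> borel_measurable borel"
    by (intro measurable_compose[OF borel_measurable_continuous_on_indicator measurable_ennreal]) auto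
  also have "(\<lambda>s. ennreal (indicator {0..1} s *\<^sub>R auto_cost P s i)) = automation_cost i"
    using True by (auto simp: automation_cost_def)
  finally show ?thesis .
qed (simp add: automation_cost_def[abs_def])

lemma measurable_stage_cost:
  "Measurable.pred borel (u q i) \<Longrightarrow> stage_cost u q i \<in> borel_measurable borel"
  unfolding stage_cost_def[abs_def] by measurable

lemma hybrid_policy_clamp:
  assumes "u \<in> stationary_policies P"
  shows "hybrid_policy P (clamp u) (stage_cost (clamp u))"
  by unfold_locales (auto intro: measurable_clamp[OF assms] measurable_stage_cost)

lemma policy_value_bellman:
  assumes "u \<in> stationary_policies P" "i \<in> regimes P"
  shows "ennreal (\<alpha> + (\<nu> + real (min q m) * \<mu> + exit_rate i)) * policy_value u h q i
    = h q + ennreal \<nu> * (\<integral>\<^sup>+x. stage_cost (clamp u) q i x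
         + (if clamp u q i x then policy_value u h (q + 1) i else policy_value u h q i) \<partial>score_law P)
      + ennreal (real (min q m) * \<mu>) * policy_value u h (q - 1) i
      + (\<Sum>j\<in>regimes P - {i}. ennreal (regime_gen P i j) * policy_value u h q j)"
proof -
  interpret hybrid_policy P "clamp u" h "stage_cost (clamp u)" by (rule hybrid_policy_clamp[OF assms(1)])
  show ?thesis using bellman[OF assms(2), of q] unfolding J_def policy_value_def .
qed

lemma departures_clamp:
  assumes i: "i \<in> regimes P" and good: "good (a, s, \<sigma>, e, \<xi>)"
  shows "departures P (clamp u) q i (a, s, \<sigma>, e, \<xi>) n = departures P u q i (a, s, \<sigma>, e, \<xi>) n"
proof (induction n)
  case (Suc n)
  have "s n \<in> {0..1}" using good by (auto simp: good_def)
  moreover note regime_before_regimes[OF i good, of "arrival_time a n"]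
  ultimately show ?case using Suc by (simp add: departures_Suc queue_at_arrival_count clamp_def del: departures.simps)
qed (simp add: departures_0 del: departures.simps)

text \<open>On good samples only genuine regimes and scores in the unit interval occur, so clamping
  changes neither the path nor its cost.\<close>

lemma policy_cost_eq:
  assumes i: "i \<in> regimes P"
  shows "policy_cost P u q i = policy_value u hold q i"
  unfolding policy_cost_def policy_value_def
proof (intro nn_integral_cong_AE, use AE_good in eventually_elim)
  fix \<omega> assume g: "good \<omega>"
  obtain a s \<sigma> e \<xi> where \<omega>: "\<omega> = (a, s, \<sigma>, e, \<xi>)" by (cases \<omega>)
  note good = g[unfolded \<omega>]
  have s: "s n \<in> {0..1}" for n using good by (auto simp: good_def)
  have r: "regime_before P i e \<xi> t \<in> regimes P" for t by (rule regime_before_regimes[OF i good])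
  have ql: "queue_length P (clamp u) q i \<omega> t = queue_length P u q i \<omega> t" for t
    by (simp add: \<omega> queue_length_count departures_clamp[OF i good])
  have qa: "queue_at_arrival P (clamp u) q i \<omega> n = queue_at_arrival P u q i \<omega> n" for n
    by (simp add: \<omega> queue_at_arrival_count departures_clamp[OF i good])
  have dec: "ennreal (exp (- \<alpha> * arrival_time a n) * decision_cost P u q i \<omega> n) =
     ennreal (exp (- \<alpha> * arrival_time a n)) * stage_cost (clamp u) (queue_at_arrival P (clamp u) q i \<omega> n)
       (regime_before P i e \<xi> (arrival_time a n)) (s n)" for n
    using s[of n] r[of "arrival_time a n"]
    by (auto simp: decision_cost_def \<omega>[symmetric] qa stage_cost_def clamp_def automation_cost_def esc_def ennreal_mult')
      (auto simp: \<omega> Let_def ennreal_mult')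
  show "(\<integral>\<^sup>+t\<in>{0..}. ennreal (exp (- \<alpha> * t) * holding_cost P (queue_length P u q i \<omega> t)) \<partial>lborel)
      + (\<Sum>n. ennreal (exp (- \<alpha> * arrival_time (fst \<omega>) n) * decision_cost P u q i \<omega> n))
    = total_cost P (clamp u) hold (stage_cost (clamp u)) q i \<omega>"
  proof -
    have "total_cost P (clamp u) hold (stage_cost (clamp u)) q i \<omega> =
     (\<integral>\<^sup>+t\<in>{0..}. ennreal (exp (- \<alpha> * t)) * hold (queue_length P (clamp u) q i \<omega> t) \<partial>lborel)
      + (\<Sum>n. ennreal (exp (- \<alpha> * arrival_time a n)) * stage_cost (clamp u) (queue_at_arrival P (clamp u) q i \<omega> n)
       (regime_before P i e \<xi> (arrival_time a n)) (s n))"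
      by (simp add: total_cost_def \<omega>)
    then show ?thesis by (simp only: dec[symmetric] ql hold_def) (simp add: \<omega> ennreal_mult')
  qed
qed

end

section \<open>Uniformization and value iteration\<close>

context hybrid begin

text \<open>The sum dominates each exit rate, so \<open>\<Lambda>\<close> dominates the total event
  rate in every state.\<close>

definition total_exit :: real where
  "total_exit = (\<Sum>i\<in>regimes P. exit_rate i)"

definition \<Lambda> :: real where
  "\<Lambda> = \<nu> + real m * \<mu> + total_exit"

text \<open>
  Uniformization at the total rate \<open>\<Lambda>\<close>: the rate that state \<open>(q, i)\<close> lacks to reach \<open>\<Lambda>\<close> is spent on fictitious
  transitions of \<open>(q, i)\<close> to itself.
\<close>

definition rest :: "(nat \<Rightarrow> nat \<Rightarrow> ennreal) \<Rightarrow> nat \<Rightarrow> nat \<Rightarrow> ennreal" where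
  "rest f q i = ennreal \<mu> * (of_nat (min q m) * f (q - 1) i + of_nat (m - min q m) * f q i)
     + (\<Sum>j\<in>regimes P - {i}. ennreal (regime_gen P i j) * f q j) + ennreal (total_exit - exit_rate i) * f q i"

definition policy_op :: "policy \<Rightarrow> (nat \<Rightarrow> ennreal) \<Rightarrow> (nat \<Rightarrow> nat \<Rightarrow> ennreal) \<Rightarrow> nat \<Rightarrow> nat \<Rightarrow> ennreal" where
  "policy_op u h f q i = ennreal (1 / (\<alpha> + \<Lambda>)) * (h q
     + ennreal \<nu> * (\<integral>\<^sup>+x. stage_cost (clamp u) q i x + (if clamp u q i x then f (q + 1) i else f q i) \<partial>score_law P)
     + rest f q i)"

definition opt_op :: "(nat \<Rightarrow> nat \<Rightarrow> ennreal) \<Rightarrow> nat \<Rightarrow> nat \<Rightarrow> ennreal" where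
  "opt_op f q i = ennreal (1 / (\<alpha> + \<Lambda>)) * (hold q
     + ennreal \<nu> * (\<integral>\<^sup>+x. min (esc + f (q + 1) i) (automation_cost i x + f q i) \<partial>score_law P) + rest f q i)"

lemma exit_rate_le: "i \<in> regimes P \<Longrightarrow> exit_rate i \<le> total_exit"
  unfolding total_exit_def by (rule member_le_sum) (auto intro: exit_rate_nonneg)

lemma total_exit_nonneg: "0 \<le> total_exit"
  unfolding total_exit_def by (intro sum_nonneg exit_rate_nonneg)

lemma \<Lambda>_pos: "0 < \<Lambda>"
  using params total_exit_nonneg by (simp add: \<Lambda>_def add_pos_nonneg)

text \<open>The missing rate times the value is added to both sides of the evaluation equation, and
  the result is divided by the finite number \<open>\<alpha> + \<Lambda>\<close>. Nothing is
  subtracted, so the identity holds even where the value is infinite.\<close>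

lemma policy_value_fixed_point:
  assumes u: "u \<in> stationary_policies P" and i: "i \<in> regimes P"
  shows "policy_value u h q i = policy_op u h (policy_value u h) q i"
proof -
  let ?V = "policy_value u h" and ?k = "min q m"
  let ?I = "\<integral>\<^sup>+x. stage_cost (clamp u) q i x + (if clamp u q i x then ?V (q + 1) i else ?V q i) \<partial>score_law P"
  let ?S = "\<Sum>j\<in>regimes P - {i}. ennreal (regime_gen P i j) * ?V q j"
  have nn: "0 \<le> exit_rate i" "exit_rate i \<le> total_exit" using i exit_rate_nonneg exit_rate_le by auto
  \<comment> \<open>The uniform rate is the true rate plus that of the idle servers and that of the
    exit rates of the other regimes.\<close>
  have "ennreal (\<alpha> + \<Lambda>) = ennreal (\<alpha> + (\<nu> + real ?k * \<mu> + exit_rate i)) + (ennreal \<mu> * of_nat (m - ?k) + ennreal (total_exit - exit_rate i))"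
  proof -
    have "\<alpha> + \<Lambda> = (\<alpha> + (\<nu> + real ?k * \<mu> + exit_rate i)) + (\<mu> * real (m - ?k) + (total_exit - exit_rate i))"
      by (simp add: \<Lambda>_def of_nat_diff algebra_simps)
    moreover have "0 \<le> \<alpha> + (\<nu> + real ?k * \<mu> + exit_rate i)" "0 \<le> \<mu> * real (m - ?k)" "0 \<le> total_exit - exit_rate i"
      using params nn by auto
    ultimately show ?thesis using params
      by (simp only: ennreal_plus add_nonneg_nonneg ennreal_of_nat_eq_real_of_nat ennreal_mult less_imp_le of_nat_0_le_iff)
  qed
  then have "ennreal (\<alpha> + \<Lambda>) * ?V q i = (h q + ennreal \<nu> * ?I + ennreal (real ?k * \<mu>) * ?V (q - 1) i + ?S)
    + (ennreal \<mu> * of_nat (m - ?k) + ennreal (total_exit - exit_rate i)) * ?V q i"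
    using policy_value_bellman[OF u i, of q h] by (simp add: distrib_right)
  also have "ennreal (real ?k * \<mu>) = ennreal \<mu> * of_nat ?k"
    using params by (simp add: ennreal_of_nat_eq_real_of_nat ennreal_mult mult.commute del: of_nat_min)
  finally have "ennreal (\<alpha> + \<Lambda>) * ?V q i = h q + ennreal \<nu> * ?I + rest ?V q i"
    by (simp add: rest_def distrib_left distrib_right mult_ac add_ac)
  then have "ennreal (1 / (\<alpha> + \<Lambda>)) * (ennreal (\<alpha> + \<Lambda>) * ?V q i) = policy_op u h ?V q i"
    by (simp add: policy_op_def)
  moreover have "ennreal (1 / (\<alpha> + \<Lambda>)) * ennreal (\<alpha> + \<Lambda>) = 1"
    using params \<Lambda>_pos by (subst ennreal_mult[symmetric]) auto
  ultimately show ?thesis by (simp add: mult.assoc[symmetric])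
qed

lemma rest_mono:
  assumes "\<And>q i. i \<in> regimes P \<Longrightarrow> f q i \<le> f' q i" "i \<in> regimes P"
  shows "rest f q i \<le> rest f' q i"
  unfolding rest_def using assms by (intro add_mono mult_left_mono sum_mono) auto

lemma opt_op_mono:
  assumes "\<And>q i. i \<in> regimes P \<Longrightarrow> f q i \<le> f' q i" "i \<in> regimes P"
  shows "opt_op f q i \<le> opt_op f' q i"
  unfolding opt_op_def using assms
  by (intro add_mono mult_left_mono nn_integral_mono min.mono rest_mono order_refl) auto

lemma policy_op_mono:
  assumes "\<And>q i. i \<in> regimes P \<Longrightarrow> f q i \<le> f' q i" "i \<in> regimes P"
  shows "policy_op u h f q i \<le> policy_op u h f' q i"
  unfolding policy_op_def using assms
  by (intro add_mono mult_left_mono nn_integral_mono rest_mono order_refl) auto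

lemma opt_op_le_policy_op: "opt_op f q i \<le> policy_op u hold f q i"
  unfolding opt_op_def policy_op_def
  by (intro mult_left_mono add_mono nn_integral_mono) (auto simp: stage_cost_def)

lemma rest_add:
  assumes i: "i \<in> regimes P"
  shows "rest (\<lambda>q i. f q i + x) q i = rest f q i + ennreal (real m * \<mu> + total_exit) * x"
proof -
  let ?k = "min q m"
  have "(of_nat m :: ennreal) = of_nat ?k + of_nat (m - ?k)" by (simp flip: of_nat_add)
  then have 1: "of_nat ?k * (f (q - 1) i + x) + of_nat (m - ?k) * (f q i + x)
      = of_nat ?k * f (q - 1) i + of_nat (m - ?k) * f q i + of_nat m * x"
    by (simp add: distrib_left distrib_right add_ac)
  have 2: "(\<Sum>j\<in>regimes P - {i}. ennreal (regime_gen P i j) * (f q j + x))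
     = (\<Sum>j\<in>regimes P - {i}. ennreal (regime_gen P i j) * f q j) + ennreal (exit_rate i) * x"
  proof -
    have "ennreal (exit_rate i) = (\<Sum>j\<in>regimes P - {i}. ennreal (regime_gen P i j))"
      unfolding exit_rate_eq[OF i] using i by (intro sum_ennreal[symmetric]) (auto intro: regime_gen_nonneg)
    then show ?thesis by (simp add: distrib_left sum.distrib sum_distrib_right)
  qed
  have 3: "ennreal (real m * \<mu> + total_exit) = ennreal \<mu> * of_nat m + ennreal (exit_rate i) + ennreal (total_exit - exit_rate i)"
  proof -
    have "ennreal (exit_rate i) + ennreal (total_exit - exit_rate i) = ennreal total_exit"
      using exit_rate_nonneg[OF i] exit_rate_le[OF i] by (simp flip: ennreal_plus)
    moreover have "ennreal (real m * \<mu> + total_exit) = ennreal (real m * \<mu>) + ennreal total_exit"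
      using params total_exit_nonneg by (intro ennreal_plus) auto
    moreover have "ennreal (real m * \<mu>) = ennreal \<mu> * of_nat m"
      using params by (simp add: ennreal_of_nat_eq_real_of_nat ennreal_mult mult.commute)
    ultimately show ?thesis by (simp add: add.assoc)
  qed
  show ?thesis unfolding rest_def 1 2 3 by (simp add: distrib_left distrib_right mult_ac add_ac)
qed

text \<open>Together with monotonicity this is contraction in Blackwell's form: all transition
  weights, including the fictitious ones, add up to \<open>\<Lambda>\<close>, so a constant is
  scaled by \<open>\<Lambda> / (\<alpha> + \<Lambda>)\<close>.\<close>

lemma policy_op_add:
  assumes u: "u \<in> stationary_policies P" and i: "i \<in> regimes P"
  shows "policy_op u h (\<lambda>q i. f q i + x) q i = policy_op u h f q i + ennreal (\<Lambda> / (\<alpha> + \<Lambda>)) * x"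
proof -
  interpret S: prob_space "score_law P" by (rule prob_spaces)
  note [measurable] = measurable_clamp[OF u] measurable_stage_cost[OF measurable_clamp[OF u]]
  let ?I = "\<integral>\<^sup>+y. stage_cost (clamp u) q i y + (if clamp u q i y then f (q + 1) i else f q i) \<partial>score_law P"
  have "(\<integral>\<^sup>+y. stage_cost (clamp u) q i y + (if clamp u q i y then f (q + 1) i + x else f q i + x) \<partial>score_law P)
    = (\<integral>\<^sup>+y. (stage_cost (clamp u) q i y + (if clamp u q i y then f (q + 1) i else f q i)) + x \<partial>score_law P)"
    by (intro nn_integral_cong) (simp add: add.assoc)
  also have "\<dots> = ?I + x"
    by (subst nn_integral_add) (auto simp: S.emeasure_space_1)
  finally have 1: "(\<integral>\<^sup>+y. stage_cost (clamp u) q i y + (if clamp u q i y then f (q + 1) i + x else f q i + x) \<partial>score_law P) = ?I + x" .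
  have "ennreal \<nu> * x + ennreal (real m * \<mu> + total_exit) * x = ennreal \<Lambda> * x"
    using params total_exit_nonneg by (simp add: \<Lambda>_def add.assoc flip: distrib_right ennreal_plus)
  then have eq: "h q + ennreal \<nu> * (?I + x) + (rest f q i + ennreal (real m * \<mu> + total_exit) * x)
    = h q + ennreal \<nu> * ?I + rest f q i + ennreal \<Lambda> * x"
    by (simp add: distrib_left add_ac)
  have "ennreal (1 / (\<alpha> + \<Lambda>)) * ennreal \<Lambda> = ennreal (\<Lambda> / (\<alpha> + \<Lambda>))"
    using params \<Lambda>_pos by (subst ennreal_mult[symmetric]) auto
  then have "ennreal (1 / (\<alpha> + \<Lambda>)) * (y + ennreal \<Lambda> * x) = ennreal (1 / (\<alpha> + \<Lambda>)) * y + ennreal (\<Lambda> / (\<alpha> + \<Lambda>)) * x" for y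
    by (simp add: distrib_left mult.assoc[symmetric])
  then show ?thesis unfolding policy_op_def 1 rest_add[OF i] eq .
qed

section \<open>Value iteration and bounds on values\<close>

definition W :: "nat \<Rightarrow> nat \<Rightarrow> nat \<Rightarrow> ennreal" where
  "W n = (opt_op ^^ n) (\<lambda>_ _. 0)"

definition Winf :: "nat \<Rightarrow> nat \<Rightarrow> ennreal" where
  "Winf q i = (SUP n. W n q i)"

lemma W_simps: "W 0 q i = 0" "W (Suc n) q i = opt_op (W n) q i"
  by (simp_all add: W_def)

lemma W_mono: "i \<in> regimes P \<Longrightarrow> W n q i \<le> W (Suc n) q i"
proof (induction n arbitrary: q i)
  case (Suc n)
  show ?case unfolding W_simps(2)[of "Suc n"] unfolding W_simps(2)[of n]
    by (rule opt_op_mono) (use Suc in \<open>auto simp: W_simps(2)[symmetric]\<close>)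
qed (simp add: W_simps)

lemma W_le_policy_value:
  assumes "u \<in> stationary_policies P"
  shows "i \<in> regimes P \<Longrightarrow> W n q i \<le> policy_value u hold q i"
proof (induction n arbitrary: q i)
  case (Suc n)
  have "W (Suc n) q i \<le> opt_op (policy_value u hold) q i"
    unfolding W_simps by (rule opt_op_mono) (use Suc in auto)
  also have "\<dots> \<le> policy_op u hold (policy_value u hold) q i" by (rule opt_op_le_policy_op)
  also have "\<dots> = policy_value u hold q i" using policy_value_fixed_point[OF assms Suc.prems] by simp
  finally show ?case .
qed (simp add: W_simps)

lemma nn_integral_exp_decay: "(\<integral>\<^sup>+t\<in>{0..}. ennreal (exp (- \<alpha> * t)) \<partial>lborel) = ennreal (1 / \<alpha>)"
proof -
  have "(\<integral>\<^sup>+t\<in>{0..}. ennreal (exp (- \<alpha> * t)) \<partial>lborel) = (\<integral>\<^sup>+t. ennreal (exponential_density \<alpha> t) * ennreal (1 / \<alpha>) \<partial>lborel)"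
    using params
    by (intro nn_integral_cong) (auto simp: exponential_density_def indicator_def mult.commute simp flip: ennreal_mult)
  also have "\<dots> = (\<integral>\<^sup>+t. ennreal (1 / \<alpha>) \<partial>exp_law \<alpha>)" by (rule nn_integral_exp_law[symmetric]) simp
  also have "\<dots> = ennreal (1 / \<alpha>)"
    using prob_space.emeasure_space_1[OF prob_space_exp_law[OF params(3)]] by simp
  finally show ?thesis .
qed

definition cost_bound :: real where
  "cost_bound = esc_cost P + (\<Sum>i\<in>regimes P. auto_cost P 1 i)"

lemma auto_cost_bounds:
  assumes "i \<in> regimes P" "s \<in> {0..1}"
  shows "0 \<le> auto_cost P s i" "auto_cost P s i \<le> (\<Sum>i\<in>regimes P. auto_cost P 1 i)"
proof -
  show "0 \<le> auto_cost P s i" using assms model by (auto simp: hybrid_model_def)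
  have "strict_mono_on {0..1} (\<lambda>s. auto_cost P s i)" using assms model by (auto simp: hybrid_model_def)
  then have "auto_cost P s i \<le> auto_cost P 1 i"
    using assms(2) strict_mono_onD[of "{0..1}" "\<lambda>s. auto_cost P s i" s 1] by (cases "s = 1") auto
  also have "\<dots> \<le> (\<Sum>i\<in>regimes P. auto_cost P 1 i)"
    using model assms(1) by (intro member_le_sum) (auto simp: hybrid_model_def)
  finally show "auto_cost P s i \<le> (\<Sum>i\<in>regimes P. auto_cost P 1 i)" .
qed

lemma cost_bound:
  "0 \<le> cost_bound" "stage_cost u q i s \<le> ennreal cost_bound" "esc < \<top>" "automation_cost i s < \<top>"
proof -
  have e: "0 < esc_cost P" using model by (simp add: hybrid_model_def)
  have a: "0 \<le> (\<Sum>i\<in>regimes P. auto_cost P 1 i)" by (intro sum_nonneg auto_cost_bounds) auto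
  show "0 \<le> cost_bound" using e a by (simp add: cost_bound_def)
  have "esc_cost P \<le> cost_bound" "i \<in> regimes P \<Longrightarrow> s \<in> {0..1} \<Longrightarrow> auto_cost P s i \<le> cost_bound"
    using e a auto_cost_bounds[of i s] by (auto simp: cost_bound_def)
  then show "stage_cost u q i s \<le> ennreal cost_bound"
    by (auto simp: stage_cost_def esc_def automation_cost_def intro!: ennreal_leI)
qed (simp_all add: esc_def automation_cost_def)

text \<open>\<open>1 / \<alpha>\<close> is the total discounted time and
  \<open>\<nu> / \<alpha>\<close> the expected discounted number of arrivals, summed as a geometric
  series.\<close>

lemma policy_value_bound:
  assumes H: "\<And>\<omega> t. h (queue_length P (clamp u) q i \<omega> t) \<le> ennreal H" and H0: "0 \<le> H"
  shows "policy_value u h q i \<le> ennreal (H / \<alpha>) + ennreal (cost_bound * (\<nu> / \<alpha>))"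
proof -
  let ?d = "\<lambda>\<omega>. \<Sum>n. ennreal (exp (- (\<alpha> * arrival_time (arrivals \<omega>) n)))"
  have [measurable]: "(\<lambda>\<omega>. arrival_time (arrivals \<omega>) n) \<in> borel_measurable \<Omega>" for n
    unfolding arrival_time_def using measurable_components(1) by (intro borel_measurable_sum) (simp add: case_prod_beta')
  have arr: "(\<integral>\<^sup>+\<omega>. ennreal (exp (- (\<alpha> * arrival_time (arrivals \<omega>) n))) \<partial>\<Omega>) = ennreal ((\<nu> / (\<nu> + \<alpha>)) ^ Suc n)" for n
    using split_arrival[of 0] measurable_components(1) params
    by (intro nn_integral_discounted_arrival[OF prob_space_axioms, where g = "drop_arrival 0"])
      (auto simp: case_prod_beta' skip_def)
  have "total_cost P (clamp u) h (stage_cost (clamp u)) q i \<omega> \<le> ennreal (H / \<alpha>) + ennreal cost_bound * ?d \<omega>" for \<omega>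
  proof (cases \<omega>)
    case (fields a s \<sigma> e \<xi>)
    have "(\<integral>\<^sup>+t\<in>{0..}. ennreal (exp (- \<alpha> * t)) * h (queue_length P (clamp u) q i \<omega> t) \<partial>lborel)
      \<le> (\<integral>\<^sup>+t. ennreal H * (ennreal (exp (- \<alpha> * t)) * indicator {0..} t) \<partial>lborel)"
      by (intro nn_integral_mono) (auto simp: indicator_def mult.commute[of "ennreal H"] intro!: mult_left_mono H)
    also have "\<dots> = ennreal H * ennreal (1 / \<alpha>)" by (subst nn_integral_cmult) (auto simp: nn_integral_exp_decay[simplified])
    also have "\<dots> = ennreal (H / \<alpha>)" using H0 params by (simp flip: ennreal_mult)
    finally have 1: "(\<integral>\<^sup>+t\<in>{0..}. ennreal (exp (- \<alpha> * t)) * h (queue_length P (clamp u) q i \<omega> t) \<partial>lborel) \<le> ennreal (H / \<alpha>)" .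
    have "(\<Sum>n. ennreal (exp (- \<alpha> * arrival_time a n)) * stage_cost (clamp u) (queue_at_arrival P (clamp u) q i \<omega> n)
       (regime_before P i e \<xi> (arrival_time a n)) (s n)) \<le> (\<Sum>n. ennreal cost_bound * ennreal (exp (- (\<alpha> * arrival_time a n))))"
      by (intro suminf_le) (auto simp: mult.commute[of "ennreal cost_bound"] intro!: mult_left_mono cost_bound)
    then have 2: "(\<Sum>n. ennreal (exp (- \<alpha> * arrival_time a n)) * stage_cost (clamp u) (queue_at_arrival P (clamp u) q i \<omega> n)
       (regime_before P i e \<xi> (arrival_time a n)) (s n)) \<le> ennreal cost_bound * ?d \<omega>"
      by (simp add: fields)
    show ?thesis using add_mono[OF 1 2] by (simp add: total_cost_def fields)
  qed
  then have "policy_value u h q i \<le> (\<integral>\<^sup>+\<omega>. ennreal (H / \<alpha>) + ennreal cost_bound * ?d \<omega> \<partial>\<Omega>)"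
    unfolding policy_value_def by (intro nn_integral_mono)
  also have "\<dots> = ennreal (H / \<alpha>) + ennreal cost_bound * (\<Sum>n. \<integral>\<^sup>+\<omega>. ennreal (exp (- (\<alpha> * arrival_time (arrivals \<omega>) n))) \<partial>\<Omega>)"
    by (simp add: nn_integral_add nn_integral_cmult nn_integral_suminf emeasure_space_1)
  also have "(\<Sum>n. \<integral>\<^sup>+\<omega>. ennreal (exp (- (\<alpha> * arrival_time (arrivals \<omega>) n))) \<partial>\<Omega>) = ennreal (\<nu> / \<alpha>)"
    unfolding arr
  proof (rule suminf_ennreal_eq)
    have "(\<lambda>n. (\<nu> / (\<nu> + \<alpha>)) * (\<nu> / (\<nu> + \<alpha>)) ^ n) sums ((\<nu> / (\<nu> + \<alpha>)) * (1 / (1 - \<nu> / (\<nu> + \<alpha>))))"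
      using params by (intro sums_mult geometric_sums) auto
    moreover have "(\<nu> / (\<nu> + \<alpha>)) * (1 / (1 - \<nu> / (\<nu> + \<alpha>))) = \<nu> / \<alpha>"
    proof -
      have "1 - \<nu> / (\<nu> + \<alpha>) = \<alpha> / (\<nu> + \<alpha>)" using params by (simp add: field_simps)
      then show ?thesis using params by simp
    qed
    ultimately show "(\<lambda>n. (\<nu> / (\<nu> + \<alpha>)) ^ Suc n) sums (\<nu> / \<alpha>)" by (simp only: power_Suc)
  qed (use params in simp)
  also have "ennreal cost_bound * ennreal (\<nu> / \<alpha>) = ennreal (cost_bound * (\<nu> / \<alpha>))"
    using cost_bound params by (simp flip: ennreal_mult)
  finally show ?thesis .
qed

lemma holding_cost_nonneg: "0 \<le> holding_cost P q"
  using model monoD[of "holding_cost P" 0 q] by (simp add: hybrid_model_def)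

lemma hold_mono: "q \<le> q' \<Longrightarrow> hold q \<le> hold q'"
  using model monoD[of "holding_cost P" q q'] by (simp add: hybrid_model_def hold_def ennreal_leI)

lemma increasing_convex_hold: "increasing_convex hold"
proof -
  have "mono (holding_cost P)" and
    c: "holding_cost P (n + 1) - holding_cost P n \<le> holding_cost P (n + 2) - holding_cost P (n + 1)" for n
    using model by (auto simp: hybrid_model_def)
  then have "holding_cost P n \<le> holding_cost P (n + 1)" for n by (simp add: monoD)
  moreover have "holding_cost P (n + 1) + holding_cost P (n + 1) \<le> holding_cost P n + holding_cost P (n + 2)" for n
    using c[of n] by linarith
  ultimately have "increasing_convex (\<lambda>q. ennreal (holding_cost P q))"
    by (subst increasing_convex_ennreal_iff) (auto simp: holding_cost_nonneg)
  then show ?thesis by (simp add: hold_def[abs_def])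
qed

text \<open>Without escalation the list of departure times stays the initial one, so the queue never
  exceeds \<open>q\<close> and the holding cost is bounded along the path. This bounds every iterate
  and their limit.\<close>

lemma policy_value_never_finite: "policy_value (\<lambda>_ _ _. False) hold q i < \<top>"
proof -
  have "departures P (clamp (\<lambda>_ _ _. False)) q i (a, s, \<sigma>, e, \<xi>) n = initial_queue m \<sigma> q" for a s \<sigma> e \<xi> n
    by (induction n) (simp_all add: departures_0 departures_Suc clamp_def del: departures.simps)
  then have "queue_length P (clamp (\<lambda>_ _ _. False)) q i \<omega> t \<le> q" for \<omega> t
    using count_gt_le_length[of "initial_queue m \<sigma> q" t for \<sigma>]
    by (cases \<omega>) (simp add: queue_length_count)
  then have "hold (queue_length P (clamp (\<lambda>_ _ _. False)) q i \<omega> t) \<le> ennreal (holding_cost P q)" for \<omega> t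
    using hold_mono by (simp flip: hold_def)
  from policy_value_bound[where h = hold, OF this holding_cost_nonneg] show ?thesis
    by (rule le_less_trans) simp
qed

lemma never_stationary: "(\<lambda>_ _ _. False) \<in> stationary_policies P"
  by (simp add: stationary_policies_def)

lemma W_finite: "i \<in> regimes P \<Longrightarrow> W n q i < \<top>"
  using W_le_policy_value[OF never_stationary] policy_value_never_finite by (rule le_less_trans)

lemma increasing_convex_W: "i \<in> regimes P \<Longrightarrow> increasing_convex (\<lambda>q. W n q i)"
proof (induction n arbitrary: i)
  case 0
  then show ?case by (simp add: W_simps increasing_convex_const)
next
  case (Suc n)
  have W: "increasing_convex (\<lambda>q. W n q i)" "\<And>q. W n q i < \<top>" using Suc W_finite by auto
  have "increasing_convex (\<lambda>q. \<integral>\<^sup>+x. min (esc + W n (q + 1) i) (automation_cost i x + W n q i) \<partial>score_law P)"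
    by (intro increasing_convex_nn_integral increasing_convex_min[OF W] cost_bound) measurable
  moreover have "increasing_convex (\<lambda>q. rest (W n) q i)"
    unfolding rest_def
    by (intro increasing_convex_add increasing_convex_cmult increasing_convex_sum
        increasing_convex_service[OF W params(4)] W Suc.IH) auto
  ultimately show ?case
    unfolding W_simps opt_op_def
    by (intro increasing_convex_add increasing_convex_cmult increasing_convex_hold)
qed

lemma Winf_lim: "i \<in> regimes P \<Longrightarrow> (\<lambda>n. W n q i) \<longlonglongrightarrow> Winf q i"
  unfolding Winf_def by (intro LIMSEQ_SUP incseq_SucI W_mono)

lemma Winf_le_policy_value:
  "u \<in> stationary_policies P \<Longrightarrow> i \<in> regimes P \<Longrightarrow> Winf q i \<le> policy_value u hold q i"
  unfolding Winf_def by (intro SUP_least W_le_policy_value)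

lemma Winf_finite: "i \<in> regimes P \<Longrightarrow> Winf q i < \<top>"
  using Winf_le_policy_value[OF never_stationary] policy_value_never_finite by (rule le_less_trans)

text \<open>The iterates increase, so monotone convergence takes \<open>opt_op\<close> through the
  limit. \<open>Winf\<close> is thus a supersolution, the property from which the upper bound for
  the greedy policy is drawn.\<close>

lemma opt_op_Winf:
  assumes i: "i \<in> regimes P"
  shows "opt_op Winf q i \<le> Winf q i"
proof -
  note lim = Winf_lim
  have "(\<lambda>n. \<integral>\<^sup>+x. min (esc + W n (q + 1) i) (automation_cost i x + W n q i) \<partial>score_law P)
     \<longlonglongrightarrow> (\<integral>\<^sup>+x. min (esc + Winf (q + 1) i) (automation_cost i x + Winf q i) \<partial>score_law P)"
  proof (rule nn_integral_LIMSEQ)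
    show "incseq (\<lambda>n x. min (esc + W n (q + 1) i) (automation_cost i x + W n q i))"
      by (intro incseq_SucI le_funI min.mono add_left_mono W_mono i)
    show "(\<lambda>n. min (esc + W n (q + 1) i) (automation_cost i x + W n q i)) \<longlonglongrightarrow> min (esc + Winf (q + 1) i) (automation_cost i x + Winf q i)" for x
      by (intro tendsto_min tendsto_add tendsto_const lim i)
  qed measurable
  moreover have "(\<lambda>n. rest (W n) q i) \<longlonglongrightarrow> rest Winf q i"
    unfolding rest_def
    by (intro tendsto_add tendsto_sum ennreal_tendsto_cmult lim i) (auto simp: of_nat_less_top)
  ultimately have "(\<lambda>n. opt_op (W n) q i) \<longlonglongrightarrow> opt_op Winf q i"
    unfolding opt_op_def by (intro ennreal_tendsto_cmult tendsto_add tendsto_const) auto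
  then show ?thesis
  proof (rule LIMSEQ_le_const2, intro exI allI impI)
    fix n show "opt_op (W n) q i \<le> Winf q i" unfolding Winf_def W_simps(2)[symmetric] by (rule SUP_upper) simp
  qed
qed

section \<open>The greedy policy attains the limit of value iteration\<close>

definition greedy :: policy where
  "greedy q i s \<longleftrightarrow> esc + Winf (q + 1) i \<le> automation_cost i s + Winf q i"

lemma greedy_stationary: "greedy \<in> stationary_policies P"
proof -
  have "Measurable.pred borel (greedy q i)" for q i unfolding greedy_def[abs_def] by measurable
  then show ?thesis by (auto simp: stationary_policies_def intro: measurable_restrict_space1)
qed

lemma policy_op_greedy:
  assumes i: "i \<in> regimes P"
  shows "policy_op greedy hold Winf q i \<le> Winf q i"
proof -
  have "(\<integral>\<^sup>+x. stage_cost (clamp greedy) q i x + (if clamp greedy q i x then Winf (q + 1) i else Winf q i) \<partial>score_law P)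
    = (\<integral>\<^sup>+x. min (esc + Winf (q + 1) i) (automation_cost i x + Winf q i) \<partial>score_law P)"
    by (intro nn_integral_cong_AE, use AE_score_law[OF model] in eventually_elim)
      (auto simp: stage_cost_def clamp_def greedy_def i min_def)
  then have "policy_op greedy hold Winf q i = opt_op Winf q i" by (simp add: policy_op_def opt_op_def)
  then show ?thesis using opt_op_Winf[OF i] by simp
qed

text \<open>Bounded by \<open>hold N\<close>, dominated by \<open>hold\<close>, increasing in
  \<open>N\<close>, and equal to \<open>hold q\<close> as soon as \<open>N\<close> reaches
  \<open>q\<close>.\<close>

definition truncated_hold :: "nat \<Rightarrow> nat \<Rightarrow> ennreal" where
  "truncated_hold N q = (if q \<le> N then hold q else 0)"

text \<open>
  With truncated holding costs the value of the greedy policy is bounded, so that contraction applies; for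
  the full holding cost that value might a priori be infinite.
\<close>

lemma truncated_value_le:
  assumes "i \<in> regimes P"
  shows "policy_value greedy (truncated_hold N) q i \<le> Winf q i"
proof -
  let ?V = "policy_value greedy (truncated_hold N)"
  define B where "B = ennreal (holding_cost P N / \<alpha>) + ennreal (cost_bound * (\<nu> / \<alpha>))"
  define \<beta> where "\<beta> = \<Lambda> / (\<alpha> + \<Lambda>)"
  have \<beta>: "0 \<le> \<beta>" "\<beta> < 1" using \<Lambda>_pos params by (auto simp: \<beta>_def)
  have "truncated_hold N q' \<le> ennreal (holding_cost P N)" for q'
    using hold_mono[of q' N] by (simp add: truncated_hold_def flip: hold_def)
  then have bound: "?V q i \<le> B" for q i
    unfolding B_def by (rule policy_value_bound[OF _ holding_cost_nonneg])
  \<comment> \<open>Each application of \<open>policy_op greedy\<close> returns the supersolution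
    \<open>Winf\<close> to at most itself and shrinks the excess by the factor
    \<open>\<beta>\<close>; the crude bound \<open>B\<close> starts the induction.\<close>
  have "\<forall>q. \<forall>i\<in>regimes P. ?V q i \<le> Winf q i + ennreal (\<beta> ^ n) * B" for n
  proof (induction n)
    case 0
    then show ?case using bound by (auto intro: add_increasing)
  next
    case (Suc n)
    show ?case
    proof (intro allI ballI)
      fix q i assume i: "i \<in> regimes P"
      have "?V q i = policy_op greedy (truncated_hold N) ?V q i"
        by (rule policy_value_fixed_point[OF greedy_stationary i])
      also have "\<dots> \<le> policy_op greedy hold ?V q i"
        unfolding policy_op_def by (intro mult_left_mono add_right_mono) (auto simp: truncated_hold_def)
      also have "\<dots> \<le> policy_op greedy hold (\<lambda>q i. Winf q i + ennreal (\<beta> ^ n) * B) q i"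
        using Suc by (intro policy_op_mono[OF _ i]) auto
      also have "\<dots> = policy_op greedy hold Winf q i + ennreal \<beta> * (ennreal (\<beta> ^ n) * B)"
        unfolding \<beta>_def by (rule policy_op_add[OF greedy_stationary i])
      also have "\<dots> \<le> Winf q i + ennreal \<beta> * (ennreal (\<beta> ^ n) * B)"
        by (intro add_right_mono policy_op_greedy i)
      also have "ennreal \<beta> * (ennreal (\<beta> ^ n) * B) = ennreal (\<beta> ^ Suc n) * B"
        using \<beta> by (simp add: ennreal_mult mult.assoc)
      finally show "?V q i \<le> Winf q i + ennreal (\<beta> ^ Suc n) * B" .
    qed
  qed
  then have le: "?V q i \<le> Winf q i + B * ennreal (\<beta> ^ n)" for n using assms by (simp add: mult.commute)
  have "(\<lambda>n. \<beta> ^ n) \<longlonglongrightarrow> 0" using \<beta> by (intro LIMSEQ_realpow_zero) auto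
  then have "(\<lambda>n. Winf q i + B * ennreal (\<beta> ^ n)) \<longlonglongrightarrow> Winf q i + B * ennreal 0"
    by (intro tendsto_add tendsto_const ennreal_tendsto_cmult tendsto_ennrealI) (simp_all add: B_def)
  then show ?thesis using le by (intro LIMSEQ_le_const) auto
qed

text \<open>Monotone convergence in \<open>N\<close> is applied twice, to the time integral on each
  path and to the expectation over paths.\<close>

lemma policy_value_greedy:
  assumes i: "i \<in> regimes P"
  shows "policy_value greedy hold q i \<le> Winf q i"
proof -
  let ?c = "\<lambda>N. total_cost P (clamp greedy) (truncated_hold N) (stage_cost (clamp greedy)) q i"
  have mono: "truncated_hold N k \<le> truncated_hold (Suc N) k" for N k by (simp add: truncated_hold_def)
  have lim: "(\<lambda>N. truncated_hold N k) \<longlonglongrightarrow> hold k" for k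
    by (rule tendsto_eventually, rule eventually_sequentiallyI[of k]) (simp add: truncated_hold_def)
  note ql = measurable_queue_length_time[OF params(4) measurable_clamp[OF greedy_stationary]]
  have "(\<lambda>N. \<integral>\<^sup>+\<omega>. ?c N \<omega> \<partial>\<Omega>) \<longlonglongrightarrow> (\<integral>\<^sup>+\<omega>. total_cost P (clamp greedy) hold (stage_cost (clamp greedy)) q i \<omega> \<partial>\<Omega>)"
  proof (rule nn_integral_LIMSEQ)
    show "incseq ?c"
    proof (intro incseq_SucI le_funI)
      fix N \<omega>
      show "?c N \<omega> \<le> ?c (Suc N) \<omega>"
        unfolding total_cost_def
        by (auto split: prod.split intro!: add_right_mono nn_integral_mono mult_right_mono mult_left_mono mono)
    qed
    fix N
    interpret hybrid_policy P "clamp greedy" "truncated_hold N" "stage_cost (clamp greedy)"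
      by (rule hybrid_policy_clamp[OF greedy_stationary])
    show "?c N \<in> borel_measurable \<Omega>" by (rule measurable_C)
  next
    fix \<omega> :: sample
    obtain a s \<sigma> e \<xi> where \<omega>: "\<omega> = (a, s, \<sigma>, e, \<xi>)" by (cases \<omega>)
    have "(\<lambda>N. \<integral>\<^sup>+t\<in>{0..}. ennreal (exp (- \<alpha> * t)) * truncated_hold N (queue_length P (clamp greedy) q i \<omega> t) \<partial>lborel)
      \<longlonglongrightarrow> (\<integral>\<^sup>+t\<in>{0..}. ennreal (exp (- \<alpha> * t)) * hold (queue_length P (clamp greedy) q i \<omega> t) \<partial>lborel)"
    proof (rule nn_integral_LIMSEQ)
      show "incseq (\<lambda>N t. ennreal (exp (- \<alpha> * t)) * truncated_hold N (queue_length P (clamp greedy) q i \<omega> t) * indicator {0..} t)"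
        by (intro incseq_SucI le_funI mult_right_mono mult_left_mono mono) auto
      fix N
      have "(\<lambda>t. truncated_hold N (queue_length P (clamp greedy) q i \<omega> t)) \<in> borel_measurable lborel"
        using measurable_compose[OF ql, of "truncated_hold N"] by simp
      then show "(\<lambda>t. ennreal (exp (- \<alpha> * t)) * truncated_hold N (queue_length P (clamp greedy) q i \<omega> t) * indicator {0..} t) \<in> borel_measurable lborel"
        by measurable
    next
      fix t
      have "(\<lambda>N. indicator {0..} t * (ennreal (exp (- \<alpha> * t)) * truncated_hold N (queue_length P (clamp greedy) q i \<omega> t)))
         \<longlonglongrightarrow> indicator {0..} t * (ennreal (exp (- \<alpha> * t)) * hold (queue_length P (clamp greedy) q i \<omega> t))"
        by (intro ennreal_tendsto_cmult lim) (auto simp: indicator_def)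
      then show "(\<lambda>N. ennreal (exp (- \<alpha> * t)) * truncated_hold N (queue_length P (clamp greedy) q i \<omega> t) * indicator {0..} t)
         \<longlonglongrightarrow> ennreal (exp (- \<alpha> * t)) * hold (queue_length P (clamp greedy) q i \<omega> t) * indicator {0..} t"
        by (simp only: mult.commute[of "indicator {0..} t"])
    qed
    then show "(\<lambda>N. ?c N \<omega>) \<longlonglongrightarrow> total_cost P (clamp greedy) hold (stage_cost (clamp greedy)) q i \<omega>"
      unfolding total_cost_def \<omega> prod.case by (intro tendsto_add tendsto_const)
  qed
  then show ?thesis
    unfolding policy_value_def
  proof (rule LIMSEQ_le_const2, intro exI allI impI)
    fix N show "(\<integral>\<^sup>+\<omega>. ?c N \<omega> \<partial>\<Omega>) \<le> Winf q i" using truncated_value_le[OF i, of N q] by (simp add: policy_value_def)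
  qed
qed

lemma optimal_value_eq:
  assumes i: "i \<in> regimes P"
  shows "optimal_value P q i = Winf q i"
proof (rule antisym)
  have "optimal_value P q i \<le> policy_cost P greedy q i"
    unfolding optimal_value_def by (rule INF_lower) (rule greedy_stationary)
  then show "optimal_value P q i \<le> Winf q i"
    using policy_value_greedy[OF i, of q] by (simp add: policy_cost_eq[OF i])
  show "Winf q i \<le> optimal_value P q i"
    unfolding optimal_value_def by (rule INF_greatest) (simp add: policy_cost_eq[OF i] Winf_le_policy_value[OF _ i])
qed

lemma increasing_convex_Winf:
  assumes i: "i \<in> regimes P"
  shows "increasing_convex (\<lambda>q. Winf q i)"
proof (rule increasing_convexI)
  fix q
  show "Winf q i \<le> Winf (q + 1) i"
    using increasing_convexD(1)[OF increasing_convex_W[OF i]] by (intro LIMSEQ_le[OF Winf_lim[OF i] Winf_lim[OF i]]) auto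
  show "Winf (q + 1) i + Winf (q + 1) i \<le> Winf q i + Winf (q + 2) i"
    using increasing_convexD(2)[OF increasing_convex_W[OF i]]
    by (intro LIMSEQ_le[OF tendsto_add[OF Winf_lim[OF i] Winf_lim[OF i]] tendsto_add[OF Winf_lim[OF i] Winf_lim[OF i]]]) auto
qed

end

text \<open>Finiteness accompanies convexity because \<open>value_increment\<close> uses
  \<open>enn2real\<close>, which sends an infinite value to 0; only for finite values are the
  increments the intended differences.\<close>

theorem proposition1:
  fixes P :: hybrid_params
  assumes "hybrid_model P"
  shows "(\<forall>q. \<forall>i\<in>regimes P. optimal_value P q i < \<top>) \<and>
         (\<forall>q. \<forall>i\<in>regimes P. value_increment P (q + 1) i \<ge> value_increment P q i)"
proof -
  interpret hybrid P by unfold_locales (rule assms)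
  have "value_increment P q i \<le> value_increment P (q + 1) i" if i: "i \<in> regimes P" for q i
  proof -
    obtain F where F: "\<And>q. 0 \<le> F q" "(\<lambda>q. Winf q i) = (\<lambda>q. ennreal (F q))"
      "\<And>q. F (q + 1) + F (q + 1) \<le> F q + F (q + 2)"
      using increasing_convex_real[OF increasing_convex_Winf[OF i] Winf_finite[OF i]] by metis
    have "enn2real (optimal_value P q i) = F q" for q
      using fun_cong[OF F(2), of q] F(1)[of q] by (simp add: optimal_value_eq[OF i])
    then show ?thesis using F(3)[of q] by (simp add: value_increment_def)
  qed
  then show ?thesis by (simp add: optimal_value_eq Winf_finite)
qed

end
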